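(* Let $X,X_1,X_2,\dots$ be i.i.d. real random variables and consider Efron's bootstrap: for each $b\ge1$ and $n\ge1$, $(w_1^{(n)}(b),\ldots,w_n^{(n)}(b))$ has the multinomial distribution of size $m_n$ with probabilities $(\frac1n,\ldots,\frac1n)$, the sets of weights for different $b$ being i.i.d. and independent of the data. Let $0<\alpha\le1$, let $z_\alpha$ be defined by $P(Z\le z_\alpha)=\alpha$ with $Z$ standard normal, and let $C^{(B)}_{1,\alpha},C^{(B)}_{2,\alpha},C^{(B)}_{3,\alpha}$ be the bootstrap quantiles defined in the context. All limits are as $n,m_n,B\to\infty$. (a) Assume $0<\mathrm{var}(X)<\infty$. If $m_n=o(n^2)$, then $C^{(B)}_{1,\alpha}\to z_\alpha$ in probability-$\bigotimes_{b=1}^\infty P_{X,w(b)}$. If $m_n=o(n^2)$ and $n=o(m_n)$, then $C^{(B)}_{2,\alpha}\to z_\alpha$ in probability-$\bigotimes_{b=1}^\infty P_{X,w(b)}$. (b) Assume $X\in DAN$ and that either $\frac{m_n}{2n\log n}\to\infty$, or $E_XX^2<\infty$ and $m_n/n\to\infty$. Then $C^{(B)}_{2,\alpha}\to z_\alpha$ in probability-$\bigotimes_{b=1}^\infty P_{X,w(b)}$. (c) Assume $X\in DAN$ and that, for an arbitrary $\varepsilon>0$, $\frac{m_n}{n}\ge\varepsilon>0$. Then $C^{(B)}_{3,\alpha}\to z_\alpha$ in probability-$\bigotimes_{b=1}^\infty P_{X,w(b)}$.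
   Context: $X\in DAN$ means that $X$ is in the domain of attraction of the normal law (possibly with infinite variance): there are constants $a_n\in\mathbb R$, $b_n>0$ with $b_n^{-1}(\sum_{i=1}^nX_i-a_n)\to N(0,1)$ in distribution. For $\alpha=1$, $z_\alpha=+\infty$. $\bigotimes_{b=1}^\infty P_{X,w(b)}$ denotes the joint probability of a single data sequence $X_1,X_2,\ldots$ and the array of i.i.d. sets of weights $w(b)$, $b\ge1$, which are independent of the data; all $B$ bootstrap sub-samples are based on the same data. Put $\bar X_n=\frac1n\sum_{i=1}^nX_i$, $S_n^2=\frac1n\sum_{i=1}^n(X_i-\bar X_n)^2$, and for $1\le b\le B$, $\bar X^*_{m_n}(b)=\frac1{m_n}\sum_{i=1}^nw_i^{(n)}(b)X_i$, $S^{*2}_{m_n}(b)=\frac1{m_n}\sum_{i=1}^nw_i^{(n)}(b)(X_i-\bar X^*_{m_n}(b))^2$ (the variance, with divisor $m_n$, of the $b$-th bootstrap sample), and $$T^*_{m_n}(b)=\frac{\sum_{i=1}^n\big(\frac{w_i^{(n)}(b)}{m_n}-\frac1n\big)X_i}{S_n\sqrt{\sum_{i=1}^n\big(\frac{w_i^{(n)}(b)}{m_n}-\frac1n\big)^2}},\quad T^{**}_{m_n}(b)=\frac{\sum_{i=1}^n\big(\frac{w_i^{(n)}(b)}{m_n}-\frac1n\big)X_i}{S^*_{m_n}(b)/\sqrt{m_n}},\quad T^{**}_{m_n,S_n}(b)=\frac{\sum_{i=1}^n\big(\frac{w_i^{(n)}(b)}{m_n}-\frac1n\big)X_i}{S_n/\sqrt{m_n}}.$$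 Define $$C^{(B)}_{1,\alpha}=\inf\Big\{t:\frac1B\sum_{b=1}^BI(T^*_{m_n}(b)\le t)\ge\alpha\Big\},\quad C^{(B)}_{2,\alpha}=\inf\Big\{t:\frac1B\sum_{b=1}^BI(T^{**}_{m_n}(b)\le t)\ge\alpha\Big\},$$ $$C^{(B)}_{3,\alpha}=\inf\Big\{t:\frac1B\sum_{b=1}^BI(T^{**}_{m_n,S_n}(b)\le t)\ge\alpha\Big\}.$$ *)

theory Defs
  imports "HOL-Probability.Probability" "HOL-Library.Landau_Symbols"
begin

section \<open>Data and weights\<close>

text \<open>Data and weights carry indices starting from 1. The generic copy \<open>X\<close> only serves to name the
  common law, so its independence of the sample is not required.\<close>

definition iid_sample :: "'a measure \<Rightarrow> ('a \<Rightarrow> real) \<Rightarrow> (nat \<Rightarrow> 'a \<Rightarrow> real) \<Rightarrow> bool" where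
  "iid_sample M X Xs \<longleftrightarrow>
     X \<in> borel_measurable M \<and>
     prob_space.indep_vars M (\<lambda>_. borel) Xs {1..} \<and>
     (\<forall>i\<ge>1. distr M borel (Xs i) = distr M borel X)"

text \<open>Domain of attraction of the normal law, for an i.i.d. sequence.\<close>

definition DAN :: "'a measure \<Rightarrow> (nat \<Rightarrow> 'a \<Rightarrow> real) \<Rightarrow> bool" where
  "DAN M Xs \<longleftrightarrow>
     (\<exists>a b :: nat \<Rightarrow> real. (\<forall>n. b n > 0) \<and>
        weak_conv_m (\<lambda>n. distr M borel (\<lambda>\<omega>. ((\<Sum>i=1..n. Xs i \<omega>) - a n) / b n))
          std_normal_distribution)"

definition multinomial_distributed ::
  "'a measure \<Rightarrow> nat \<Rightarrow> 'i set \<Rightarrow> ('i \<Rightarrow> real) \<Rightarrow> ('i \<Rightarrow> 'a \<Rightarrow> nat) \<Rightarrow> bool" where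
  "multinomial_distributed M N I p V \<longleftrightarrow>
     (\<forall>i\<in>I. V i \<in> measurable M (count_space UNIV)) \<and>
     (\<forall>k :: 'i \<Rightarrow> nat. measure M {\<omega> \<in> space M. \<forall>i\<in>I. V i \<omega> = k i} =
        (if (\<Sum>i\<in>I. k i) = N then fact N / (\<Prod>i\<in>I. fact (k i)) * (\<Prod>i\<in>I. p i ^ k i) else 0))"

text \<open>Independence of two random elements. The library's \<^const>\<open>prob_space.indep_var\<close> forces both to
  take values in the same type; this is its characterization \<open>indep_var_eq\<close> without that restriction.\<close>

definition indep_elements ::
  "'a measure \<Rightarrow> 'b measure \<Rightarrow> ('a \<Rightarrow> 'b) \<Rightarrow> 'c measure \<Rightarrow> ('a \<Rightarrow> 'c) \<Rightarrow> bool" where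
  "indep_elements M S Y T Z \<longleftrightarrow>
     Y \<in> measurable M S \<and> Z \<in> measurable M T \<and>
     prob_space.indep_set M
       (sigma_sets (space M) {Y -` A \<inter> space M | A. A \<in> sets S})
       (sigma_sets (space M) {Z -` A \<inter> space M | A. A \<in> sets T})"

text \<open>\<open>w b n i\<close> is the weight of the \<open>i\<close>-th of the first \<open>n\<close> observations in the \<open>b\<close>-th bootstrap
  sample. For each sample size \<open>n\<close> the weight vectors are independent over \<open>b\<close>, and identically
  distributed because their law is given explicitly; all of them together are independent of the
  whole data sequence. The joint law for different \<open>n\<close> is left open.\<close>

definition efron_weights ::
  "'a measure \<Rightarrow> (nat \<Rightarrow> 'a \<Rightarrow> real) \<Rightarrow> (nat \<Rightarrow> nat) \<Rightarrow> (nat \<Rightarrow> nat \<Rightarrow> nat \<Rightarrow> 'a \<Rightarrow> nat) \<Rightarrow> bool" where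
  "efron_weights M Xs m w \<longleftrightarrow>
     (\<forall>n\<ge>1.
        (\<forall>b\<ge>1. multinomial_distributed M (m n) {1..n} (\<lambda>i. 1 / real n) (w b n)) \<and>
        prob_space.indep_vars M (\<lambda>b. PiM {1..n} (\<lambda>i. count_space UNIV))
          (\<lambda>b \<omega>. \<lambda>i\<in>{1..n}. w b n i \<omega>) {1..} \<and>
        indep_elements M
          (PiM {1..} (\<lambda>i. borel)) (\<lambda>\<omega>. \<lambda>i\<in>{1..}. Xs i \<omega>)
          (PiM ({1..} \<times> {1..n}) (\<lambda>(b, i). count_space UNIV))
          (\<lambda>\<omega>. \<lambda>(b, i) \<in> {1..} \<times> {1..n}. w b n i \<omega>))"


section \<open>Statistics\<close>

text \<open>Below, \<open>x\<close> is a realization of the data and \<open>v\<close> one of the weights of size \<open>m\<close>. In the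
  exceptional case of a vanishing denominator the quotients take the value 0.\<close>

definition sample_mean :: "nat \<Rightarrow> (nat \<Rightarrow> real) \<Rightarrow> real" where
  "sample_mean n x = (\<Sum>i=1..n. x i) / real n"

definition sample_var :: "nat \<Rightarrow> (nat \<Rightarrow> real) \<Rightarrow> real" where
  "sample_var n x = (\<Sum>i=1..n. (x i - sample_mean n x)\<^sup>2) / real n"

definition boot_mean :: "nat \<Rightarrow> nat \<Rightarrow> (nat \<Rightarrow> nat) \<Rightarrow> (nat \<Rightarrow> real) \<Rightarrow> real" where
  "boot_mean n m v x = (\<Sum>i=1..n. real (v i) * x i) / real m"

definition boot_var :: "nat \<Rightarrow> nat \<Rightarrow> (nat \<Rightarrow> nat) \<Rightarrow> (nat \<Rightarrow> real) \<Rightarrow> real" where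
  "boot_var n m v x = (\<Sum>i=1..n. real (v i) * (x i - boot_mean n m v x)\<^sup>2) / real m"

text \<open>\<open>T1\<close>, \<open>T2\<close>, \<open>T3\<close> are \<open>T*\<close>, \<open>T**\<close> and the version of \<open>T**\<close> normalized by \<open>S\<^sub>n\<close>.\<close>

definition T1 :: "nat \<Rightarrow> nat \<Rightarrow> (nat \<Rightarrow> nat) \<Rightarrow> (nat \<Rightarrow> real) \<Rightarrow> real" where
  "T1 n m v x =
     (\<Sum>i=1..n. (real (v i) / real m - 1 / real n) * x i) /
     (sqrt (sample_var n x) * sqrt (\<Sum>i=1..n. (real (v i) / real m - 1 / real n)\<^sup>2))"

definition T2 :: "nat \<Rightarrow> nat \<Rightarrow> (nat \<Rightarrow> nat) \<Rightarrow> (nat \<Rightarrow> real) \<Rightarrow> real" where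
  "T2 n m v x =
     (\<Sum>i=1..n. (real (v i) / real m - 1 / real n) * x i) /
     (sqrt (boot_var n m v x) / sqrt (real m))"

definition T3 :: "nat \<Rightarrow> nat \<Rightarrow> (nat \<Rightarrow> nat) \<Rightarrow> (nat \<Rightarrow> real) \<Rightarrow> real" where
  "T3 n m v x =
     (\<Sum>i=1..n. (real (v i) / real m - 1 / real n) * x i) /
     (sqrt (sample_var n x) / sqrt (real m))"

text \<open>For \<open>0 < \<alpha> \<le> 1\<close> and \<open>B \<ge> 1\<close> the set is nonempty and bounded below, so the infimum is genuine.\<close>

definition empirical_quantile :: "real \<Rightarrow> nat \<Rightarrow> (nat \<Rightarrow> real) \<Rightarrow> real" where
  "empirical_quantile \<alpha> B T = Inf {t. (\<Sum>b=1..B. of_bool (T b \<le> t)) / real B \<ge> \<alpha>}"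

text \<open>\<open>boot_quantile T m Xs w \<alpha> (n, B)\<close> is the quantile computed from \<open>B\<close> bootstrap samples of the
  same first \<open>n\<close> observations.\<close>

definition boot_quantile ::
  "(nat \<Rightarrow> nat \<Rightarrow> (nat \<Rightarrow> nat) \<Rightarrow> (nat \<Rightarrow> real) \<Rightarrow> real) \<Rightarrow> (nat \<Rightarrow> nat) \<Rightarrow>
   (nat \<Rightarrow> 'a \<Rightarrow> real) \<Rightarrow> (nat \<Rightarrow> nat \<Rightarrow> nat \<Rightarrow> 'a \<Rightarrow> nat) \<Rightarrow> real \<Rightarrow> nat \<times> nat \<Rightarrow> 'a \<Rightarrow> real" where
  "boot_quantile T m Xs w \<alpha> = (\<lambda>(n, B) \<omega>.
     empirical_quantile \<alpha> B (\<lambda>b. T n (m n) (\<lambda>i. w b n i \<omega>) (\<lambda>i. Xs i \<omega>)))"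


section \<open>Convergence in probability to a possibly infinite constant\<close>

definition tendsto_in_prob ::
  "'a measure \<Rightarrow> ('k \<Rightarrow> 'a \<Rightarrow> real) \<Rightarrow> ereal \<Rightarrow> 'k filter \<Rightarrow> bool" where
  "tendsto_in_prob M Y l F \<longleftrightarrow>
     (\<forall>k. Y k \<in> borel_measurable M) \<and>
     (\<forall>U. open U \<longrightarrow> l \<in> U \<longrightarrow>
        ((\<lambda>k. measure M {\<omega> \<in> space M. ereal (Y k \<omega>) \<notin> U}) \<longlongrightarrow> 0) F)"

lemma tendsto_in_prob_real_iff:
  assumes "prob_space M"
  shows "tendsto_in_prob M Y (ereal r) F \<longleftrightarrow>
     (\<forall>k. Y k \<in> borel_measurable M) \<and>
     (\<forall>\<epsilon>>0. ((\<lambda>k. measure M {\<omega> \<in> space M. \<bar>Y k \<omega> - r\<bar> > \<epsilon>}) \<longlongrightarrow> 0) F)"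
proof -
  interpret prob_space M by fact
  show ?thesis
  proof (cases "\<forall>k. Y k \<in> borel_measurable M")
    case True
    hence [measurable]: "\<And>k. Y k \<in> borel_measurable M" by auto
    show ?thesis
    proof (intro iffI conjI allI impI)
      fix \<epsilon> :: real assume L: "tendsto_in_prob M Y (ereal r) F" and "\<epsilon> > 0"
      let ?U = "{ereal (r - \<epsilon>) <..< ereal (r + \<epsilon>)}"
      have "((\<lambda>k. prob {\<omega> \<in> space M. ereal (Y k \<omega>) \<notin> ?U}) \<longlongrightarrow> 0) F"
        using L \<open>\<epsilon> > 0\<close> unfolding tendsto_in_prob_def by (auto dest!: spec[of _ ?U])
      thus "((\<lambda>k. prob {\<omega> \<in> space M. \<bar>Y k \<omega> - r\<bar> > \<epsilon>}) \<longlongrightarrow> 0) F"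
        by (rule tendsto_sandwich[rotated 3, where f = "\<lambda>_. 0"])
           (auto intro!: always_eventually finite_measure_mono)
    next
      assume R: "(\<forall>k. Y k \<in> borel_measurable M) \<and>
        (\<forall>\<epsilon>>0. ((\<lambda>k. prob {\<omega> \<in> space M. \<bar>Y k \<omega> - r\<bar> > \<epsilon>}) \<longlongrightarrow> 0) F)"
      show "tendsto_in_prob M Y (ereal r) F"
        unfolding tendsto_in_prob_def
      proof (intro conjI allI impI)
        fix U :: "ereal set" assume U: "open U" "ereal r \<in> U"
        have "open (ereal -` U)" using U(1) by (rule open_ereal_vimage)
        then obtain e where e: "e > 0" "\<And>y. dist y r < e \<Longrightarrow> ereal y \<in> U"
          using U(2) unfolding open_dist by auto
        have "((\<lambda>k. prob {\<omega> \<in> space M. \<bar>Y k \<omega> - r\<bar> > e / 2}) \<longlongrightarrow> 0) F"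
          using R half_gt_zero[OF e(1)] by blast
        thus "((\<lambda>k. prob {\<omega> \<in> space M. ereal (Y k \<omega>) \<notin> U}) \<longlongrightarrow> 0) F"
          by (rule tendsto_sandwich[rotated 3, where f = "\<lambda>_. 0"])
             (use e in \<open>force intro!: always_eventually finite_measure_mono simp: dist_real_def\<close>)+
      qed (use True in auto)
    qed (use True in auto)
  qed (auto simp: tendsto_in_prob_def)
qed

lemma tendsto_in_prob_PInf_iff:
  assumes "prob_space M"
  shows "tendsto_in_prob M Y \<infinity> F \<longleftrightarrow>
     (\<forall>k. Y k \<in> borel_measurable M) \<and>
     (\<forall>K. ((\<lambda>k. measure M {\<omega> \<in> space M. Y k \<omega> \<le> K}) \<longlongrightarrow> 0) F)"
proof -
  interpret prob_space M by fact
  show ?thesis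
  proof (cases "\<forall>k. Y k \<in> borel_measurable M")
    case True
    hence [measurable]: "\<And>k. Y k \<in> borel_measurable M" by auto
    show ?thesis
    proof (intro iffI conjI allI impI)
      fix K :: real assume L: "tendsto_in_prob M Y \<infinity> F"
      have "((\<lambda>k. prob {\<omega> \<in> space M. ereal (Y k \<omega>) \<notin> {ereal K<..}}) \<longlongrightarrow> 0) F"
        using L unfolding tendsto_in_prob_def by (auto dest!: spec[of _ "{ereal K<..}"])
      thus "((\<lambda>k. prob {\<omega> \<in> space M. Y k \<omega> \<le> K}) \<longlongrightarrow> 0) F"
        by (simp add: not_less)
    next
      assume R: "(\<forall>k. Y k \<in> borel_measurable M) \<and>
        (\<forall>K. ((\<lambda>k. prob {\<omega> \<in> space M. Y k \<omega> \<le> K}) \<longlongrightarrow> 0) F)"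
      show "tendsto_in_prob M Y \<infinity> F"
        unfolding tendsto_in_prob_def
      proof (intro conjI allI impI)
        fix U :: "ereal set" assume U: "open U" "\<infinity> \<in> U"
        then obtain K where K: "{ereal K<..} \<subseteq> U" using open_PInfty by blast
        have *: "{\<omega> \<in> space M. ereal (Y k \<omega>) \<notin> U} \<subseteq> {\<omega> \<in> space M. Y k \<omega> \<le> K}" for k
          using K by (auto simp: subset_iff simp flip: not_less)
        have "((\<lambda>k. prob {\<omega> \<in> space M. Y k \<omega> \<le> K}) \<longlongrightarrow> 0) F"
          using R by simp
        thus "((\<lambda>k. prob {\<omega> \<in> space M. ereal (Y k \<omega>) \<notin> U}) \<longlongrightarrow> 0) F"
          by (rule tendsto_sandwich[rotated 3, where f = "\<lambda>_. 0"])
             (auto intro!: always_eventually finite_measure_mono *)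
      qed (use True in auto)
    qed (use True in auto)
  qed (auto simp: tendsto_in_prob_def)
qed

end

theory Submission
  imports Defs "HOL-Combinatorics.Multiset_Permutations"
begin

text \<open>
Given the data, a bootstrap sample consists of \<open>m\<close> indices drawn independently and uniformly from
\<open>{1..n}\<close>, and the weight of an observation is the number of times its index is drawn
(\<open>prob_resample_counts\<close>). In terms of the standardized data \<open>y i = (x i - mean) / S\<close> the statistic
\<open>T3\<close> is the sum of the \<open>y\<close>-values of the drawn indices, divided by the root of \<open>m\<close>. This is a normalized
sum of independent, identically distributed terms of mean 0 and variance 1, so it is conditionally
close to normal if the data satisfy a Lindeberg condition: the terms \<open>(y i)\<^sup>2\<close> that exceed \<open>\<delta> * m\<close>
contribute at most \<open>\<delta>\<close> to the mean of all \<open>(y i)\<^sup>2\<close> (\<open>bootstrap_clt_T3\<close>). The statistics \<open>T1\<close> and \<open>T2\<close>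
are quotients of \<open>T3\<close> by factors that tend to 1. For \<open>T1\<close> the factor depends on the number of
coincidences among the drawn indices, whose fluctuations are negligible. For \<open>T2\<close> it is governed by a
weak law of large numbers for the \<open>(y i)\<^sup>2\<close>, and the Lindeberg condition is just what this law requires.

All \<open>B\<close> bootstrap samples share the same data, but they are conditionally independent. The second
moment of the deviation of their empirical distribution function from the normal one is therefore at
most \<open>1 / B\<close> plus the mean square of the conditional deviation (\<open>boot_cdf_second_moment\<close>), so the
empirical distribution function converges in probability at every point. Since the normal
distribution function is strictly increasing and less than 1, the quantiles converge as well, to \<open>\<infinity>\<close>
if \<open>\<alpha> = 1\<close> (\<open>boot_quantile_converges\<close>).

It remains to see that the data satisfy the Lindeberg condition with probability tending to 1. For
finite variance this is dominated convergence for the truncated second moment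
(\<open>lindeberg_finite_variance\<close>). In the domain of attraction of the normal law, with \<open>m \<ge> \<epsilon> * n\<close>, it
suffices that the largest deviation is negligible against the root of the sum of squares
(\<open>lindeberg_normal_attraction\<close>). Let \<open>b n\<close> be the norming constants, \<open>cf\<close> the characteristic function of
\<open>X\<close>, and \<open>Y\<close> the difference of two observations. Then \<open>(norm (cf (t / b n)))\<^sup>2\<close> is the expectation of
\<open>cos (t * Y / b n)\<close>, and the normal limit means that \<open>n\<close> times the expectation of
\<open>1 - cos (t * Y / b n)\<close> tends to \<open>t\<^sup>2\<close>. Because of the doubling formula for the cosine, \<open>n\<close> times the
expectation of \<open>(1 - cos (t * Y / b n))\<^sup>2\<close> tends to 0. Averaged over the frequencies \<open>t\<close>, this shows
that no difference among the first \<open>n\<close> observations is of order \<open>b n\<close>; applied to \<open>n div 2\<close> disjoint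
differences, the two limits show that the sum of squares is at least of order \<open>(b n)\<^sup>2\<close>, each time
with probability tending to 1.
\<close>

section \<open>Quantiles of empirical distributions and of the normal law\<close>

text \<open>The infimum defining the quantile is attained because the empirical distribution function is right
continuous. This turns every statement about quantiles into one about the values of the empirical
distribution function at fixed points.\<close>

lemma empirical_quantile_le_iff:
  assumes "0 < \<alpha>" "\<alpha> \<le> 1" "0 < B"
  shows "empirical_quantile \<alpha> B T \<le> a \<longleftrightarrow> \<alpha> \<le> (\<Sum>b=1..B. of_bool (T b \<le> a)) / real B"
proof -
  define F where "F t = (\<Sum>b=1..B. of_bool (T b \<le> t)) / real B" for t
  have mono: "F s \<le> F t" if "s \<le> t" for s t
    unfolding F_def using that by (intro divide_right_mono sum_mono) auto
  let ?A = "{t. F t \<ge> \<alpha>}"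
  have fin: "finite (T ` {1..B})" and ne: "T ` {1..B} \<noteq> {}" using assms by auto
  have "F (Max (T ` {1..B})) = (\<Sum>b=1..B. 1) / real B"
    unfolding F_def by (intro arg_cong2[where f = "(/)"] sum.cong refl) (use fin in auto)
  hence "F (Max (T ` {1..B})) = 1" using assms by simp
  hence "Max (T ` {1..B}) \<in> ?A" using assms by simp
  hence A_ne: "?A \<noteq> {}" by blast
  have "Min (T ` {1..B}) \<le> t" if "t \<in> ?A" for t
  proof (rule ccontr)
    assume "\<not> ?thesis"
    have "\<not> T b \<le> t" if "b \<in> {1..B}" for b
    proof -
      have "Min (T ` {1..B}) \<le> T b" using that by (intro Min_le fin) auto
      thus ?thesis using \<open>\<not> Min (T ` {1..B}) \<le> t\<close> by linarith
    qed
    hence "F t = 0" unfolding F_def by simp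
    thus False using that assms by simp
  qed
  hence bdd: "bdd_below ?A" by (rule bdd_belowI)
  have "\<alpha> \<le> F a" if "Inf ?A \<le> a"
  proof -
    \<comment> \<open>finitely many jumps, so the empirical distribution function is constant just to the right of \<open>a\<close>\<close>
    obtain a' where a': "a < a'" "\<forall>b\<in>{1..B}. T b \<le> a' \<longrightarrow> T b \<le> a"
    proof -
      define C where "C = insert (a + 1) {y \<in> T ` {1..B}. a < y}"
      define c where "c = Min C"
      have fC: "finite C" using fin by (auto simp: C_def)
      have pos: "a < c" using fC by (auto simp: C_def c_def)
      have c_le: "c \<le> T b" if "b \<in> {1..B}" "a < T b" for b
        unfolding c_def using that by (intro Min_le fC) (auto simp: C_def)
      show ?thesis
        by (rule that[of "(a + c) / 2"]) (use pos c_le in \<open>force simp: not_le[symmetric]\<close>)+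
    qed
    have "Inf ?A < a'" using that a' by simp
    then obtain t where t: "t \<in> ?A" "t < a'" using cInf_lessD[OF A_ne] by auto
    have "\<alpha> \<le> F a'" using t mono[of t a'] by simp
    also have "F a' \<le> F a"
      unfolding F_def using a' by (intro divide_right_mono sum_mono) auto
    finally show ?thesis .
  qed
  moreover have "Inf ?A \<le> a" if "\<alpha> \<le> F a" using that bdd by (intro cInf_lower) auto
  ultimately show ?thesis unfolding empirical_quantile_def F_def by blast
qed

abbreviation \<Phi> :: "real \<Rightarrow> real" where
  "\<Phi> \<equiv> cdf std_normal_distribution"

lemma std_normal_interval_pos:
  assumes "a < b"
  shows "0 < measure std_normal_distribution {a<..b}"
proof -
  interpret N: real_distribution std_normal_distribution by (rule real_dist_normal_dist)
  have "emeasure std_normal_distribution {a<..b} \<noteq> 0"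
  proof
    assume "emeasure std_normal_distribution {a<..b} = 0"
    hence "{a<..b} \<in> null_sets std_normal_distribution" by (auto simp: null_sets_def)
    hence "AE x in lborel. x \<in> {a<..b} \<longrightarrow> std_normal_density x \<le> 0"
      by (subst (asm) null_sets_density_iff) (auto simp: ennreal_eq_0_iff)
    hence "AE x in lborel. x \<notin> {a<..b}"
      by eventually_elim (use normal_density_pos[of 1 0] in \<open>auto simp: not_le[symmetric]\<close>)
    hence "emeasure lborel {a<..b} = 0"
      by (subst (asm) AE_iff_measurable[OF _ refl]) (auto simp: greaterThanAtMost_def greaterThan_def atMost_def Int_def)
    thus False using assms by simp
  qed
  thus ?thesis by (simp add: N.emeasure_eq_measure zero_less_measure_iff)
qed

lemma cdf_std_normal_strict_mono: "a < b \<Longrightarrow> \<Phi> a < \<Phi> b"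
proof -
  interpret N: real_distribution std_normal_distribution by (rule real_dist_normal_dist)
  show "a < b \<Longrightarrow> ?thesis" using std_normal_interval_pos[of a b] N.cdf_diff_eq[of a b] by simp
qed

lemma cdf_std_normal_less_1: "\<Phi> a < 1"
proof -
  interpret N: real_distribution std_normal_distribution by (rule real_dist_normal_dist)
  have "\<Phi> a < \<Phi> (a + 1)"
    by (intro cdf_std_normal_strict_mono) simp
  also have "\<dots> \<le> 1" by (rule N.cdf_bounded_prob)
  finally show ?thesis .
qed

lemma isCont_cdf_std_normal: "isCont (\<Phi>) a"
proof -
  interpret N: real_distribution std_normal_distribution by (rule real_dist_normal_dist)
  have "emeasure std_normal_distribution {a} = 0"
    by (subst emeasure_density) (auto simp: nn_integral_0_iff_AE)
  thus ?thesis by (simp add: N.isCont_cdf measure_def)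
qed

text \<open>The normal distribution function separates the points below \<open>z\<close> from those above it strictly. For
\<open>\<alpha> = 1\<close>, where \<open>z = \<infinity>\<close>, the first half says that it stays below 1 on the real line.\<close>

lemma cdf_at_normal_quantile:
  assumes "measure std_normal_distribution {x. ereal x \<le> z} = \<alpha>" "0 < \<alpha>"
  shows "ereal a < z \<Longrightarrow> \<Phi> a < \<alpha>"
    and "z < ereal a \<Longrightarrow> \<alpha> < \<Phi> a"
proof -
  interpret N: real_distribution std_normal_distribution by (rule real_dist_normal_dist)
  have z_PInf: "\<alpha> = 1" if "z = \<infinity>" using assms(1) that N.prob_space by simp
  have z_real: "\<alpha> = \<Phi> r" if "z = ereal r" for r
    using assms(1) that by (simp add: cdf_def atMost_def)
  have z_MInf: "z \<noteq> -\<infinity>" using assms by auto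
  show "ereal a < z \<Longrightarrow> \<Phi> a < \<alpha>"
    using z_MInf z_real z_PInf by (cases z) (auto simp: cdf_std_normal_strict_mono cdf_std_normal_less_1)
  show "z < ereal a \<Longrightarrow> \<alpha> < \<Phi> a"
    using z_MInf z_real by (cases z) (auto simp: cdf_std_normal_strict_mono)
qed

section \<open>Multinomial weights as counts of uniform draws\<close>

text \<open>The indices of the \<open>m\<close> observations of a bootstrap sample, in the order in which they are drawn.
The multinomial weights are the counts of this list; sums against the weights become sums of
independent terms along the list.\<close>

definition resample :: "nat \<Rightarrow> nat \<Rightarrow> nat list pmf" where
  "resample n m = replicate_pmf m (pmf_of_set {1..n})"

abbreviation resample_prob :: "nat \<Rightarrow> nat \<Rightarrow> nat list set \<Rightarrow> real" where
  "resample_prob n m \<equiv> measure_pmf.prob (resample n m)"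

abbreviation resample_mean :: "nat \<Rightarrow> nat \<Rightarrow> (nat list \<Rightarrow> 'b::{banach, second_countable_topology}) \<Rightarrow> 'b" where
  "resample_mean n m \<equiv> measure_pmf.expectation (resample n m)"

lemma set_pmf_resample:
  "0 < n \<Longrightarrow> set_pmf (resample n m) = {l. set l \<subseteq> {1..n} \<and> length l = m}"
  unfolding resample_def set_replicate_pmf by auto

lemma finite_set_pmf_resample [simp]: "0 < n \<Longrightarrow> finite (set_pmf (resample n m))"
  by (simp add: set_pmf_resample finite_lists_length_eq)

lemma integrable_resample [simp]:
  fixes f :: "nat list \<Rightarrow> 'b::{banach, second_countable_topology}"
  shows "0 < n \<Longrightarrow> integrable (measure_pmf (resample n m)) f"
  by (simp add: integrable_measure_pmf_finite)

lemma expectation_resample_0: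
  fixes h :: "nat list \<Rightarrow> 'b::{banach, second_countable_topology}"
  shows "resample_mean n 0 h = h []"
  by (simp add: resample_def return_pmf.rep_eq integral_return)

lemma expectation_resample_Suc:
  fixes h :: "nat list \<Rightarrow> 'b::{banach, second_countable_topology}"
  assumes "0 < n"
  shows "resample_mean n (Suc m) h =
    (\<Sum>i=1..n. resample_mean n m (\<lambda>l. h (i # l))) /\<^sub>R real n"
proof -
  have fin: "finite (set_pmf (replicate_pmf m (pmf_of_set {1..n})))"
    using finite_set_pmf_resample[OF assms, of m] by (simp add: resample_def)
  have eq: "measure_pmf.expectation (replicate_pmf m (pmf_of_set {1..n}) \<bind> (\<lambda>l. return_pmf (i # l))) h =
      resample_mean n m (\<lambda>l. h (i # l))" for i
    unfolding resample_def map_pmf_def[symmetric] by simp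
  have "resample_mean n (Suc m) h = (\<Sum>i=1..n. measure_pmf.expectation
      (replicate_pmf m (pmf_of_set {1..n}) \<bind> (\<lambda>l. return_pmf (i # l))) h /\<^sub>R real n)"
    unfolding resample_def replicate_pmf.simps
    by (subst pmf_expectation_bind_pmf_of_set) (use assms fin in auto)
  thus ?thesis by (simp only: eq scaleR_sum_right)
qed

lemma expectation_resample_cong:
  assumes "0 < n" "\<And>l. set l \<subseteq> {1..n} \<Longrightarrow> length l = m \<Longrightarrow> f l = g l"
  shows "resample_mean n m f = resample_mean n m g"
  using assms by (intro integral_cong_AE) (auto simp: AE_measure_pmf_iff set_pmf_resample)

lemma expectation_resample_iexp:
  assumes "0 < n"
  shows "resample_mean n m (\<lambda>l. iexp (t * sum_list (map g l))) =
    ((\<Sum>i=1..n. iexp (t * g i)) / of_nat n) ^ m"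
proof (induction m)
  case (Suc m)
  have "resample_mean n m (\<lambda>l. iexp (t * sum_list (map g (i # l)))) =
      iexp (t * g i) * ((\<Sum>i=1..n. iexp (t * g i)) / of_nat n) ^ m" for i
    using Suc.IH by (simp add: distrib_left exp_add)
  thus ?case
    by (simp only: expectation_resample_Suc[OF assms] sum_distrib_right[symmetric])
       (simp add: scaleR_conv_of_real field_simps)
qed (simp add: expectation_resample_0)

lemma expectation_resample_sum_list:
  fixes g :: "nat \<Rightarrow> real"
  assumes "0 < n"
  shows "resample_mean n m (\<lambda>l. sum_list (map g l)) =
    real m * ((\<Sum>i=1..n. g i) / real n)"
proof (induction m)
  case (Suc m)
  thus ?case using assms
    by (simp add: expectation_resample_Suc sum.distrib field_simps)
qed (simp add: expectation_resample_0)

lemma expectation_resample_sum_list_sq: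
  fixes g :: "nat \<Rightarrow> real"
  assumes "0 < n" "(\<Sum>i=1..n. g i) = 0"
  shows "resample_mean n m (\<lambda>l. (sum_list (map g l))\<^sup>2) =
    real m * ((\<Sum>i=1..n. (g i)\<^sup>2) / real n)"
proof (induction m)
  case (Suc m)
  have "resample_mean n m (\<lambda>l. (sum_list (map g (i # l)))\<^sup>2) =
     (g i)\<^sup>2 + real m * ((\<Sum>i=1..n. (g i)\<^sup>2) / real n)" for i
    using Suc.IH assms
    by (simp add: power2_sum expectation_resample_sum_list mult.assoc)
  hence "resample_mean n (Suc m) (\<lambda>l. (sum_list (map g l))\<^sup>2) =
     (\<Sum>i=1..n. (g i)\<^sup>2 + real m * ((\<Sum>i=1..n. (g i)\<^sup>2) / real n)) / real n"
    by (simp only: expectation_resample_Suc[OF assms(1)] real_scaleR_def divide_inverse mult.commute)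
  also have "\<dots> = ((\<Sum>i=1..n. (g i)\<^sup>2) + real n * (real m * ((\<Sum>i=1..n. (g i)\<^sup>2) / real n))) / real n"
    by (simp add: sum.distrib)
  also have "\<dots> = real (Suc m) * ((\<Sum>i=1..n. (g i)\<^sup>2) / real n)"
    using assms(1) by (simp add: field_simps)
  finally show ?case .
qed (simp add: expectation_resample_0)

lemma sum_count_list_mult:
  fixes g :: "nat \<Rightarrow> real"
  assumes "set l \<subseteq> {1..n}"
  shows "(\<Sum>i=1..n. real (count_list l i) * g i) = sum_list (map g l)"
  using assms
proof (induction l)
  case (Cons a l)
  have "(\<Sum>i=1..n. real (count_list (a # l) i) * g i) =
      (\<Sum>i=1..n. (if i = a then g i else 0) + real (count_list l i) * g i)"
    by (intro sum.cong) (auto simp: algebra_simps)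
  also have "\<dots> = g a + sum_list (map g l)"
    using Cons by (simp add: sum.distrib)
  finally show ?case by simp
qed simp

lemma sum_count_list:
  fixes l :: "nat list"
  shows "set l \<subseteq> {1..n} \<Longrightarrow> (\<Sum>i=1..n. real (count_list l i)) = real (length l)"
  using sum_count_list_mult[of l n "\<lambda>_. 1"] by (simp add: sum_list_triv)

text \<open>For a list of length \<open>m\<close> this is, up to the factor \<open>m\<^sup>2\<close>, the sum of squared centred weights in the
denominator of \<open>T1\<close>.\<close>

definition count_dispersion :: "nat \<Rightarrow> nat list \<Rightarrow> real" where
  "count_dispersion n l = (\<Sum>i=1..n. (real (count_list l i) - real (length l) / real n)\<^sup>2)"

lemma count_dispersion_eq:
  assumes "0 < n" "set l \<subseteq> {1..n}"
  shows "count_dispersion n l = (\<Sum>i=1..n. (real (count_list l i))\<^sup>2) - (real (length l))\<^sup>2 / real n"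
proof -
  have "count_dispersion n l = (\<Sum>i=1..n. (real (count_list l i))\<^sup>2)
    - 2 * (real (length l) / real n) * (\<Sum>i=1..n. real (count_list l i)) + real n * (real (length l) / real n)\<^sup>2"
    unfolding count_dispersion_def power2_diff
    by (simp add: sum.distrib sum_subtractf sum_distrib_left sum_divide_distrib mult_ac)
  also have "(\<Sum>i=1..n. real (count_list l i)) = real (length l)" by (rule sum_count_list[OF assms(2)])
  finally show ?thesis using assms(1) by (simp add: power2_eq_square field_simps)
qed

text \<open>The increment has a centred part and a constant, so that mean and variance of the dispersion follow
by induction on the number of draws.\<close>

lemma count_dispersion_Cons:
  assumes "0 < n" "i \<in> {1..n}" "set l \<subseteq> {1..n}"
  shows "count_dispersion n (i # l) = count_dispersion n l
     + 2 * (real (count_list l i) - real (length l) / real n) + (1 - 1 / real n)"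
proof -
  have "(\<Sum>j=1..n. (real (count_list (i # l) j))\<^sup>2) =
      (\<Sum>j=1..n. (if j = i then 2 * real (count_list l i) + 1 else 0) + (real (count_list l j))\<^sup>2)"
    by (intro sum.cong) (auto simp: power2_eq_square algebra_simps)
  also have "\<dots> = 2 * real (count_list l i) + 1 + (\<Sum>j=1..n. (real (count_list l j))\<^sup>2)"
    using assms by (simp add: sum.distrib)
  finally show ?thesis
    using assms by (simp add: count_dispersion_eq power2_eq_square field_simps)
qed

lemma sum_count_deviation:
  assumes "0 < n" "set l \<subseteq> {1..n}"
  shows "(\<Sum>i=1..n. real (count_list l i) - real (length l) / real n) = 0"
  using assms sum_count_list[of l n] by (simp add: sum_subtractf)

lemma expectation_count_dispersion:
  assumes "0 < n"
  shows "resample_mean n m (count_dispersion n) = real m * (1 - 1 / real n)"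
proof (induction m)
  case (Suc m)
  have "resample_mean n (Suc m) (count_dispersion n) =
    (\<Sum>i=1..n. resample_mean n m (\<lambda>l. count_dispersion n l
     + 2 * (real (count_list l i) - real (length l) / real n) + (1 - 1 / real n))) / real n"
    unfolding expectation_resample_Suc[OF assms] real_scaleR_def
    by (simp only: divide_inverse mult.commute, intro arg_cong2[where f = "(*)"] sum.cong refl
        expectation_resample_cong[OF assms]) (simp_all add: count_dispersion_Cons[OF assms] divide_inverse)
  also have "\<dots> = (resample_mean n m (\<lambda>l. \<Sum>i=1..n. count_dispersion n l
     + 2 * (real (count_list l i) - real (length l) / real n) + (1 - 1 / real n))) / real n"
    using assms by (subst Bochner_Integration.integral_sum) auto
  also have "resample_mean n m (\<lambda>l. \<Sum>i=1..n. count_dispersion n l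
     + 2 * (real (count_list l i) - real (length l) / real n) + (1 - 1 / real n)) =
     resample_mean n m (\<lambda>l. real n * count_dispersion n l + real n * (1 - 1 / real n))"
  proof (rule expectation_resample_cong[OF assms])
    fix l assume l: "set l \<subseteq> {1..n}"
    show "(\<Sum>i=1..n. count_dispersion n l
     + 2 * (real (count_list l i) - real (length l) / real n) + (1 - 1 / real n)) =
       real n * count_dispersion n l + real n * (1 - 1 / real n)"
      unfolding sum.distrib sum_distrib_left[symmetric] sum_count_deviation[OF assms l] by simp
  qed
  also have "\<dots> = real n * (real m * (1 - 1 / real n)) + real n * (1 - 1 / real n)"
    using Suc.IH assms by simp
  also have "\<dots> / real n = real (Suc m) * (1 - 1 / real n)"
    using assms by (simp add: distrib_right add_divide_distrib)
  finally show ?case .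
qed (simp add: expectation_resample_0 count_dispersion_def)

text \<open>The increments \<open>2 * d l i\<close> of the centred dispersion, where \<open>d l i\<close> is the centred count of the index \<open>i\<close> drawn next, are
orthogonal to the past, and their mean square is \<open>4 / n\<close> times the mean of the current dispersion.
Summing over the draws gives the order \<open>m\<^sup>2 / n\<close>, which is small compared with the square of the
mean dispersion once \<open>n\<close> is large.\<close>

lemma expectation_count_dispersion_deviation:
  assumes "0 < n"
  shows "resample_mean n m (\<lambda>l. (count_dispersion n l - real m * (1 - 1 / real n))\<^sup>2)
     \<le> 2 * (real m)\<^sup>2 / real n"
proof (induction m)
  case (Suc m)
  define c where "c = 1 - 1 / real n"
  define d where "d l i = real (count_list l i) - real (length l) / real n" for l and i :: nat
  define E where "E l = count_dispersion n l - real m * c" for l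
  have c: "0 \<le> c" "c \<le> 1" using assms by (auto simp: c_def)
  have "resample_mean n (Suc m) (\<lambda>l. (count_dispersion n l - real (Suc m) * c)\<^sup>2) =
    (\<Sum>i=1..n. resample_mean n m (\<lambda>l. (E l + 2 * d l i)\<^sup>2)) / real n"
  proof -
    have "count_dispersion n (i # l) - real (Suc m) * c = E l + 2 * d l i"
      if "i \<in> {1..n}" "set l \<subseteq> {1..n}" "length l = m" for i l
      using count_dispersion_Cons[OF assms that(1,2)] that(3)
      by (simp add: E_def d_def c_def[symmetric] algebra_simps)
    thus ?thesis
      unfolding expectation_resample_Suc[OF assms] real_scaleR_def
      by (simp only: divide_inverse mult.commute, intro arg_cong2[where f = "(*)"] sum.cong refl
          expectation_resample_cong[OF assms]) simp_all
  qed
  also have "\<dots> = resample_mean n m (\<lambda>l. \<Sum>i=1..n. (E l + 2 * d l i)\<^sup>2) / real n"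
    using assms by (subst Bochner_Integration.integral_sum) auto
  also have "resample_mean n m (\<lambda>l. \<Sum>i=1..n. (E l + 2 * d l i)\<^sup>2) =
    resample_mean n m (\<lambda>l. real n * (E l)\<^sup>2 + 4 * count_dispersion n l)"
  proof (rule expectation_resample_cong[OF assms])
    fix l assume l: "set l \<subseteq> {1..n}"
    have "(\<Sum>i=1..n. (E l + 2 * d l i)\<^sup>2) =
        (\<Sum>i=1..n. (E l)\<^sup>2 + 4 * E l * d l i + 4 * (d l i)\<^sup>2)"
      by (intro sum.cong) (auto simp: power2_eq_square algebra_simps)
    also have "\<dots> = real n * (E l)\<^sup>2 + 4 * E l * (\<Sum>i=1..n. d l i) + 4 * count_dispersion n l"
      by (simp add: sum.distrib sum_distrib_left count_dispersion_def d_def)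
    also have "(\<Sum>i=1..n. d l i) = 0" unfolding d_def by (rule sum_count_deviation[OF assms l])
    finally show "(\<Sum>i=1..n. (E l + 2 * d l i)\<^sup>2) = real n * (E l)\<^sup>2 + 4 * count_dispersion n l" by simp
  qed
  also have "\<dots> = real n * resample_mean n m (\<lambda>l. (E l)\<^sup>2) + 4 * (real m * c)"
    using assms by (simp add: expectation_count_dispersion c_def)
  also have "\<dots> / real n \<le> (real n * (2 * (real m)\<^sup>2 / real n) + 4 * (real m * 1)) / real n"
    using Suc.IH c by (intro divide_right_mono add_mono mult_left_mono) (auto simp: E_def c_def)
  also have "\<dots> \<le> 2 * (real (Suc m))\<^sup>2 / real n"
    using assms by (simp add: power2_eq_square field_simps)
  finally show ?case by (simp add: c_def)
qed (simp add: expectation_resample_0 count_dispersion_def)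

lemma pmf_resample:
  assumes "0 < n" "set l \<subseteq> {1..n}" "length l = m"
  shows "pmf (resample n m) l = (1 / real n) ^ m"
  using assms(2,3)
proof (induction l arbitrary: m)
  case Nil thus ?case by (simp add: resample_def)
next
  case (Cons a l)
  then obtain m' where m: "m = Suc m'" "length l = m'" by auto
  have "pmf (resample n m) (a # l) = resample_mean n m (indicator {a # l})"
    by (simp add: pmf.rep_eq)
  also have "\<dots> = (\<Sum>i=1..n. measure_pmf.expectation (resample n m') (\<lambda>l'. indicator {a # l} (i # l'))) / real n"
    unfolding m(1) by (subst expectation_resample_Suc[OF assms(1)]) (simp add: divide_inverse mult.commute)
  also have "\<dots> = (\<Sum>i=1..n. (if i = a then pmf (resample n m') l else 0)) / real n"
  proof (intro arg_cong2[where f = "(/)"] sum.cong refl)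
    fix i
    have "measure_pmf.expectation (resample n m') (\<lambda>l'. indicator {a # l} (i # l') :: real) =
       measure_pmf.expectation (resample n m') (\<lambda>l'. of_bool (i = a) * indicator {l} l' :: real)"
      by (intro Bochner_Integration.integral_cong refl) (auto simp: indicator_def)
    thus "measure_pmf.expectation (resample n m') (\<lambda>l'. indicator {a # l} (i # l')) =
        (if i = a then pmf (resample n m') l else 0)"
      by (simp add: pmf.rep_eq)
  qed
  also have "\<dots> = (1 / real n) ^ m"
    using Cons m by simp
  finally show ?case .
qed

text \<open>All lists have the same probability, and the lists with given counts are the permutations of a
multiset; their number is the multinomial coefficient.\<close>

lemma prob_resample_counts:
  assumes "0 < n"
  shows "resample_prob n m {l. \<forall>i\<in>{1..n}. count_list l i = k i} =
    (if (\<Sum>i=1..n. k i) = m then fact m / (\<Prod>i=1..n. fact (k i)) * (\<Prod>i=1..n. (1 / real n) ^ k i) else 0)"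
proof -
  let ?S = "{l. set l \<subseteq> {1..n} \<and> length l = m \<and> (\<forall>i\<in>{1..n}. count_list l i = k i)}"
  have "resample_prob n m {l. \<forall>i\<in>{1..n}. count_list l i = k i} =
      resample_prob n m ?S"
    by (subst measure_Int_set_pmf[symmetric]) (auto simp: set_pmf_resample[OF assms] intro!: arg_cong[where f = "measure_pmf.prob _"])
  also have "\<dots> = (\<Sum>l\<in>?S. pmf (resample n m) l)"
    by (intro measure_measure_pmf_finite finite_subset[OF _ finite_lists_length_eq[of "{1..n}" m]]) auto
  also have "\<dots> = (\<Sum>l\<in>?S. (1 / real n) ^ m)"
    by (intro sum.cong) (auto simp: pmf_resample[OF assms])
  finally have eq: "resample_prob n m {l. \<forall>i\<in>{1..n}. count_list l i = k i} =
      real (card ?S) * (1 / real n) ^ m" by simp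
  show ?thesis
  proof (cases "(\<Sum>i=1..n. k i) = m")
    case False
    have "(\<Sum>i=1..n. k i) = m" if "l \<in> ?S" for l
    proof -
      have "(\<Sum>i=1..n. k i) = (\<Sum>i=1..n. count_list l i)" using that by (intro sum.cong) auto
      also have "\<dots> = m" using that sum_count_set[of l "{1..n}"] by simp
      finally show ?thesis .
    qed
    hence "?S = {}" using False by blast
    thus ?thesis unfolding eq using False by (simp only: card.empty) simp
  next
    case True
    define A where "A = (\<Sum>i\<in>{1..n}. replicate_mset (k i) i)"
    have count: "count A i = (if i \<in> {1..n} then k i else 0)" for i
      unfolding A_def by (simp add: count_sum)
    have size: "size A = m" unfolding A_def using True by simp
    have S_eq: "?S = permutations_of_multiset A"
    proof (intro set_eqI iffI)
      fix l assume l: "l \<in> ?S"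
      have "mset l = A"
        using l by (intro multiset_eqI) (auto simp: count count_mset intro!: count_notin)
      thus "l \<in> permutations_of_multiset A" by (rule permutations_of_multisetI)
    next
      fix l assume "l \<in> permutations_of_multiset A"
      hence l: "mset l = A" by (rule permutations_of_multisetD)
      hence c: "count_list l i = (if i \<in> {1..n} then k i else 0)" for i
        using count[of i] by (simp add: count_mset flip: l)
      hence "set l \<subseteq> {1..n}" by (metis count_list_0_iff subsetI)
      moreover have "length l = m" using l size by (metis size_mset)
      ultimately show "l \<in> ?S" using c by simp
    qed
    have "real (card (permutations_of_multiset A)) * (\<Prod>i=1..n. fact (k i)) = fact m"
    proof -
      have "(\<Prod>x\<in>set_mset A. fact (count A x)) = (\<Prod>i=1..n. fact (k i) :: nat)"
        by (rule prod.mono_neutral_cong_left)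
           (auto simp: count not_in_iff[symmetric] count_greater_zero_iff[symmetric] simp del: count_greater_zero_iff split: if_splits)
      hence "card (permutations_of_multiset A) * (\<Prod>i=1..n. fact (k i)) = (fact m :: nat)"
        using card_permutations_of_multiset_aux[of A] size by simp
      hence "real (card (permutations_of_multiset A) * (\<Prod>i=1..n. fact (k i))) = real (fact m)"
        by (rule arg_cong)
      thus ?thesis by simp
    qed
    hence "real (card (permutations_of_multiset A)) = fact m / (\<Prod>i=1..n. fact (k i))"
      if "(\<Prod>i=1..n. fact (k i) :: real) \<noteq> 0"
      using that by (metis nonzero_eq_divide_eq)
    moreover have "(\<Prod>i=1..n. fact (k i) :: real) \<noteq> 0" by simp
    moreover have "(\<Prod>i=1..n. (1 / real n) ^ k i) = (1 / real n) ^ m"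
      by (simp only: power_sum[symmetric] True)
    ultimately show ?thesis unfolding eq S_eq using True by (simp only: if_True refl not_False_eq_True)
  qed
qed

section \<open>A conditional central limit theorem\<close>

text \<open>Lindeberg condition for the normalized sum of \<open>m\<close> draws from the sample \<open>x\<close>. One parameter serves both
for the truncation level and for the proportion of the variance that lies above it, since both have
to be small in the end.\<close>

definition lindeberg :: "nat \<Rightarrow> nat \<Rightarrow> real \<Rightarrow> (nat \<Rightarrow> real) \<Rightarrow> bool" where
  "lindeberg n m \<delta> x \<longleftrightarrow> 0 < sample_var n x \<and>
     (\<Sum>i=1..n. (x i - sample_mean n x)\<^sup>2 *
        of_bool (\<delta> * real m * sample_var n x < (x i - sample_mean n x)\<^sup>2)) / real n
     \<le> \<delta> * sample_var n x"

definition standardized :: "nat \<Rightarrow> (nat \<Rightarrow> real) \<Rightarrow> nat \<Rightarrow> real" where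
  "standardized n x i = (x i - sample_mean n x) / sqrt (sample_var n x)"

lemma standardized_sq:
  "0 < sample_var n x \<Longrightarrow> (standardized n x i)\<^sup>2 = (x i - sample_mean n x)\<^sup>2 / sample_var n x"
  by (simp add: standardized_def power_divide)

lemma sum_standardized: "0 < n \<Longrightarrow> (\<Sum>i=1..n. standardized n x i) = 0"
  unfolding standardized_def sum_divide_distrib[symmetric]
  by (simp add: sum_subtractf sample_mean_def)

lemma sum_standardized_sq:
  assumes "0 < n" "0 < sample_var n x"
  shows "(\<Sum>i=1..n. (standardized n x i)\<^sup>2) = real n"
proof -
  have "(\<Sum>i=1..n. (x i - sample_mean n x)\<^sup>2) = real n * sample_var n x"
    using assms by (simp add: sample_var_def)
  thus ?thesis
    using assms by (simp only: standardized_sq sum_divide_distrib[symmetric]) simp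
qed

lemma lindeberg_standardized:
  assumes "lindeberg n m \<delta> x"
  shows "(\<Sum>i=1..n. (standardized n x i)\<^sup>2 * of_bool (\<delta> * real m < (standardized n x i)\<^sup>2)) / real n \<le> \<delta>"
proof -
  have v: "0 < sample_var n x" using assms by (simp add: lindeberg_def)
  have "(standardized n x i)\<^sup>2 * of_bool (\<delta> * real m < (standardized n x i)\<^sup>2) =
      (x i - sample_mean n x)\<^sup>2 * of_bool (\<delta> * real m * sample_var n x < (x i - sample_mean n x)\<^sup>2)
        / sample_var n x" for i
    using v by (simp add: standardized_sq pos_less_divide_eq)
  hence "(\<Sum>i=1..n. (standardized n x i)\<^sup>2 * of_bool (\<delta> * real m < (standardized n x i)\<^sup>2)) / real n =
     ((\<Sum>i=1..n. (x i - sample_mean n x)\<^sup>2 *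
        of_bool (\<delta> * real m * sample_var n x < (x i - sample_mean n x)\<^sup>2)) / real n) / sample_var n x"
    by (simp only: sum_divide_distrib[symmetric]) simp
  also have "\<dots> \<le> \<delta>" using assms v unfolding lindeberg_def by (subst pos_divide_le_eq) blast+
  finally show ?thesis .
qed

text \<open>Lindeberg central limit theorem for uniform draws from a triangular array. The draws are identically
distributed, so the characteristic function of the sum is a power, and its base is compared with
\<open>1 - s\<^sup>2 / (2 * m)\<close>. The remainder \<open>min (6 * y\<^sup>2) (\<bar>u\<bar> * \<bar>y\<bar> ^ 3)\<close>, where \<open>u = s / sqrt m\<close>, is estimated by its
first argument on the large values of \<open>y\<close> and by its second one on the others.\<close>

lemma resample_clt:
  fixes n m :: "nat \<Rightarrow> nat" and y :: "nat \<Rightarrow> nat \<Rightarrow> real"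
  assumes n: "\<And>k. 0 < n k" and m: "filterlim m at_top sequentially"
    and mean: "\<And>k. (\<Sum>i=1..n k. y k i) = 0" and var: "\<And>k. (\<Sum>i=1..n k. (y k i)\<^sup>2) = real (n k)"
    and lind: "\<And>k. (\<Sum>i=1..n k. (y k i)\<^sup>2 * of_bool (\<delta> k * real (m k) < (y k i)\<^sup>2)) / real (n k) \<le> \<delta> k"
    and \<delta>: "\<delta> \<longlonglongrightarrow> 0"
  shows "(\<lambda>k. resample_prob (n k) (m k) {l. sum_list (map (y k) l) / sqrt (real (m k)) \<le> t})
     \<longlonglongrightarrow> \<Phi> t"
proof -
  define P where "P k = distr (measure_pmf (resample (n k) (m k))) borel
     (\<lambda>l. sum_list (map (y k) l) / sqrt (real (m k)))" for k
  have P: "real_distribution (P k)" for k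
    unfolding P_def by (intro prob_space.real_distribution_distr[OF prob_space_measure_pmf]) simp
  have \<delta>_nonneg: "0 \<le> \<delta> k" for k
    using lind[of k] by (rule order_trans[rotated]) (intro divide_nonneg_nonneg sum_nonneg; simp)
  have "(\<lambda>k. char (P k) s) \<longlonglongrightarrow> char std_normal_distribution s" for s
  proof -
    define c where "c k = (\<Sum>i=1..n k. iexp (s / sqrt (real (m k)) * y k i)) / of_nat (n k)" for k
    have char_P: "char (P k) s = c k ^ m k" for k
    proof -
      have "char (P k) s = (CLINT l | measure_pmf (resample (n k) (m k)).
          iexp (s / sqrt (real (m k)) * sum_list (map (y k) l)))"
        unfolding P_def char_def by (subst integral_distr) (simp_all add: field_simps)
      thus ?thesis unfolding expectation_resample_iexp[OF n] c_def .
    qed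
    define w where "w k = 1 + (- (s\<^sup>2) / 2) / real (m k)" for k
    define e where "e k = s\<^sup>2 / 6 * (6 * \<delta> k + \<bar>s\<bar> * sqrt (\<delta> k))" for k
    have bound: "norm (c k ^ m k - of_real (w k ^ m k)) \<le> e k" if k: "real (m k) \<ge> s\<^sup>2 / 4" "m k > 0" for k
    proof -
      define u where "u = s / sqrt (real (m k))"
      have u2: "real (m k) * u\<^sup>2 = s\<^sup>2" using k by (simp add: u_def power_divide)
      define Q where "Q = pmf_of_set {1..n k}"
      have E: "measure_pmf.expectation Q f = (\<Sum>i=1..n k. f i) / real (n k)" for f :: "nat \<Rightarrow> real"
        unfolding Q_def using n[of k] by (subst integral_pmf_of_set) auto
      have int: "integrable (measure_pmf Q) f" for f :: "nat \<Rightarrow> 'b::{banach, second_countable_topology}"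
        unfolding Q_def using n[of k] by (intro integrable_measure_pmf_finite) auto
      have cchar: "c k = char (distr (measure_pmf Q) borel (y k)) u"
      proof -
        have "char (distr (measure_pmf Q) borel (y k)) u = (CLINT i | measure_pmf Q. iexp (u * y k i))"
          unfolding char_def by (subst integral_distr) auto
        also have "\<dots> = (\<Sum>i=1..n k. iexp (u * y k i)) /\<^sub>R real (n k)"
          unfolding Q_def using n[of k] by (subst integral_measure_pmf[of "{1..n k}"]) (auto simp: scaleR_sum_right divide_inverse)
        finally show ?thesis by (simp add: c_def u_def scaleR_conv_of_real divide_inverse mult.commute)
      qed
      have "norm (c k - (1 - u\<^sup>2 * 1 / 2)) \<le>
          u\<^sup>2 / 6 * measure_pmf.expectation Q (\<lambda>i. min (6 * (y k i)\<^sup>2) (\<bar>u\<bar> * \<bar>y k i\<bar> ^ 3))"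
        using prob_space.char_approx3'[OF prob_space_measure_pmf, of "y k" Q 1 "distr (measure_pmf Q) borel (y k)" u]
        unfolding cchar using mean[of k] var[of k] n[of k] by (simp add: int E)
      also have "measure_pmf.expectation Q (\<lambda>i. min (6 * (y k i)\<^sup>2) (\<bar>u\<bar> * \<bar>y k i\<bar> ^ 3)) \<le>
          measure_pmf.expectation Q (\<lambda>i. 6 * ((y k i)\<^sup>2 * of_bool (\<delta> k * real (m k) < (y k i)\<^sup>2)) + \<bar>s\<bar> * sqrt (\<delta> k) * (y k i)\<^sup>2)"
      proof (intro integral_mono int)
        fix i
        show "min (6 * (y k i)\<^sup>2) (\<bar>u\<bar> * \<bar>y k i\<bar> ^ 3) \<le> 6 * ((y k i)\<^sup>2 * of_bool (\<delta> k * real (m k) < (y k i)\<^sup>2)) + \<bar>s\<bar> * sqrt (\<delta> k) * (y k i)\<^sup>2"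
        proof (cases "\<delta> k * real (m k) < (y k i)\<^sup>2")
          case True
          thus ?thesis using \<delta>_nonneg[of k] by (simp add: min.coboundedI1)
        next
          case False
          hence "\<bar>y k i\<bar> \<le> sqrt (\<delta> k * real (m k))" by (simp add: real_le_rsqrt)
          hence "\<bar>u\<bar> * \<bar>y k i\<bar> \<le> \<bar>u\<bar> * sqrt (\<delta> k * real (m k))" by (intro mult_left_mono) auto
          also have "\<dots> = \<bar>s\<bar> * sqrt (\<delta> k)" using k by (simp add: u_def real_sqrt_mult abs_divide)
          finally have le: "\<bar>u\<bar> * \<bar>y k i\<bar> \<le> \<bar>s\<bar> * sqrt (\<delta> k)" .
          have "min (6 * (y k i)\<^sup>2) (\<bar>u\<bar> * \<bar>y k i\<bar> ^ 3) \<le> \<bar>u\<bar> * \<bar>y k i\<bar> ^ 3" by simp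
          also have "\<dots> = \<bar>u\<bar> * \<bar>y k i\<bar> * \<bar>y k i\<bar>\<^sup>2"
            by (simp only: power3_eq_cube power2_eq_square mult.assoc)
          also have "\<dots> \<le> \<bar>s\<bar> * sqrt (\<delta> k) * \<bar>y k i\<bar>\<^sup>2"
            by (intro mult_right_mono le) auto
          finally show ?thesis using False by simp
        qed
      qed
      also have "\<dots> \<le> 6 * \<delta> k + \<bar>s\<bar> * sqrt (\<delta> k)"
      proof -
        have "measure_pmf.expectation Q (\<lambda>i. 6 * ((y k i)\<^sup>2 * of_bool (\<delta> k * real (m k) < (y k i)\<^sup>2)) + \<bar>s\<bar> * sqrt (\<delta> k) * (y k i)\<^sup>2)
          = 6 * measure_pmf.expectation Q (\<lambda>i. (y k i)\<^sup>2 * of_bool (\<delta> k * real (m k) < (y k i)\<^sup>2))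
            + \<bar>s\<bar> * sqrt (\<delta> k) * measure_pmf.expectation Q (\<lambda>i. (y k i)\<^sup>2)"
          by (subst Bochner_Integration.integral_add) (auto simp: int)
        thus ?thesis using lind[of k] n[of k] var[of k] by (simp add: E)
      qed
      finally have "norm (c k - (1 - u\<^sup>2 * 1 / 2)) \<le> u\<^sup>2 / 6 * (6 * \<delta> k + \<bar>s\<bar> * sqrt (\<delta> k))"
        by (simp add: mult_left_mono)
      moreover have "1 - u\<^sup>2 * 1 / 2 = w k" using u2 k by (simp add: w_def field_simps)
      ultimately have cw: "norm (c k - of_real (w k)) \<le> u\<^sup>2 / 6 * (6 * \<delta> k + \<bar>s\<bar> * sqrt (\<delta> k))"
        by (simp flip: of_real_diff)
      interpret R: real_distribution "distr (measure_pmf Q) borel (y k)"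
        by (intro prob_space.real_distribution_distr[OF prob_space_measure_pmf]) simp
      have "norm (c k) \<le> 1" unfolding cchar by (rule R.cmod_char_le_1)
      moreover have "\<bar>w k\<bar> \<le> 1"
      proof -
        have "s\<^sup>2 / 2 / real (m k) \<le> 2" using k by (simp add: field_simps)
        moreover have "0 \<le> s\<^sup>2 / 2 / real (m k)" by simp
        ultimately show ?thesis unfolding w_def by (simp add: abs_le_iff)
      qed
      ultimately have "norm (c k ^ m k - of_real (w k) ^ m k) \<le> real (m k) * norm (c k - of_real (w k))"
        by (intro norm_power_diff) auto
      also have "\<dots> \<le> real (m k) * (u\<^sup>2 / 6 * (6 * \<delta> k + \<bar>s\<bar> * sqrt (\<delta> k)))"
        by (intro mult_left_mono cw) auto
      also have "\<dots> = e k" unfolding e_def u2[symmetric] by simp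
      finally show ?thesis by simp
    qed
    have "e \<longlonglongrightarrow> s\<^sup>2 / 6 * (6 * 0 + \<bar>s\<bar> * sqrt 0)"
      unfolding e_def by (intro tendsto_intros \<delta>)
    hence e: "e \<longlonglongrightarrow> 0" by simp
    have "filterlim (\<lambda>k. real (m k)) at_top sequentially"
      by (rule filterlim_compose[OF filterlim_real_sequentially m])
    hence "\<forall>\<^sub>F k in sequentially. real (m k) \<ge> s\<^sup>2 / 4" unfolding filterlim_at_top by blast
    moreover have "\<forall>\<^sub>F k in sequentially. m k > 0"
      using m[unfolded filterlim_at_top, rule_format, of 1] by eventually_elim auto
    ultimately have "\<forall>\<^sub>F k in sequentially. norm (c k ^ m k - of_real (w k ^ m k)) \<le> e k"
      by eventually_elim (rule bound)
    hence diff: "(\<lambda>k. c k ^ m k - of_real (w k ^ m k)) \<longlonglongrightarrow> 0"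
      by (rule Lim_null_comparison[OF _ e])
    have "(\<lambda>j. (1 + (- (s\<^sup>2) / 2) / real j) ^ j) \<longlonglongrightarrow> exp (- (s\<^sup>2) / 2)"
      by (rule tendsto_exp_limit_sequentially)
    from filterlim_compose[OF this m] have "(\<lambda>k. w k ^ m k) \<longlonglongrightarrow> exp (- (s\<^sup>2) / 2)"
      by (simp add: w_def)
    hence "(\<lambda>k. complex_of_real (w k ^ m k)) \<longlonglongrightarrow> of_real (exp (- (s\<^sup>2) / 2))"
      by (rule tendsto_of_real)
    from tendsto_add[OF diff this] show ?thesis
      by (simp add: char_P char_std_normal_distribution)
  qed
  hence "weak_conv_m P std_normal_distribution"
    by (intro levy_continuity P real_dist_normal_dist)
  hence "(\<lambda>k. cdf (P k) t) \<longlonglongrightarrow> \<Phi> t"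
    unfolding weak_conv_m_def weak_conv_def using isCont_cdf_std_normal by blast
  moreover have "cdf (P k) t = resample_prob (n k) (m k)
      {l. sum_list (map (y k) l) / sqrt (real (m k)) \<le> t}" for k
    unfolding cdf_def P_def by (subst measure_distr) (auto simp: vimage_def)
  ultimately show ?thesis by simp
qed

text \<open>The conditional law of \<open>T\<close> given the data is close to the normal law, uniformly over all data sets
that satisfy a sufficiently strict Lindeberg condition. The uniformity lets the condition be verified
with high probability only.\<close>

definition bootstrap_clt :: "(nat \<Rightarrow> nat \<Rightarrow> (nat \<Rightarrow> nat) \<Rightarrow> (nat \<Rightarrow> real) \<Rightarrow> real) \<Rightarrow> bool" where
  "bootstrap_clt T \<longleftrightarrow> (\<forall>t. \<forall>\<eta>>0. \<exists>\<delta>>0. \<exists>N. \<forall>n\<ge>N. \<forall>m\<ge>N. \<forall>x. lindeberg n m \<delta> x \<longrightarrow>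
     \<bar>resample_prob n m {l. T n m (count_list l) x \<le> t} - \<Phi> t\<bar> \<le> \<eta>)"

lemma T3_count_list:
  assumes "0 < n" "0 < m" "set l \<subseteq> {1..n}" "length l = m" 
  shows "T3 n m (count_list l) x = sum_list (map (standardized n x) l) / sqrt (real m)"
proof -
  define S where "S = sqrt (sample_var n x)"
  have "sum_list (map (standardized n x) l) = (\<Sum>i=1..n. real (count_list l i) * standardized n x i)"
    using assms by (simp only: sum_count_list_mult)
  also have "\<dots> = ((\<Sum>i=1..n. real (count_list l i) * x i) - real m * sample_mean n x) / S"
    using assms sum_count_list[of l n]
    by (simp add: standardized_def S_def[symmetric] sum_divide_distrib[symmetric] right_diff_distrib
        sum_subtractf sum_distrib_right[symmetric])
  also have "(\<Sum>i=1..n. real (count_list l i) * x i) - real m * sample_mean n x =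
      real m * (\<Sum>i=1..n. (real (count_list l i) / real m - 1 / real n) * x i)"
    using assms by (simp add: left_diff_distrib sum_subtractf sample_mean_def right_diff_distrib
        sum_distrib_left sum_divide_distrib)
  finally have eq: "sum_list (map (standardized n x) l) =
      real m * (\<Sum>i=1..n. (real (count_list l i) / real m - 1 / real n) * x i) / S" .
  have "real m = sqrt (real m) * sqrt (real m)" by simp
  thus ?thesis unfolding eq T3_def S_def[symmetric] using assms
    by (simp add: divide_simps)
qed

lemma prob_resample_cong:
  assumes "0 < n" "\<And>l. set l \<subseteq> {1..n} \<Longrightarrow> length l = m \<Longrightarrow> P l \<longleftrightarrow> Q l"
  shows "resample_prob n m {l. P l} = resample_prob n m {l. Q l}"
  using assms by (intro measure_pmf.finite_measure_eq_AE) (auto simp: AE_measure_pmf_iff set_pmf_resample)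

text \<open>If uniformity failed, the counterexamples for \<open>\<delta> = 1 / (k + 1)\<close> would form a triangular array that
contradicts the central limit theorem along this sequence.\<close>

lemma bootstrap_clt_T3: "bootstrap_clt T3"
proof (rule ccontr)
  assume "\<not> bootstrap_clt T3"
  then obtain t \<eta> where \<eta>: "\<eta> > 0" and bad: "\<And>\<delta> N. \<delta> > 0 \<Longrightarrow> \<exists>n\<ge>N. \<exists>m\<ge>N. \<exists>x. lindeberg n m \<delta> x \<and>
     \<not> \<bar>resample_prob n m {l. T3 n m (count_list l) x \<le> t} - \<Phi> t\<bar> \<le> \<eta>"
    unfolding bootstrap_clt_def by meson
  have "\<forall>k. \<exists>n m x. n \<ge> Suc k \<and> m \<ge> Suc k \<and> lindeberg n m (1 / real (Suc k)) x \<and>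
     \<not> \<bar>resample_prob n m {l. T3 n m (count_list l) x \<le> t} - \<Phi> t\<bar> \<le> \<eta>"
  proof
    fix k :: nat show "\<exists>n m x. n \<ge> Suc k \<and> m \<ge> Suc k \<and> lindeberg n m (1 / real (Suc k)) x \<and>
     \<not> \<bar>resample_prob n m {l. T3 n m (count_list l) x \<le> t} - \<Phi> t\<bar> \<le> \<eta>"
      using bad[of "1 / real (Suc k)" "Suc k"] by auto
  qed
  then obtain n m x where
    nm: "\<And>k. n k \<ge> Suc k" "\<And>k. m k \<ge> Suc k" and lind: "\<And>k. lindeberg (n k) (m k) (1 / real (Suc k)) (x k)"
    and far: "\<And>k. \<not> \<bar>resample_prob (n k) (m k) {l. T3 (n k) (m k) (count_list l) (x k) \<le> t}
        - \<Phi> t\<bar> \<le> \<eta>"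
    by metis
  have n0: "0 < n k" and m0: "0 < m k" for k using nm[of k] by auto
  have v: "0 < sample_var (n k) (x k)" for k using lind[of k] by (simp add: lindeberg_def)
  have m_lim: "filterlim m at_top sequentially"
    by (rule filterlim_at_top_mono[OF filterlim_Suc]) (use nm in auto)
  have "(\<lambda>k. resample_prob (n k) (m k)
      {l. sum_list (map (standardized (n k) (x k)) l) / sqrt (real (m k)) \<le> t}) \<longlonglongrightarrow> \<Phi> t"
    by (rule resample_clt[where \<delta> = "\<lambda>k. 1 / real (Suc k)", OF n0 m_lim sum_standardized[OF n0]
          sum_standardized_sq[OF n0 v] lindeberg_standardized[OF lind] LIMSEQ_Suc[OF lim_1_over_n]])
  hence "(\<lambda>k. resample_prob (n k) (m k) {l. T3 (n k) (m k) (count_list l) (x k) \<le> t})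
      \<longlonglongrightarrow> \<Phi> t"
    by (elim back_subst[where P = "\<lambda>f. f \<longlonglongrightarrow> _"], intro ext prob_resample_cong[OF n0])
       (simp add: T3_count_list[OF n0 m0])
  hence "\<forall>\<^sub>F k in sequentially. dist (resample_prob (n k) (m k)
      {l. T3 (n k) (m k) (count_list l) (x k) \<le> t}) (\<Phi> t) < \<eta>"
    using \<eta> by (rule tendstoD)
  thus False using far by (auto simp: eventually_sequentially dist_real_def) (meson less_imp_le order_refl)
qed

lemma lindeberg_mono:
  assumes "lindeberg n m \<delta> x" "\<delta> \<le> \<delta>'"
  shows "lindeberg n m \<delta>' x"
proof -
  have v: "0 < sample_var n x" using assms by (simp add: lindeberg_def)
  have thr: "\<delta> * real m * sample_var n x \<le> \<delta>' * real m * sample_var n x"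
    using assms v by (intro mult_right_mono) auto
  have "(\<Sum>i=1..n. (x i - sample_mean n x)\<^sup>2 *
        of_bool (\<delta>' * real m * sample_var n x < (x i - sample_mean n x)\<^sup>2)) / real n \<le>
      (\<Sum>i=1..n. (x i - sample_mean n x)\<^sup>2 *
        of_bool (\<delta> * real m * sample_var n x < (x i - sample_mean n x)\<^sup>2)) / real n"
    using thr by (intro divide_right_mono sum_mono mult_left_mono) auto
  also have "\<dots> \<le> \<delta> * sample_var n x" using assms by (simp add: lindeberg_def)
  also have "\<dots> \<le> \<delta>' * sample_var n x" using assms v by (intro mult_right_mono) auto
  finally show ?thesis using v by (simp add: lindeberg_def)
qed

text \<open>Slutsky's lemma in terms of distribution functions: where \<open>Q\<close> is within \<open>e\<close> of 1, the event
\<open>T3 / Q \<le> t\<close> lies between \<open>T3 \<le> t - e * \<bar>t\<bar>\<close> and \<open>T3 \<le> t + e * \<bar>t\<bar>\<close>.\<close>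

lemma bootstrap_clt_ratio:
  assumes T: "\<And>n m v x. 0 < n \<Longrightarrow> 0 < m \<Longrightarrow> 0 < sample_var n x \<Longrightarrow> T n m v x = T3 n m v x / Q n m v x"
    and Q: "\<And>\<eta>. 0 < \<eta> \<Longrightarrow> \<exists>\<delta>>0. \<exists>N. \<forall>n\<ge>N. \<forall>m\<ge>N. \<forall>x. lindeberg n m \<delta> x \<longrightarrow>
       resample_prob n m {l. \<eta> < \<bar>Q n m (count_list l) x - 1\<bar>} \<le> \<eta>"
  shows "bootstrap_clt T"
  unfolding bootstrap_clt_def
proof (intro allI impI)
  fix t \<eta> :: real assume \<eta>: "0 < \<eta>"
  obtain d where d: "d > 0" "\<And>s. \<bar>s - t\<bar> < d \<Longrightarrow> \<bar>\<Phi> s - \<Phi> t\<bar> < \<eta> / 3"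
    using isCont_cdf_std_normal[of t] \<eta> unfolding continuous_at_eps_delta
    by (metis dist_real_def zero_less_divide_iff zero_less_numeral)
  define e where "e = min (1 / 2) (min (\<eta> / 3) (d / (2 * (\<bar>t\<bar> + 1))))"
  have e: "0 < e" using \<eta> d by (auto simp: e_def)
  have e_le: "e \<le> 1 / 2" "e \<le> \<eta> / 3" "e \<le> d / (2 * (\<bar>t\<bar> + 1))" unfolding e_def by linarith+
  have "e * \<bar>t\<bar> \<le> d / (2 * (\<bar>t\<bar> + 1)) * (\<bar>t\<bar> + 1)"
    by (intro mult_mono) (use d e e_le in auto)
  also have "\<dots> < d" using d(1) by (simp add: field_simps add_pos_nonneg)
  finally have et: "e * \<bar>t\<bar> < d" .
  define a b where "a = t - e * \<bar>t\<bar>" and "b = t + e * \<bar>t\<bar>"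
  have ab: "\<bar>\<Phi> a - \<Phi> t\<bar> < \<eta> / 3" "\<bar>\<Phi> b - \<Phi> t\<bar> < \<eta> / 3"
    using d(2)[of a] d(2)[of b] et e by (auto simp: a_def b_def abs_mult)
  have \<eta>3: "\<eta> / 3 > 0" using \<eta> by simp
  let ?close = "\<lambda>\<delta> N s. \<forall>n\<ge>N. \<forall>m\<ge>N. \<forall>x. lindeberg n m \<delta> x \<longrightarrow>
     \<bar>resample_prob n m {l. T3 n m (count_list l) x \<le> s} - \<Phi> s\<bar> \<le> \<eta> / 3"
  obtain \<delta>1 N1 where 1: "\<delta>1 > 0" "?close \<delta>1 N1 a"
    using bootstrap_clt_T3 \<eta>3 unfolding bootstrap_clt_def by meson
  obtain \<delta>2 N2 where 2: "\<delta>2 > 0" "?close \<delta>2 N2 b"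
    using bootstrap_clt_T3 \<eta>3 unfolding bootstrap_clt_def by meson
  obtain \<delta>3 N3 where 3: "\<delta>3 > 0" "\<forall>n\<ge>N3. \<forall>m\<ge>N3. \<forall>x. lindeberg n m \<delta>3 x \<longrightarrow>
       resample_prob n m {l. e < \<bar>Q n m (count_list l) x - 1\<bar>} \<le> e"
    using Q[OF e] by meson
  define \<delta> where "\<delta> = min \<delta>1 (min \<delta>2 \<delta>3)"
  define N where "N = Suc (max N1 (max N2 N3))"
  show "\<exists>\<delta>>0. \<exists>N. \<forall>n\<ge>N. \<forall>m\<ge>N. \<forall>x. lindeberg n m \<delta> x \<longrightarrow>
     \<bar>resample_prob n m {l. T n m (count_list l) x \<le> t} - \<Phi> t\<bar> \<le> \<eta>"
  proof (intro exI[of _ \<delta>] exI[of _ N] conjI allI impI)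
    show "\<delta> > 0" using 1 2 3 by (simp add: \<delta>_def)
    fix n m x assume nm: "N \<le> n" "N \<le> m" and lind: "lindeberg n m \<delta> x"
    have nm0: "0 < n" "0 < m" "N1 \<le> n" "N2 \<le> n" "N3 \<le> n" "N1 \<le> m" "N2 \<le> m" "N3 \<le> m"
      using nm by (auto simp: N_def)
    have v: "0 < sample_var n x" using lind by (simp add: lindeberg_def)
    have l: "lindeberg n m \<delta>1 x" "lindeberg n m \<delta>2 x" "lindeberg n m \<delta>3 x"
      using lind by (auto intro: lindeberg_mono simp: \<delta>_def)
    let ?P = "resample_prob n m"
    let ?bad = "{l. e < \<bar>Q n m (count_list l) x - 1\<bar>}"
    have bad: "?P ?bad \<le> \<eta> / 3" using 3(2) nm0 l e_le by force
    have near: "t * Q n m (count_list l) x \<le> b" "a \<le> t * Q n m (count_list l) x" "0 < Q n m (count_list l) x"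
      if "l \<notin> ?bad" for l
    proof -
      have "\<bar>Q n m (count_list l) x - 1\<bar> \<le> e" using that by simp
      moreover have "\<bar>t * Q n m (count_list l) x - t\<bar> = \<bar>t\<bar> * \<bar>Q n m (count_list l) x - 1\<bar>"
        by (simp add: right_diff_distrib flip: abs_mult)
      ultimately have "\<bar>t * Q n m (count_list l) x - t\<bar> \<le> \<bar>t\<bar> * e" by (simp add: mult_left_mono)
      thus "t * Q n m (count_list l) x \<le> b" "a \<le> t * Q n m (count_list l) x"
        by (auto simp: a_def b_def abs_le_iff mult.commute)
      show "0 < Q n m (count_list l) x" using that e_le by auto
    qed
    have T_iff: "T n m (count_list l) x \<le> t \<longleftrightarrow> T3 n m (count_list l) x \<le> t * Q n m (count_list l) x"
      if "l \<notin> ?bad" for l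
      using near(3)[OF that] T[OF nm0(1,2) v] by (simp add: pos_divide_le_eq)
    have "?P {l. T n m (count_list l) x \<le> t} \<le> ?P ({l. T3 n m (count_list l) x \<le> b} \<union> ?bad)"
      using T_iff near by (intro measure_pmf.finite_measure_mono) force+
    also have "\<dots> \<le> ?P {l. T3 n m (count_list l) x \<le> b} + ?P ?bad"
      by (intro measure_Un_le) auto
    finally have upper: "?P {l. T n m (count_list l) x \<le> t} \<le> ?P {l. T3 n m (count_list l) x \<le> b} + ?P ?bad" .
    have "?P {l. T3 n m (count_list l) x \<le> a} \<le> ?P ({l. T n m (count_list l) x \<le> t} \<union> ?bad)"
      using T_iff near by (intro measure_pmf.finite_measure_mono) force+
    also have "\<dots> \<le> ?P {l. T n m (count_list l) x \<le> t} + ?P ?bad"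
      by (intro measure_Un_le) auto
    finally have lower: "?P {l. T3 n m (count_list l) x \<le> a} \<le> ?P {l. T n m (count_list l) x \<le> t} + ?P ?bad" .
    have "\<bar>?P {l. T3 n m (count_list l) x \<le> a} - \<Phi> a\<bar> \<le> \<eta> / 3"
      using 1(2) nm0 l(1) by blast
    moreover have "\<bar>?P {l. T3 n m (count_list l) x \<le> b} - \<Phi> b\<bar> \<le> \<eta> / 3"
      using 2(2) nm0 l(2) by blast
    ultimately show "\<bar>?P {l. T n m (count_list l) x \<le> t} - \<Phi> t\<bar> \<le> \<eta>"
      using upper lower bad ab by linarith
  qed
qed

lemma prob_resample_mono:
  assumes "0 < n" "\<And>l. set l \<subseteq> {1..n} \<Longrightarrow> length l = m \<Longrightarrow> P l \<Longrightarrow> Q l"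
  shows "resample_prob n m {l. P l} \<le> resample_prob n m {l. Q l}"
  using assms by (intro measure_pmf.finite_measure_mono_AE) (auto simp: AE_measure_pmf_iff set_pmf_resample)

lemma prob_resample_disj_le:
  "resample_prob n m {l. P l \<or> Q l} \<le>
   resample_prob n m {l. P l} + resample_prob n m {l. Q l}"
  unfolding Collect_disj_eq by (intro measure_Un_le) auto

lemma prob_resample_markov:
  assumes "0 < n" "0 < a" "\<And>l. 0 \<le> f l"
  shows "resample_prob n m {l. a \<le> f l} \<le> resample_mean n m f / a"
  using integral_Markov_inequality_measure[of "measure_pmf (resample n m)" f "{}" a] assms by simp

lemma abs_sqrt_minus_one_le:
  fixes r :: real
  assumes "0 \<le> r"
  shows "\<bar>sqrt r - 1\<bar> \<le> \<bar>r - 1\<bar>"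
proof -
  have "r - 1 = (sqrt r - 1) * (sqrt r + 1)" using assms by (simp add: algebra_simps)
  hence "\<bar>r - 1\<bar> = \<bar>sqrt r - 1\<bar> * (sqrt r + 1)" using assms by (simp add: abs_mult)
  moreover have "\<bar>sqrt r - 1\<bar> * 1 \<le> \<bar>sqrt r - 1\<bar> * (sqrt r + 1)" using assms by (intro mult_left_mono) auto
  ultimately show ?thesis by simp
qed

lemma count_dispersion_ratio:
  assumes "0 < n" "0 < m" "length l = m"
  shows "real m * (\<Sum>i=1..n. (real (count_list l i) / real m - 1 / real n)\<^sup>2) = count_dispersion n l / real m"
proof -
  have "real m * (real (count_list l i) / real m - 1 / real n)\<^sup>2 =
      (real (count_list l i) - real (length l) / real n)\<^sup>2 / real m" for i
    using assms by (simp add: power2_eq_square field_simps)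
  thus ?thesis by (simp add: count_dispersion_def sum_distrib_left sum_divide_distrib)
qed

lemma prob_weight_norm_far:
  assumes \<eta>: "0 < \<eta>" and n: "0 < n" "2 / \<eta> \<le> real n" "8 / \<eta> ^ 3 \<le> real n" and m: "0 < m"
  shows "resample_prob n m
    {l. \<eta> < \<bar>sqrt (real m * (\<Sum>i=1..n. (real (count_list l i) / real m - 1 / real n)\<^sup>2)) - 1\<bar>} \<le> \<eta>"
proof -
  define E where "E l = count_dispersion n l - real m * (1 - 1 / real n)" for l
  have "(\<eta> * real m / 2)\<^sup>2 \<le> (E l)\<^sup>2"
    if l: "set l \<subseteq> {1..n}" "length l = m"
      "\<eta> < \<bar>sqrt (real m * (\<Sum>i=1..n. (real (count_list l i) / real m - 1 / real n)\<^sup>2)) - 1\<bar>" for l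
  proof -
    have "\<eta> < \<bar>sqrt (count_dispersion n l / real m) - 1\<bar>"
      using l(3) unfolding count_dispersion_ratio[OF n(1) m l(2)] .
    also have "\<dots> \<le> \<bar>count_dispersion n l / real m - 1\<bar>"
      by (intro abs_sqrt_minus_one_le divide_nonneg_nonneg) (auto simp: count_dispersion_def sum_nonneg)
    also have "count_dispersion n l / real m - 1 = E l / real m - 1 / real n"
      using m by (simp add: E_def diff_divide_distrib)
    also have "\<bar>\<dots>\<bar> \<le> \<bar>E l\<bar> / real m + 1 / real n"
      by (rule order_trans[OF abs_triangle_ineq4]) (simp add: abs_divide)
    also have "1 / real n \<le> \<eta> / 2" using n \<eta> by (simp add: field_simps)
    finally have "\<eta> < \<bar>E l\<bar> / real m + \<eta> / 2" by simp
    hence "\<eta> / 2 < \<bar>E l\<bar> / real m" by linarith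
    hence "\<eta> * real m / 2 < \<bar>E l\<bar>" using m by (simp add: field_simps)
    hence "(\<eta> * real m / 2)\<^sup>2 \<le> \<bar>E l\<bar>\<^sup>2" using \<eta> by (intro power_mono) auto
    thus ?thesis by simp
  qed
  hence "resample_prob n m
    {l. \<eta> < \<bar>sqrt (real m * (\<Sum>i=1..n. (real (count_list l i) / real m - 1 / real n)\<^sup>2)) - 1\<bar>} \<le>
    resample_prob n m {l. (\<eta> * real m / 2)\<^sup>2 \<le> (E l)\<^sup>2}"
    by (intro prob_resample_mono n(1)) auto
  also have "\<dots> \<le> resample_mean n m (\<lambda>l. (E l)\<^sup>2) / (\<eta> * real m / 2)\<^sup>2"
    using \<eta> m by (intro prob_resample_markov n(1)) auto
  also have "\<dots> \<le> (2 * (real m)\<^sup>2 / real n) / (\<eta> * real m / 2)\<^sup>2"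
    unfolding E_def by (intro divide_right_mono expectation_count_dispersion_deviation n(1)) simp
  also have "\<dots> = 8 / \<eta> ^ 3 * \<eta> / real n"
    using \<eta> m n by (simp add: power2_eq_square power3_eq_cube field_simps)
  also have "\<dots> \<le> real n * \<eta> / real n"
    using n \<eta> by (intro divide_right_mono mult_right_mono) auto
  also have "\<dots> = \<eta>" using n by simp
  finally show ?thesis .
qed

text \<open>The two normalizations differ by a function of the weights alone, whose square is
\<open>count_dispersion n l / m\<close> for the list \<open>l\<close> of drawn indices.\<close>

lemma bootstrap_clt_T1: "bootstrap_clt T1"
proof (rule bootstrap_clt_ratio)
  fix n m :: nat and v x
  assume nm: "0 < n" "0 < m" "0 < sample_var n x"
  have "T1 n m v x = T3 n m v x / (sqrt (real m) * sqrt (\<Sum>i=1..n. (real (v i) / real m - 1 / real n)\<^sup>2))"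
    using nm by (simp add: T1_def T3_def)
  thus "T1 n m v x = T3 n m v x / sqrt (real m * (\<Sum>i=1..n. (real (v i) / real m - 1 / real n)\<^sup>2))"
    by (simp only: real_sqrt_mult)
next
  fix \<eta> :: real assume \<eta>: "0 < \<eta>"
  define N where "N = Suc (nat \<lceil>max (2 / \<eta>) (8 / \<eta> ^ 3)\<rceil>)"
  have N: "max (2 / \<eta>) (8 / \<eta> ^ 3) \<le> real N" unfolding N_def by linarith
  show "\<exists>\<delta>>0. \<exists>N. \<forall>n\<ge>N. \<forall>m\<ge>N. \<forall>x. lindeberg n m \<delta> x \<longrightarrow> resample_prob n m
    {l. \<eta> < \<bar>sqrt (real m * (\<Sum>i=1..n. (real (count_list l i) / real m - 1 / real n)\<^sup>2)) - 1\<bar>} \<le> \<eta>"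
  proof (intro exI[of _ "1::real"] exI[of _ N] conjI allI impI)
    fix n m :: nat assume nm: "N \<le> n" "N \<le> m"
    hence "max (2 / \<eta>) (8 / \<eta> ^ 3) \<le> real n" "0 < n" "0 < m" using N by (auto simp: N_def)
    thus "resample_prob n m
      {l. \<eta> < \<bar>sqrt (real m * (\<Sum>i=1..n. (real (count_list l i) / real m - 1 / real n)\<^sup>2)) - 1\<bar>} \<le> \<eta>"
      using \<eta> by (intro prob_weight_norm_far) auto
  qed auto
qed

lemma boot_var_ratio:
  assumes "0 < n" "0 < m" "set l \<subseteq> {1..n}" "length l = m" "0 < sample_var n x"
  shows "boot_var n m (count_list l) x / sample_var n x =
    sum_list (map (\<lambda>i. (standardized n x i)\<^sup>2) l) / real m - (sum_list (map (standardized n x) l) / real m)\<^sup>2"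
proof -
  define y where "y = standardized n x"
  define S where "S = sqrt (sample_var n x)"
  have S: "0 < S" "S\<^sup>2 = sample_var n x" using assms by (auto simp: S_def)
  have x: "x i = sample_mean n x + S * y i" for i
    using S by (simp add: y_def standardized_def S_def[symmetric])
  define Y where "Y = sum_list (map y l) / real m"
  have Y: "Y = (\<Sum>i=1..n. real (count_list l i) * y i) / real m"
    unfolding Y_def using assms by (simp only: sum_count_list_mult)
  have cnt: "(\<Sum>i=1..n. real (count_list l i)) = real m" using assms sum_count_list[of l n] by simp
  have "boot_mean n m (count_list l) x =
      (\<Sum>i=1..n. real (count_list l i) * sample_mean n x + S * (real (count_list l i) * y i)) / real m"
    unfolding boot_mean_def by (intro arg_cong2[where f = "(/)"] sum.cong refl) (subst x, simp add: algebra_simps)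
  also have "\<dots> = sample_mean n x + S * Y"
    unfolding sum.distrib sum_distrib_right[symmetric] sum_distrib_left[symmetric] cnt Y
    using assms by (simp add: add_divide_distrib)
  finally have bm: "boot_mean n m (count_list l) x = sample_mean n x + S * Y" .
  have "boot_var n m (count_list l) x =
      (\<Sum>i=1..n. S\<^sup>2 * (real (count_list l i) * (y i)\<^sup>2 - 2 * Y * (real (count_list l i) * y i) + Y\<^sup>2 * real (count_list l i))) / real m"
    unfolding boot_var_def bm
    by (intro arg_cong2[where f = "(/)"] sum.cong refl) (subst x, simp add: algebra_simps power2_eq_square)
  also have "\<dots> = S\<^sup>2 * ((\<Sum>i=1..n. real (count_list l i) * (y i)\<^sup>2) / real m - 2 * Y * Y + Y\<^sup>2)"
  proof -
    have mY: "(\<Sum>i=1..n. real (count_list l i) * y i) = real m * Y" using Y assms by simp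
    show ?thesis
      unfolding sum_distrib_left[symmetric] sum.distrib sum_subtractf cnt mY
      using assms(2) by (simp add: field_simps)
  qed
  also have "\<dots> = S\<^sup>2 * ((\<Sum>i=1..n. real (count_list l i) * (y i)\<^sup>2) / real m - Y\<^sup>2)"
    by (simp add: power2_eq_square)
  also have "(\<Sum>i=1..n. real (count_list l i) * (y i)\<^sup>2) = sum_list (map (\<lambda>i. (y i)\<^sup>2) l)"
    using assms by (simp only: sum_count_list_mult)
  finally show ?thesis using S assms(5) by (simp add: y_def Y_def)
qed

text \<open>A weak law of large numbers under the Lindeberg tail bound. The part of \<open>u\<close> above \<open>\<delta> * m\<close> has small
mean and is handled by Markov's inequality; the second moment of the remaining part is at most
\<open>\<delta> * m\<close>, which is small compared with the number \<open>m\<close> of draws.\<close>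

lemma resample_weak_law:
  assumes n: "0 < n" and m: "0 < m" and u: "\<And>i. 0 \<le> u i" "(\<Sum>i=1..n. u i) = real n"
    and tail: "(\<Sum>i=1..n. u i * of_bool (\<delta> * real m < u i)) / real n \<le> \<delta>"
    and \<eta>: "0 < \<eta>" "\<delta> \<le> \<eta> / 3"
  shows "resample_prob n m {l. \<eta> < \<bar>sum_list (map u l) / real m - 1\<bar>} \<le> 9 * \<delta> / \<eta>\<^sup>2 + 3 * \<delta> / \<eta>"
proof -
  let ?E = "resample_mean n m" and ?P = "resample_prob n m"
  define u2 where "u2 i = u i * of_bool (\<delta> * real m < u i)" for i
  define u1 where "u1 i = u i - u2 i" for i
  define c where "c = (\<Sum>i=1..n. u1 i) / real n"
  define g where "g i = u1 i - c" for i
  have u2_nonneg: "0 \<le> u2 i" for i using u by (simp add: u2_def)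
  have \<delta>: "0 \<le> \<delta>" using tail by (rule order_trans[rotated]) (intro divide_nonneg_nonneg sum_nonneg; simp add: u)
  have c_eq: "c = 1 - (\<Sum>i=1..n. u2 i) / real n"
    using n u(2) by (simp add: c_def u1_def sum_subtractf diff_divide_distrib)
  have u2_mean: "(\<Sum>i=1..n. u2 i) / real n \<le> \<delta>" "0 \<le> (\<Sum>i=1..n. u2 i) / real n"
    unfolding u2_def by (rule tail) (intro divide_nonneg_nonneg sum_nonneg; simp add: u(1))
  have u1: "0 \<le> u1 i" "u1 i \<le> \<delta> * real m" for i
    using u \<delta> by (auto simp: u1_def u2_def)
  have sum_g: "(\<Sum>i=1..n. g i) = 0" using n by (simp add: g_def sum_subtractf c_def)
  have "(\<Sum>i=1..n. (g i)\<^sup>2) = (\<Sum>i=1..n. (u1 i)\<^sup>2) - 2 * c * (\<Sum>i=1..n. u1 i) + real n * c\<^sup>2"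
    by (simp add: g_def power2_diff sum.distrib sum_subtractf sum_distrib_left mult_ac)
  also have "(\<Sum>i=1..n. u1 i) = real n * c" using n by (simp add: c_def)
  finally have "(\<Sum>i=1..n. (g i)\<^sup>2) = (\<Sum>i=1..n. (u1 i)\<^sup>2) - real n * c\<^sup>2"
    by (simp add: power2_eq_square)
  moreover have "0 \<le> real n * c\<^sup>2" by simp
  ultimately have "(\<Sum>i=1..n. (g i)\<^sup>2) \<le> (\<Sum>i=1..n. (u1 i)\<^sup>2)" by linarith
  also have "\<dots> \<le> (\<Sum>i=1..n. (\<delta> * real m) * u1 i)"
    unfolding power2_eq_square by (intro sum_mono mult_right_mono u1)
  also have "\<dots> = (\<delta> * real m) * (real n * c)"
    using n by (simp add: sum_distrib_left[symmetric] c_def)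
  also have "\<dots> \<le> (\<delta> * real m) * (real n * 1)"
    using u2_mean \<delta> by (intro mult_left_mono) (auto simp: c_eq)
  finally have g_var: "(\<Sum>i=1..n. (g i)\<^sup>2) / real n \<le> \<delta> * real m"
    using n by (simp add: field_simps)
  have split: "sum_list (map u l) = sum_list (map g l) + sum_list (map u2 l) + real (length l) * c" for l
    by (induction l) (auto simp: g_def u1_def algebra_simps)
  have "?P {l. \<eta> < \<bar>sum_list (map u l) / real m - 1\<bar>} \<le>
      ?P {l. (\<eta> * real m / 3)\<^sup>2 \<le> (sum_list (map g l))\<^sup>2 \<or> \<eta> * real m / 3 \<le> sum_list (map u2 l)}"
  proof (rule prob_resample_mono[OF n], rule disjCI)
    fix l assume l: "length l = m" "\<eta> < \<bar>sum_list (map u l) / real m - 1\<bar>"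
      "\<not> \<eta> * real m / 3 \<le> sum_list (map u2 l)"
    have "0 \<le> sum_list (map u2 l)" by (intro sum_list_nonneg) (auto simp: u2_nonneg)
    have "sum_list (map u l) / real m - 1 = sum_list (map g l) / real m + sum_list (map u2 l) / real m + (c - 1)"
      using m l(1) by (simp add: split add_divide_distrib)
    moreover have "\<bar>c - 1\<bar> \<le> \<eta> / 3" using c_eq u2_mean \<eta> by linarith
    moreover have "0 \<le> sum_list (map u2 l) / real m" using \<open>0 \<le> sum_list (map u2 l)\<close> by simp
    ultimately have "\<eta> < \<bar>sum_list (map g l) / real m\<bar> + sum_list (map u2 l) / real m + \<eta> / 3"
      using l(2) by linarith
    moreover have "sum_list (map u2 l) / real m < \<eta> / 3" using l m by (simp add: field_simps)
    ultimately have "\<eta> / 3 < \<bar>sum_list (map g l) / real m\<bar>" by linarith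
    hence "\<eta> / 3 < \<bar>sum_list (map g l)\<bar> / real m" by (simp add: abs_divide)
    hence "\<eta> * real m / 3 \<le> \<bar>sum_list (map g l)\<bar>" using m by (simp add: field_simps)
    hence "(\<eta> * real m / 3)\<^sup>2 \<le> \<bar>sum_list (map g l)\<bar>\<^sup>2" using \<eta> by (intro power_mono) auto
    thus "(\<eta> * real m / 3)\<^sup>2 \<le> (sum_list (map g l))\<^sup>2" by simp
  qed
  also have "\<dots> \<le> ?P {l. (\<eta> * real m / 3)\<^sup>2 \<le> (sum_list (map g l))\<^sup>2} + ?P {l. \<eta> * real m / 3 \<le> sum_list (map u2 l)}"
    by (rule prob_resample_disj_le)
  also have "?P {l. (\<eta> * real m / 3)\<^sup>2 \<le> (sum_list (map g l))\<^sup>2} \<le> ?E (\<lambda>l. (sum_list (map g l))\<^sup>2) / (\<eta> * real m / 3)\<^sup>2"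
    using \<eta> m by (intro prob_resample_markov n) auto
  also have "\<dots> \<le> (real m * (\<delta> * real m)) / (\<eta> * real m / 3)\<^sup>2"
    unfolding expectation_resample_sum_list_sq[OF n sum_g]
    using g_var by (intro divide_right_mono mult_left_mono) auto
  also have "\<dots> = 9 * \<delta> / \<eta>\<^sup>2" using \<eta> m by (simp add: power2_eq_square field_simps)
  also have "?P {l. \<eta> * real m / 3 \<le> sum_list (map u2 l)} \<le> ?E (\<lambda>l. sum_list (map u2 l)) / (\<eta> * real m / 3)"
    using \<eta> m by (intro prob_resample_markov n sum_list_nonneg) (auto simp: u2_nonneg)
  also have "\<dots> \<le> (real m * \<delta>) / (\<eta> * real m / 3)"
    unfolding expectation_resample_sum_list[OF n]
    using u2_mean \<eta> by (intro divide_right_mono mult_left_mono) auto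
  also have "\<dots> = 3 * \<delta> / \<eta>" using \<eta> m by (simp add: field_simps)
  finally show ?thesis by simp
qed

lemma prob_boot_var_far:
  assumes n: "0 < n" and m: "0 < m" and \<eta>: "0 < \<eta>" "\<delta> \<le> \<eta> / 6" and lind: "lindeberg n m \<delta> x"
  shows "resample_prob n m {l. \<eta> < \<bar>sqrt (boot_var n m (count_list l) x / sample_var n x) - 1\<bar>}
    \<le> 36 * \<delta> / \<eta>\<^sup>2 + 6 * \<delta> / \<eta> + 2 / (real m * \<eta>)"
proof -
  let ?E = "resample_mean n m" and ?P = "resample_prob n m"
  define y where "y = standardized n x"
  have v: "0 < sample_var n x" using lind by (simp add: lindeberg_def)
  let ?U = "\<lambda>l. \<eta> / 2 < \<bar>sum_list (map (\<lambda>i. (y i)\<^sup>2) l) / real m - 1\<bar>"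
  let ?Y = "\<lambda>l. (real m)\<^sup>2 * \<eta> / 2 \<le> (sum_list (map y l))\<^sup>2"
  have "?P {l. \<eta> < \<bar>sqrt (boot_var n m (count_list l) x / sample_var n x) - 1\<bar>} \<le> ?P {l. ?U l \<or> ?Y l}"
  proof (rule prob_resample_mono[OF n], rule disjCI)
    fix l assume l: "set l \<subseteq> {1..n}" "length l = m"
      "\<eta> < \<bar>sqrt (boot_var n m (count_list l) x / sample_var n x) - 1\<bar>" "\<not> ?Y l"
    have bv: "boot_var n m (count_list l) x / sample_var n x =
      sum_list (map (\<lambda>i. (y i)\<^sup>2) l) / real m - (sum_list (map y l) / real m)\<^sup>2"
      unfolding y_def by (rule boot_var_ratio) (use n m l v in auto)
    have "\<eta> < \<bar>sqrt (boot_var n m (count_list l) x / sample_var n x) - 1\<bar>" by (rule l(3))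
    also have "\<dots> \<le> \<bar>boot_var n m (count_list l) x / sample_var n x - 1\<bar>"
      using v by (intro abs_sqrt_minus_one_le divide_nonneg_nonneg) (auto simp: boot_var_def intro!: divide_nonneg_nonneg sum_nonneg)
    also have "\<dots> \<le> \<bar>sum_list (map (\<lambda>i. (y i)\<^sup>2) l) / real m - 1\<bar> + (sum_list (map y l) / real m)\<^sup>2"
      unfolding bv using zero_le_power2[of "sum_list (map y l) / real m"] by linarith
    also have "(sum_list (map y l) / real m)\<^sup>2 < \<eta> / 2"
      using l m by (simp add: power_divide field_simps)
    finally show "?U l" by simp
  qed
  also have "\<dots> \<le> ?P {l. ?U l} + ?P {l. ?Y l}" by (rule prob_resample_disj_le)
  also have "?P {l. ?U l} \<le> 9 * \<delta> / (\<eta> / 2)\<^sup>2 + 3 * \<delta> / (\<eta> / 2)"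
    using sum_standardized_sq[OF n v] lindeberg_standardized[OF lind] \<eta>
    by (intro resample_weak_law n m) (auto simp: y_def)
  also have "?P {l. ?Y l} \<le> ?E (\<lambda>l. (sum_list (map y l))\<^sup>2) / ((real m)\<^sup>2 * \<eta> / 2)"
    using \<eta> m by (intro prob_resample_markov n) auto
  also have "?E (\<lambda>l. (sum_list (map y l))\<^sup>2) = real m"
    unfolding y_def expectation_resample_sum_list_sq[OF n sum_standardized[OF n]] sum_standardized_sq[OF n v] using n by simp
  also have "real m / ((real m)\<^sup>2 * \<eta> / 2) = 2 / (real m * \<eta>)"
    using m \<eta> by (simp add: power2_eq_square field_simps)
  finally show ?thesis using \<eta> by (simp add: power2_eq_square field_simps)
qed

text \<open>The two normalizations differ by the ratio of bootstrap variance and sample variance. In terms of the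
standardized data it is a mean of squares minus a squared mean: the first tends to 1 by the weak law,
the second has expectation \<open>1 / m\<close>.\<close>

lemma bootstrap_clt_T2: "bootstrap_clt T2"
proof (rule bootstrap_clt_ratio)
  fix n m :: nat and v x
  assume nm: "0 < n" "0 < m" "0 < sample_var n x"
  show "T2 n m v x = T3 n m v x / sqrt (boot_var n m v x / sample_var n x)"
    using nm by (simp add: T2_def T3_def real_sqrt_divide)
next
  fix \<eta> :: real assume \<eta>: "0 < \<eta>"
  define \<delta> where "\<delta> = min (\<eta> / 6) (min (\<eta> ^ 3 / 108) (\<eta>\<^sup>2 / 18))"
  have "0 < \<delta>" using \<eta> by (auto simp: \<delta>_def)
  moreover have "\<delta> \<le> \<eta> / 6" "\<delta> \<le> \<eta> ^ 3 / 108" "\<delta> \<le> \<eta>\<^sup>2 / 18" unfolding \<delta>_def by linarith+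
  ultimately have \<delta>: "0 < \<delta>" "\<delta> \<le> \<eta> / 6" "\<delta> \<le> \<eta> ^ 3 / 108" "\<delta> \<le> \<eta>\<^sup>2 / 18" by auto
  define N where "N = Suc (nat \<lceil>6 / \<eta>\<^sup>2\<rceil>)"
  have N: "6 / \<eta>\<^sup>2 \<le> real N" unfolding N_def by linarith
  show "\<exists>\<delta>>0. \<exists>N. \<forall>n\<ge>N. \<forall>m\<ge>N. \<forall>x. lindeberg n m \<delta> x \<longrightarrow> resample_prob n m
    {l. \<eta> < \<bar>sqrt (boot_var n m (count_list l) x / sample_var n x) - 1\<bar>} \<le> \<eta>"
  proof (intro exI[of _ \<delta>] exI[of _ N] conjI allI impI \<delta>(1))
    fix n m x assume nm: "N \<le> n" "N \<le> m" and lind: "lindeberg n m \<delta> x"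
    have nm0: "0 < n" "0 < m" "6 / \<eta>\<^sup>2 \<le> real m" using nm N by (auto simp: N_def)
    have "resample_prob n m {l. \<eta> < \<bar>sqrt (boot_var n m (count_list l) x / sample_var n x) - 1\<bar>}
        \<le> 36 * \<delta> / \<eta>\<^sup>2 + 6 * \<delta> / \<eta> + 2 / (real m * \<eta>)"
      using nm0 \<eta> \<delta> lind by (intro prob_boot_var_far) auto
    also have "36 * \<delta> / \<eta>\<^sup>2 \<le> 36 * (\<eta> ^ 3 / 108) / \<eta>\<^sup>2"
      using \<delta> by (intro divide_right_mono mult_left_mono) auto
    also have "\<dots> = \<eta> / 3" using \<eta> by (simp add: power2_eq_square power3_eq_cube)
    also have "6 * \<delta> / \<eta> \<le> 6 * (\<eta>\<^sup>2 / 18) / \<eta>"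
      using \<delta> \<eta> by (intro divide_right_mono mult_left_mono) auto
    also have "\<dots> = \<eta> / 3" using \<eta> by (simp add: power2_eq_square)
    also have "2 / (real m * \<eta>) \<le> \<eta> / 3"
      using nm0 \<eta> by (simp add: field_simps power2_eq_square)
    finally show "resample_prob n m
        {l. \<eta> < \<bar>sqrt (boot_var n m (count_list l) x / sample_var n x) - 1\<bar>} \<le> \<eta>" by simp
  qed
qed

section \<open>From conditional laws to quantiles of simulated statistics\<close>

lemma sigma_sets_preimage_comp:
  assumes Y: "Y \<in> measurable M S" and g: "g \<in> measurable S N"
  shows "sigma_sets (space M) {(\<lambda>\<omega>. g (Y \<omega>)) -` A \<inter> space M | A. A \<in> sets N} \<subseteq>
    sigma_sets (space M) {Y -` A \<inter> space M | A. A \<in> sets S}"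
proof (rule sigma_sets_mono', clarify)
  fix A assume A: "A \<in> sets N"
  show "\<exists>B. (\<lambda>\<omega>. g (Y \<omega>)) -` A \<inter> space M = Y -` B \<inter> space M \<and> B \<in> sets S"
    using measurable_space[OF Y] measurable_sets[OF g A] by (intro exI[of _ "g -` A \<inter> space S"]) auto
qed

text \<open>Real functions of the two random elements have a common range, so that the product rule for
expectations of independent random variables becomes available.\<close>

lemma (in prob_space) indep_elements_indep_var:
  assumes "indep_elements M S Y T Z" "g \<in> borel_measurable S" "f \<in> borel_measurable T"
  shows "indep_var borel (\<lambda>\<omega>. g (Y \<omega>) :: real) borel (\<lambda>\<omega>. f (Z \<omega>) :: real)"
proof -
  have [measurable]: "Y \<in> measurable M S" "Z \<in> measurable M T"
    using assms(1) by (auto simp: indep_elements_def)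
  note [measurable] = assms(2,3)
  show ?thesis
    using assms(1) sigma_sets_preimage_comp[of Y M S g borel] sigma_sets_preimage_comp[of Z M T f borel] assms(2,3)
    unfolding indep_var_eq indep_elements_def indep_sets2_eq by (auto; blast)
qed

definition weight_pmf :: "nat \<Rightarrow> nat \<Rightarrow> (nat \<Rightarrow> nat) pmf" where
  "weight_pmf n m = map_pmf (\<lambda>l. restrict (count_list l) {1..n}) (resample n m)"

lemma finite_set_weight_pmf: "0 < n \<Longrightarrow> finite (set_pmf (weight_pmf n m))"
  by (simp add: weight_pmf_def)

lemma set_weight_pmf: "set_pmf (weight_pmf n m) \<subseteq> PiE {1..n} (\<lambda>_. UNIV)"
  by (auto simp: weight_pmf_def)

locale iid_data = prob_space M for M :: "'a measure" +
  fixes X :: "'a \<Rightarrow> real" and Xs :: "nat \<Rightarrow> 'a \<Rightarrow> real"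
  assumes sample: "iid_sample M X Xs"
begin

lemma Xs_indep: "indep_vars (\<lambda>_. borel) Xs {1..}"
  and Xs_distr: "1 \<le> i \<Longrightarrow> distr M borel (Xs i) = distr M borel X"
  and X_measurable [measurable]: "X \<in> borel_measurable M"
  using sample unfolding iid_sample_def by auto

lemma Xs_meas [measurable]: "1 \<le> i \<Longrightarrow> Xs i \<in> borel_measurable M"
  using Xs_indep unfolding indep_vars_def by auto

end

locale efron_bootstrap = iid_data M X Xs for M :: "'a measure" and X Xs +
  fixes m :: "nat \<Rightarrow> nat" and w :: "nat \<Rightarrow> nat \<Rightarrow> nat \<Rightarrow> 'a \<Rightarrow> nat"
  assumes weights: "efron_weights M Xs m w"
begin

definition data :: "'a \<Rightarrow> nat \<Rightarrow> real" where
  "data \<omega> = (\<lambda>i\<in>{1..}. Xs i \<omega>)"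

definition data_space :: "(nat \<Rightarrow> real) measure" where
  "data_space = PiM {1..} (\<lambda>_. borel)"

text \<open>Restriction to \<open>{1..n}\<close> leaves a countable range, so that conditioning on the weights is a summation
over atoms.\<close>

definition wts :: "nat \<Rightarrow> nat \<Rightarrow> 'a \<Rightarrow> nat \<Rightarrow> nat" where
  "wts n b \<omega> = (\<lambda>i\<in>{1..n}. w b n i \<omega>)"

lemma data_measurable [measurable]: "data \<in> measurable M data_space"
  unfolding data_def[abs_def] data_space_def by (intro measurable_restrict) auto

lemma w_measurable [measurable]:
  "1 \<le> n \<Longrightarrow> 1 \<le> b \<Longrightarrow> i \<in> {1..n} \<Longrightarrow> w b n i \<in> measurable M (count_space UNIV)"
  using weights unfolding efron_weights_def multinomial_distributed_def by auto

lemma wts_eq_iff: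
  "k \<in> PiE {1..n} (\<lambda>_. UNIV) \<Longrightarrow> wts n b \<omega> = k \<longleftrightarrow> (\<forall>i\<in>{1..n}. w b n i \<omega> = k i)"
  unfolding wts_def by (auto simp: fun_eq_iff PiE_def extensional_def restrict_def)

lemma wts_measurable [measurable]:
  assumes "1 \<le> n" "1 \<le> b"
  shows "wts n b \<in> measurable M (count_space (PiE {1..n} (\<lambda>_. UNIV)))"
proof -
  have "wts n b -` {k} \<inter> space M \<in> sets M" if k: "k \<in> PiE {1..n} (\<lambda>_. UNIV)" for k
  proof -
    have "wts n b -` {k} \<inter> space M = {\<omega> \<in> space M. \<forall>i\<in>{1..n}. w b n i \<omega> = k i}"
      using wts_eq_iff[OF k] by auto
    also have "\<dots> \<in> sets M" using assms by measurable
    finally show ?thesis .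
  qed
  moreover have "countable (PiE {1..n} (\<lambda>_. UNIV :: nat set))" by (intro countable_PiE) auto
  moreover have "wts n b \<in> space M \<rightarrow> PiE {1..n} (\<lambda>_. UNIV)" by (auto simp: wts_def)
  ultimately show ?thesis by (subst measurable_count_space_eq_countable) auto
qed

lemma prob_wts_eq:
  assumes "1 \<le> n" "1 \<le> b" and k: "k \<in> PiE {1..n} (\<lambda>_. UNIV)"
  shows "prob {\<omega> \<in> space M. wts n b \<omega> = k} = pmf (weight_pmf n (m n)) k"
proof -
  have "prob {\<omega> \<in> space M. wts n b \<omega> = k} = prob {\<omega> \<in> space M. \<forall>i\<in>{1..n}. w b n i \<omega> = k i}"
    using wts_eq_iff[OF k] by simp
  also have "\<dots> = resample_prob n (m n) {l. \<forall>i\<in>{1..n}. count_list l i = k i}"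
    using weights assms unfolding efron_weights_def multinomial_distributed_def
    by (subst prob_resample_counts) auto
  also have "{l. \<forall>i\<in>{1..n}. count_list l i = k i} = (\<lambda>l. restrict (count_list l) {1..n}) -` {k}"
    using k by (auto simp: fun_eq_iff PiE_def extensional_def restrict_def)
  finally show ?thesis by (simp add: weight_pmf_def pmf_map)
qed

lemma AE_wts:
  assumes "1 \<le> n" "1 \<le> b"
  shows "AE \<omega> in M. wts n b \<omega> \<in> set_pmf (weight_pmf n (m n))"
proof -
  let ?K = "set_pmf (weight_pmf n (m n))"
  have fin: "finite ?K" using assms by (intro finite_set_weight_pmf) simp
  have ev: "{\<omega> \<in> space M. wts n b \<omega> = k} \<in> events" if "k \<in> ?K" for k
    using measurable_sets[OF wts_measurable[OF assms], of "{k}"] set_weight_pmf that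
    by (auto simp: vimage_def Int_def conj_commute)
  have "prob {\<omega> \<in> space M. wts n b \<omega> \<in> ?K} = prob (\<Union>k\<in>?K. {\<omega> \<in> space M. wts n b \<omega> = k})"
    by (intro arg_cong[where f = prob]) auto
  also have "\<dots> = (\<Sum>k\<in>?K. prob {\<omega> \<in> space M. wts n b \<omega> = k})"
    using fin ev by (intro finite_measure_finite_Union) (auto simp: disjoint_family_on_def)
  also have "\<dots> = (\<Sum>k\<in>?K. pmf (weight_pmf n (m n)) k)"
    using set_weight_pmf assms by (intro sum.cong prob_wts_eq) auto
  also have "\<dots> = 1" using fin by (intro sum_pmf_eq_1) auto
  finally have "prob {\<omega> \<in> space M. wts n b \<omega> \<in> ?K} = 1" .
  moreover have "{\<omega> \<in> space M. wts n b \<omega> \<in> ?K} = (\<Union>k\<in>?K. {\<omega> \<in> space M. wts n b \<omega> = k})" by auto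
  ultimately show ?thesis using fin ev by (subst (asm) prob_Collect_eq_1) (auto intro!: sets.finite_UN)
qed

text \<open>That two weight vectors take given values is an event of the whole weight array, which is independent
of the data; its probability factorizes by independence of the bootstrap samples.\<close>

lemma expectation_data_wts:
  assumes "1 \<le> n" "1 \<le> b" "1 \<le> c" "b \<noteq> c"
    and k: "k \<in> PiE {1..n} (\<lambda>_. UNIV)" "k' \<in> PiE {1..n} (\<lambda>_. UNIV)"
    and g [measurable]: "g \<in> borel_measurable data_space" and bound: "\<And>x. \<bar>g x\<bar> \<le> 1"
  shows "expectation (\<lambda>\<omega>. g (data \<omega>) * of_bool (wts n b \<omega> = k \<and> wts n c \<omega> = k')) =
    expectation (\<lambda>\<omega>. g (data \<omega>)) * (pmf (weight_pmf n (m n)) k * pmf (weight_pmf n (m n)) k')"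
proof -
  let ?P = "PiM ({1..} \<times> {1..n}) (\<lambda>(b, i). count_space UNIV) :: (nat \<times> nat \<Rightarrow> nat) measure"
  let ?Z = "\<lambda>\<omega>. \<lambda>(b, i) \<in> {1..} \<times> {1..n}. w b n i \<omega>"
  define f :: "(nat \<times> nat \<Rightarrow> nat) \<Rightarrow> real" where
    "f z = of_bool (\<forall>i\<in>{1..n}. z (b, i) = k i \<and> z (c, i) = k' i)" for z
  have [measurable]: "(\<lambda>z. z (b, i)) \<in> measurable ?P (count_space UNIV)"
      "(\<lambda>z. z (c, i)) \<in> measurable ?P (count_space UNIV)" if "i \<in> {1..n}" for i
    using measurable_component_singleton[of "(b, i)" "{1..} \<times> {1..n}" "\<lambda>(b, i). count_space UNIV"]
      measurable_component_singleton[of "(c, i)" "{1..} \<times> {1..n}" "\<lambda>(b, i). count_space UNIV"] assms that by auto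
  have [measurable]: "Measurable.pred ?P (\<lambda>z. \<forall>i\<in>{1..n}. z (b, i) = k i \<and> z (c, i) = k' i)"
    by measurable
  have f: "f \<in> borel_measurable ?P" unfolding f_def[abs_def] by measurable
  have "indep_elements M data_space data ?P ?Z"
    using weights assms(1) unfolding efron_weights_def data_space_def data_def[abs_def] by blast
  from indep_elements_indep_var[OF this g f]
  have ind: "indep_var borel (\<lambda>\<omega>. g (data \<omega>)) borel (\<lambda>\<omega>. f (?Z \<omega>))" .
  have fZ: "f (?Z \<omega>) = of_bool (wts n b \<omega> = k \<and> wts n c \<omega> = k')" for \<omega>
    using assms by (auto simp: f_def wts_eq_iff)
  have fZ_meas: "(\<lambda>\<omega>. f (?Z \<omega>)) \<in> borel_measurable M" using ind by (rule indep_var_rv2)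
  have int1: "integrable M (\<lambda>\<omega>. g (data \<omega>))"
    by (rule integrable_const_bound[where B = 1]) (use bound in auto)
  have int2: "integrable M (\<lambda>\<omega>. f (?Z \<omega>))"
    by (rule integrable_const_bound[where B = 1, OF AE_I2 fZ_meas]) (simp add: f_def)
  have "expectation (\<lambda>\<omega>. f (?Z \<omega>)) = prob {\<omega> \<in> space M. wts n b \<omega> = k \<and> wts n c \<omega> = k'}"
  proof -
    have "expectation (\<lambda>\<omega>. f (?Z \<omega>)) = expectation (indicator {\<omega> \<in> space M. wts n b \<omega> = k \<and> wts n c \<omega> = k'})"
      unfolding fZ by (intro Bochner_Integration.integral_cong refl) (simp add: indicator_def)
    thus ?thesis by (simp add: Int_absorb2 subset_eq)
  qed
  also have "{\<omega> \<in> space M. wts n b \<omega> = k \<and> wts n c \<omega> = k'} =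
      (\<Inter>j\<in>{b, c}. (\<lambda>\<omega>. wts n j \<omega>) -` (if j = b then {k} else {k'}) \<inter> space M)"
    using assms(4) by auto
  also have "prob \<dots> = (\<Prod>j\<in>{b, c}. prob ((\<lambda>\<omega>. wts n j \<omega>) -` (if j = b then {k} else {k'}) \<inter> space M))"
  proof (rule indep_varsD)
    show "indep_vars (\<lambda>b. PiM {1..n} (\<lambda>i. count_space UNIV)) (\<lambda>j \<omega>. wts n j \<omega>) {1..}"
      using weights assms(1) unfolding efron_weights_def wts_def by blast
    have "{k} \<in> sets (PiM {1..n} (\<lambda>i. count_space UNIV))" if "k \<in> PiE {1..n} (\<lambda>_. UNIV)" for k :: "nat \<Rightarrow> nat"
    proof -
      have "PiE {1..n} (\<lambda>i. {k i}) = {k}" using that by (intro PiE_singleton) (auto simp: PiE_def)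
      moreover have "PiE {1..n} (\<lambda>i. {k i}) \<in> sets (PiM {1..n} (\<lambda>i. count_space UNIV))"
        by (intro sets_PiM_I_finite) auto
      ultimately show ?thesis by simp
    qed
    thus "(if j = b then {k} else {k'}) \<in> sets (PiM {1..n} (\<lambda>i. count_space UNIV))" for j
      using k by simp
  qed (use assms in auto)
  also have "\<dots> = prob {\<omega> \<in> space M. wts n b \<omega> = k} * prob {\<omega> \<in> space M. wts n c \<omega> = k'}"
    using assms(4) by (simp add: vimage_def Int_def conj_commute)
  also have "\<dots> = pmf (weight_pmf n (m n)) k * pmf (weight_pmf n (m n)) k'"
    using assms by (simp add: prob_wts_eq)
  finally have Ef: "expectation (\<lambda>\<omega>. f (?Z \<omega>)) = pmf (weight_pmf n (m n)) k * pmf (weight_pmf n (m n)) k'" .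
  have "expectation (\<lambda>\<omega>. g (data \<omega>) * f (?Z \<omega>)) = expectation (\<lambda>\<omega>. g (data \<omega>)) * expectation (\<lambda>\<omega>. f (?Z \<omega>))"
    by (rule indep_var_lebesgue_integral[OF ind int1 int2])
  thus ?thesis using Ef unfolding fZ by simp
qed

text \<open>Two bootstrap samples are conditionally independent with the same law given the data. Since the
weights take finitely many values almost surely, the conditional expectation is a finite sum over
pairs of weight vectors.\<close>

lemma expectation_two_resamples:
  fixes H :: "(nat \<Rightarrow> nat) \<Rightarrow> (nat \<Rightarrow> real) \<Rightarrow> real"
  assumes "1 \<le> n" "1 \<le> b" "1 \<le> c" "b \<noteq> c"
    and H [measurable]: "\<And>k. H k \<in> borel_measurable data_space" and bound: "\<And>k x. \<bar>H k x\<bar> \<le> 1"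
  shows "expectation (\<lambda>\<omega>. H (wts n b \<omega>) (data \<omega>) * H (wts n c \<omega>) (data \<omega>)) =
    expectation (\<lambda>\<omega>. (measure_pmf.expectation (weight_pmf n (m n)) (\<lambda>k. H k (data \<omega>)))\<^sup>2)"
proof -
  define q where "q = weight_pmf n (m n)"
  define K where "K = set_pmf q"
  have fin: "finite K" unfolding K_def q_def using assms by (intro finite_set_weight_pmf) simp
  have K: "k \<in> PiE {1..n} (\<lambda>_. UNIV)" if "k \<in> K" for k using that set_weight_pmf unfolding K_def q_def by blast
  have HH: "\<bar>H k x * H k' x\<bar> \<le> 1" for k k' x
    unfolding abs_mult using bound[of k x] bound[of k' x] by (intro mult_le_one) auto
  have intH: "integrable M (\<lambda>\<omega>. H k (data \<omega>) * H k' (data \<omega>))" for k k'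
    by (rule integrable_const_bound[where B = 1]) (use HH in auto)
  have [measurable]: "Measurable.pred M (\<lambda>\<omega>. wts n j \<omega> = k)" if "k \<in> K" "1 \<le> j" for k j
    using measurable_sets[OF wts_measurable[OF assms(1) that(2)], of "{k}"] K[OF that(1)]
    by (auto simp: pred_def vimage_def Int_def conj_commute)
  have ob: "\<bar>r * of_bool P\<bar> \<le> 1" if "\<bar>r\<bar> \<le> 1" for r :: real and P using that by simp
  have intHi: "integrable M (\<lambda>\<omega>. (H k (data \<omega>) * H k' (data \<omega>)) * of_bool (wts n b \<omega> = k \<and> wts n c \<omega> = k'))"
    if "k \<in> K" "k' \<in> K" for k k'
    using that assms by (intro integrable_const_bound[where B = 1] AE_I2 borel_measurable_times) (auto intro!: HH ob)
  have AE: "AE \<omega> in M. H (wts n b \<omega>) (data \<omega>) * H (wts n c \<omega>) (data \<omega>) =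
     (\<Sum>k\<in>K. \<Sum>k'\<in>K. (H k (data \<omega>) * H k' (data \<omega>)) * of_bool (wts n b \<omega> = k \<and> wts n c \<omega> = k'))"
    using AE_wts[OF assms(1,2)] AE_wts[OF assms(1,3)]
  proof eventually_elim
    fix \<omega> assume in_K: "wts n b \<omega> \<in> set_pmf (weight_pmf n (m n))" "wts n c \<omega> \<in> set_pmf (weight_pmf n (m n))"
    have "(\<Sum>k\<in>K. \<Sum>k'\<in>K. (H k (data \<omega>) * H k' (data \<omega>)) * of_bool (wts n b \<omega> = k \<and> wts n c \<omega> = k')) =
      (\<Sum>k\<in>K. if k = wts n b \<omega> then (\<Sum>k'\<in>K. if k' = wts n c \<omega> then H k (data \<omega>) * H k' (data \<omega>) else 0) else 0)"
      by (intro sum.cong refl) (auto intro!: sum.cong)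
    thus "H (wts n b \<omega>) (data \<omega>) * H (wts n c \<omega>) (data \<omega>) =
     (\<Sum>k\<in>K. \<Sum>k'\<in>K. (H k (data \<omega>) * H k' (data \<omega>)) * of_bool (wts n b \<omega> = k \<and> wts n c \<omega> = k'))"
      using in_K fin unfolding q_def[symmetric] K_def[symmetric] by simp
  qed
  have "expectation (\<lambda>\<omega>. H (wts n b \<omega>) (data \<omega>) * H (wts n c \<omega>) (data \<omega>)) =
      expectation (\<lambda>\<omega>. \<Sum>k\<in>K. \<Sum>k'\<in>K. (H k (data \<omega>) * H k' (data \<omega>)) * of_bool (wts n b \<omega> = k \<and> wts n c \<omega> = k'))"
  proof (rule integral_cong_AE[OF _ _ AE])
    have PiE_eq: "(\<lambda>\<omega>. H (wts n j \<omega>) (data \<omega>)) \<in> borel_measurable M" if "1 \<le> j" for j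
    proof (rule measurable_compose_countable'[OF _ wts_measurable[OF assms(1) that]])
      show "countable (PiE {1..n} (\<lambda>_. UNIV :: nat set))" by (intro countable_PiE) auto
    qed measurable
    show "(\<lambda>\<omega>. H (wts n b \<omega>) (data \<omega>) * H (wts n c \<omega>) (data \<omega>)) \<in> borel_measurable M"
      using PiE_eq assms by (intro borel_measurable_times) auto
    show "(\<lambda>\<omega>. \<Sum>k\<in>K. \<Sum>k'\<in>K. (H k (data \<omega>) * H k' (data \<omega>)) * of_bool (wts n b \<omega> = k \<and> wts n c \<omega> = k')) \<in> borel_measurable M"
      using intHi by (intro borel_measurable_sum borel_measurable_integrable) auto
  qed
  also have "\<dots> = (\<Sum>k\<in>K. \<Sum>k'\<in>K. expectation (\<lambda>\<omega>. (H k (data \<omega>) * H k' (data \<omega>)) * of_bool (wts n b \<omega> = k \<and> wts n c \<omega> = k')))"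
    using intHi by (subst Bochner_Integration.integral_sum; (intro Bochner_Integration.integrable_sum)?; simp?)
  also have "\<dots> = (\<Sum>k\<in>K. \<Sum>k'\<in>K. expectation (\<lambda>\<omega>. H k (data \<omega>) * H k' (data \<omega>)) * (pmf q k * pmf q k'))"
    unfolding q_def
    by (intro sum.cong refl expectation_data_wts[where g = "\<lambda>x. H _ x * H _ x"] assms K HH borel_measurable_times)
       (auto simp: K_def q_def)
  also have "\<dots> = (\<Sum>k\<in>K. \<Sum>k'\<in>K. expectation (\<lambda>\<omega>. (H k (data \<omega>) * H k' (data \<omega>)) * (pmf q k * pmf q k')))"
    by simp
  also have "\<dots> = expectation (\<lambda>\<omega>. \<Sum>k\<in>K. \<Sum>k'\<in>K. (H k (data \<omega>) * H k' (data \<omega>)) * (pmf q k * pmf q k'))"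
    using intH by (subst Bochner_Integration.integral_sum; (intro Bochner_Integration.integrable_sum)?; simp?)
  also have "\<dots> = expectation (\<lambda>\<omega>. (measure_pmf.expectation q (\<lambda>k. H k (data \<omega>)))\<^sup>2)"
  proof (intro Bochner_Integration.integral_cong refl)
    fix \<omega>
    have "measure_pmf.expectation q (\<lambda>k. H k (data \<omega>)) = (\<Sum>k\<in>K. pmf q k * H k (data \<omega>))"
      using fin by (subst integral_measure_pmf[of K]) (auto simp: K_def)
    thus "(\<Sum>k\<in>K. \<Sum>k'\<in>K. (H k (data \<omega>) * H k' (data \<omega>)) * (pmf q k * pmf q k')) =
        (measure_pmf.expectation q (\<lambda>k. H k (data \<omega>)))\<^sup>2"
      by (simp add: power2_eq_square sum_product mult_ac)
  qed
  finally show ?thesis unfolding q_def .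
qed

end

text \<open>Measurability in the observations for fixed weights suffices, because the weights range over a
countable set.\<close>

definition sample_statistic :: "(nat \<Rightarrow> nat \<Rightarrow> (nat \<Rightarrow> nat) \<Rightarrow> (nat \<Rightarrow> real) \<Rightarrow> real) \<Rightarrow> bool" where
  "sample_statistic T \<longleftrightarrow>
     (\<forall>n m v v' x x'. (\<forall>i\<in>{1..n}. v i = v' i \<and> x i = x' i) \<longrightarrow> T n m v x = T n m v' x') \<and>
     (\<forall>n m v. T n m v \<in> borel_measurable (PiM {1..} (\<lambda>_. borel)))"

lemma sample_statistic_cong:
  assumes "sample_statistic T" "\<And>i. i \<in> {1..n} \<Longrightarrow> v i = v' i" "\<And>i. i \<in> {1..n} \<Longrightarrow> x i = x' i"
  shows "T n m v x = T n m v' x'"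
  using assms(1)[unfolded sample_statistic_def, THEN conjunct1, THEN spec, of n, THEN spec, of m,
      THEN spec, of v, THEN spec, of v', THEN spec, of x, THEN spec, of x'] assms(2,3) by blast

lemma sample_mean_cong:
  assumes "\<And>i. i \<in> {1..n} \<Longrightarrow> x i = x' i"
  shows "sample_mean n x = sample_mean n x'"
  unfolding sample_mean_def by (intro arg_cong2[where f = "(/)"] sum.cong refl assms)

lemma sample_var_cong:
  assumes "\<And>i. i \<in> {1..n} \<Longrightarrow> x i = x' i"
  shows "sample_var n x = sample_var n x'"
proof -
  have eq: "sample_mean n x = sample_mean n x'" using assms by (rule sample_mean_cong)
  show ?thesis
    unfolding sample_var_def eq using assms by (intro arg_cong2[where f = "(/)"] sum.cong refl) simp
qed

lemma boot_mean_cong: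
  assumes "\<And>i. i \<in> {1..n} \<Longrightarrow> v i = v' i" "\<And>i. i \<in> {1..n} \<Longrightarrow> x i = x' i"
  shows "boot_mean n m v x = boot_mean n m v' x'"
  unfolding boot_mean_def using assms by (intro arg_cong2[where f = "(/)"] sum.cong refl) simp

lemma boot_var_cong:
  assumes "\<And>i. i \<in> {1..n} \<Longrightarrow> v i = v' i" "\<And>i. i \<in> {1..n} \<Longrightarrow> x i = x' i"
  shows "boot_var n m v x = boot_var n m v' x'"
proof -
  have eq: "boot_mean n m v x = boot_mean n m v' x'" using assms by (rule boot_mean_cong)
  show ?thesis
    unfolding boot_var_def eq using assms by (intro arg_cong2[where f = "(/)"] sum.cong refl) simp
qed

lemma lindeberg_cong:
  assumes "\<And>i. i \<in> {1..n} \<Longrightarrow> x i = x' i"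
  shows "lindeberg n m \<delta> x \<longleftrightarrow> lindeberg n m \<delta> x'"
proof -
  have eq: "sample_mean n x = sample_mean n x'" "sample_var n x = sample_var n x'"
    using assms by (intro sample_mean_cong sample_var_cong; blast)+
  have "(\<Sum>i=1..n. (x i - sample_mean n x')\<^sup>2 *
        of_bool (\<delta> * real m * sample_var n x' < (x i - sample_mean n x')\<^sup>2)) =
     (\<Sum>i=1..n. (x' i - sample_mean n x')\<^sup>2 *
        of_bool (\<delta> * real m * sample_var n x' < (x' i - sample_mean n x')\<^sup>2))"
    using assms by (intro sum.cong refl) simp
  thus ?thesis unfolding lindeberg_def eq by simp
qed

context
  fixes N :: "'b measure" and n :: nat and x :: "'b \<Rightarrow> nat \<Rightarrow> real"
  assumes x [measurable]: "\<And>i. i \<in> {1..n} \<Longrightarrow> (\<lambda>\<omega>. x \<omega> i) \<in> borel_measurable N"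
begin

lemma sample_mean_measurable [measurable]: "(\<lambda>\<omega>. sample_mean n (x \<omega>)) \<in> borel_measurable N"
  unfolding sample_mean_def by (intro borel_measurable_divide borel_measurable_sum x) auto

lemma sample_var_measurable [measurable]: "(\<lambda>\<omega>. sample_var n (x \<omega>)) \<in> borel_measurable N"
  unfolding sample_var_def
  by (intro borel_measurable_divide borel_measurable_sum borel_measurable_power borel_measurable_diff x
      sample_mean_measurable) auto

lemma boot_mean_measurable [measurable]: "(\<lambda>\<omega>. boot_mean n m v (x \<omega>)) \<in> borel_measurable N"
  unfolding boot_mean_def by (intro borel_measurable_divide borel_measurable_sum borel_measurable_times x) auto

lemma boot_var_measurable [measurable]: "(\<lambda>\<omega>. boot_var n m v (x \<omega>)) \<in> borel_measurable N"
  unfolding boot_var_def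
  by (intro borel_measurable_divide borel_measurable_sum borel_measurable_times borel_measurable_power
      borel_measurable_diff x boot_mean_measurable) auto

lemma contrast_measurable [measurable]:
  "(\<lambda>\<omega>. \<Sum>i=1..n. (real (v i) / real m - 1 / real n) * x \<omega> i) \<in> borel_measurable N"
  by (intro borel_measurable_sum borel_measurable_times x) auto

lemma lindeberg_measurable: "Measurable.pred N (\<lambda>\<omega>. lindeberg n m \<delta> (x \<omega>))"
proof -
  have "(\<lambda>\<omega>. (x \<omega> i - sample_mean n (x \<omega>))\<^sup>2 *
        of_bool (\<delta> * real m * sample_var n (x \<omega>) < (x \<omega> i - sample_mean n (x \<omega>))\<^sup>2)) \<in> borel_measurable N"
    if [measurable]: "i \<in> {1..n}" for i
  proof -
    note [measurable] = x[OF that]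
    show ?thesis unfolding of_bool_def by measurable
  qed
  hence [measurable]: "(\<lambda>\<omega>. \<Sum>i=1..n. (x \<omega> i - sample_mean n (x \<omega>))\<^sup>2 *
        of_bool (\<delta> * real m * sample_var n (x \<omega>) < (x \<omega> i - sample_mean n (x \<omega>))\<^sup>2)) \<in> borel_measurable N"
    by (rule borel_measurable_sum)
  show ?thesis unfolding lindeberg_def by measurable
qed

lemma T_measurable:
  "(\<lambda>\<omega>. T1 n m v (x \<omega>)) \<in> borel_measurable N"
  "(\<lambda>\<omega>. T2 n m v (x \<omega>)) \<in> borel_measurable N"
  "(\<lambda>\<omega>. T3 n m v (x \<omega>)) \<in> borel_measurable N"
  unfolding T1_def T2_def T3_def by measurable

end

lemma sample_component_measurable:
  "i \<in> {1..n} \<Longrightarrow> (\<lambda>x. x i) \<in> borel_measurable (PiM {1::nat..} (\<lambda>_. borel))"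
  by (rule measurable_component_singleton) simp

lemma sample_statistic_T1: "sample_statistic T1"
  unfolding sample_statistic_def
proof (intro conjI allI impI)
  show "T1 n m v \<in> borel_measurable (PiM {1..} (\<lambda>_. borel))" for n m v
    by (rule T_measurable(1)[where x = "\<lambda>x. x"]) (rule sample_component_measurable)
qed (auto simp: T1_def intro!: arg_cong2[where f = "(/)"] arg_cong2[where f = "(*)"] sum.cong arg_cong[where f = sqrt] sample_var_cong)

lemma sample_statistic_T2: "sample_statistic T2"
  unfolding sample_statistic_def
proof (intro conjI allI impI)
  show "T2 n m v \<in> borel_measurable (PiM {1..} (\<lambda>_. borel))" for n m v
    by (rule T_measurable(2)[where x = "\<lambda>x. x"]) (rule sample_component_measurable)
qed (auto simp: T2_def intro!: arg_cong2[where f = "(/)"] arg_cong2[where f = "(*)"] sum.cong arg_cong[where f = sqrt] boot_var_cong)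

lemma sample_statistic_T3: "sample_statistic T3"
  unfolding sample_statistic_def
proof (intro conjI allI impI)
  show "T3 n m v \<in> borel_measurable (PiM {1..} (\<lambda>_. borel))" for n m v
    by (rule T_measurable(3)[where x = "\<lambda>x. x"]) (rule sample_component_measurable)
qed (auto simp: T3_def intro!: arg_cong2[where f = "(/)"] arg_cong2[where f = "(*)"] sum.cong arg_cong[where f = sqrt] sample_var_cong)

context efron_bootstrap
begin

definition boot_cdf ::
  "(nat \<Rightarrow> nat \<Rightarrow> (nat \<Rightarrow> nat) \<Rightarrow> (nat \<Rightarrow> real) \<Rightarrow> real) \<Rightarrow> nat \<Rightarrow> nat \<Rightarrow> real \<Rightarrow> 'a \<Rightarrow> real" where
  "boot_cdf T n B t \<omega> = (\<Sum>b=1..B. of_bool (T n (m n) (\<lambda>i. w b n i \<omega>) (\<lambda>i. Xs i \<omega>) \<le> t)) / real B"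

lemma statistic_data_wts:
  assumes "sample_statistic T"
  shows "T n k (\<lambda>i. w b n i \<omega>) (\<lambda>i. Xs i \<omega>) = T n k (wts n b \<omega>) (data \<omega>)"
  by (rule sample_statistic_cong[OF assms]) (simp_all add: wts_def data_def)

lemma statistic_measurable:
  assumes "sample_statistic T" "1 \<le> n" "1 \<le> b"
  shows "(\<lambda>\<omega>. T n k (\<lambda>i. w b n i \<omega>) (\<lambda>i. Xs i \<omega>)) \<in> borel_measurable M"
  unfolding statistic_data_wts[OF assms(1)]
proof (rule measurable_compose_countable'[OF _ wts_measurable[OF assms(2,3)]])
  show "countable (PiE {1..n} (\<lambda>_. UNIV :: nat set))" by (intro countable_PiE) auto
  show "(\<lambda>\<omega>. T n k v (data \<omega>)) \<in> borel_measurable M" for v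
  proof (rule measurable_compose[OF data_measurable])
    show "T n k v \<in> borel_measurable data_space"
      using assms(1) unfolding sample_statistic_def data_space_def by blast
  qed
qed

lemma boot_cdf_measurable:
  assumes "sample_statistic T" "1 \<le> n"
  shows "boot_cdf T n B t \<in> borel_measurable M"
proof -
  have "(\<lambda>\<omega>. of_bool (T n (m n) (\<lambda>i. w b n i \<omega>) (\<lambda>i. Xs i \<omega>) \<le> t) :: real) \<in> borel_measurable M" if "1 \<le> b" for b
  proof -
    note [measurable] = statistic_measurable[OF assms that]
    show ?thesis unfolding of_bool_def by measurable
  qed
  thus ?thesis unfolding boot_cdf_def[abs_def] by (intro borel_measurable_divide borel_measurable_sum) auto
qed

lemma boot_quantile_le_iff:
  assumes "0 < \<alpha>" "\<alpha> \<le> 1" "0 < B"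
  shows "boot_quantile T m Xs w \<alpha> (n, B) \<omega> \<le> a \<longleftrightarrow> \<alpha> \<le> boot_cdf T n B a \<omega>"
  unfolding boot_quantile_def boot_cdf_def prod.case by (rule empirical_quantile_le_iff[OF assms])

text \<open>For \<open>n = 0\<close> or \<open>B = 0\<close> the quantile does not depend on the outcome; otherwise its sublevel sets are
determined by the empirical distribution function.\<close>

lemma boot_quantile_measurable:
  assumes T: "sample_statistic T" and \<alpha>: "0 < \<alpha>" "\<alpha> \<le> 1"
  shows "boot_quantile T m Xs w \<alpha> (n, B) \<in> borel_measurable M"
proof (cases "0 < n \<and> 0 < B")
  case True
  have "{\<omega> \<in> space M. boot_quantile T m Xs w \<alpha> (n, B) \<omega> \<le> a} \<in> sets M" for a
  proof -
    have [measurable]: "boot_cdf T n B a \<in> borel_measurable M"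
      using True by (intro boot_cdf_measurable T) simp
    have "{\<omega> \<in> space M. \<alpha> \<le> boot_cdf T n B a \<omega>} \<in> sets M" by measurable
    thus ?thesis using True by (subst boot_quantile_le_iff[OF \<alpha>]) auto
  qed
  thus ?thesis by (subst borel_measurable_iff_le) blast
next
  case False
  have "\<exists>c. boot_quantile T m Xs w \<alpha> (n, B) = (\<lambda>_. c)"
  proof (cases "B = 0")
    case True
    thus ?thesis unfolding boot_quantile_def empirical_quantile_def by auto
  next
    case False
    hence "n = 0" using \<open>\<not> (0 < n \<and> 0 < B)\<close> by simp
    hence eq: "T n (m n) (\<lambda>i. w b n i \<omega>) (\<lambda>i. Xs i \<omega>) = T n (m n) (\<lambda>_. 0) (\<lambda>_. 0)" for b \<omega>
      by (intro sample_statistic_cong[OF T]) auto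
    show ?thesis unfolding boot_quantile_def prod.case eq by blast
  qed
  thus ?thesis by (metis borel_measurable_const)
qed

lemma expectation_weight_pmf_statistic:
  assumes T: "sample_statistic T"
  shows "measure_pmf.expectation (weight_pmf n k) (\<lambda>v. of_bool (T n k v x \<le> t)) =
    resample_prob n k {l. T n k (count_list l) x \<le> t}"
proof -
  have eq: "T n k (restrict (count_list l) {1..n}) x = T n k (count_list l) x" for l
    by (rule sample_statistic_cong[OF T]) simp_all
  have "measure_pmf.expectation (weight_pmf n k) (\<lambda>v. of_bool (T n k v x \<le> t)) =
     resample_mean n k (indicat_real {l. T n k (count_list l) x \<le> t})"
    unfolding weight_pmf_def integral_map_pmf eq by (intro Bochner_Integration.integral_cong) (auto simp: indicator_def)
  thus ?thesis by simp
qed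

text \<open>All \<open>B\<close> samples share the data, so the deviations of the indicators from \<open>\<phi>\<close> are correlated. The
\<open>B\<close> diagonal terms contribute at most \<open>1 / B\<close>, and each of the others is the mean square of the
conditional deviation, which is at most \<open>\<eta>\<close> on the data sets counted here.\<close>

lemma boot_cdf_second_moment:
  assumes T: "sample_statistic T" and n: "1 \<le> n" and B: "0 < B" and \<phi>: "0 \<le> \<phi>" "\<phi> \<le> 1"
    and close: "\<And>x. lindeberg n (m n) \<delta> x \<Longrightarrow>
      \<bar>resample_prob n (m n) {l. T n (m n) (count_list l) x \<le> t} - \<phi>\<bar> \<le> \<eta>"
  shows "expectation (\<lambda>\<omega>. (of_bool (lindeberg n (m n) \<delta> (\<lambda>i. Xs i \<omega>)) * (boot_cdf T n B t \<omega> - \<phi>))\<^sup>2)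
     \<le> 1 / real B + \<eta>\<^sup>2"
proof -
  define H where "H v x = of_bool (lindeberg n (m n) \<delta> x) * (of_bool (T n (m n) v x \<le> t) - \<phi>)" for v x
  have H_bound: "\<bar>H v x\<bar> \<le> 1" for v x using \<phi> by (auto simp: H_def)
  have [measurable]: "T n (m n) v \<in> borel_measurable data_space" for v
    using T unfolding sample_statistic_def data_space_def by blast
  have [measurable]: "Measurable.pred data_space (lindeberg n (m n) \<delta>)"
    unfolding data_space_def by (rule lindeberg_measurable) (rule sample_component_measurable)
  have H_meas [measurable]: "H v \<in> borel_measurable data_space" for v
    unfolding H_def[abs_def] of_bool_def by measurable
  define h where "h b \<omega> = H (wts n b \<omega>) (data \<omega>)" for b \<omega>
  have h_meas: "h b \<in> borel_measurable M" if "1 \<le> b" for b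
    unfolding h_def[abs_def]
  proof (rule measurable_compose_countable'[OF _ wts_measurable[OF n that]])
    show "countable (PiE {1..n} (\<lambda>_. UNIV :: nat set))" by (intro countable_PiE) auto
  qed measurable
  have hh: "\<bar>h b \<omega> * h c \<omega>\<bar> \<le> 1" for b c \<omega>
    unfolding abs_mult h_def by (intro mult_le_one H_bound) auto
  have int_hh: "integrable M (\<lambda>\<omega>. h b \<omega> * h c \<omega>)" if "1 \<le> b" "1 \<le> c" for b c
    using that by (intro integrable_const_bound[where B = 1] borel_measurable_times h_meas AE_I2) (simp_all add: hh)
  have lind: "lindeberg n (m n) \<delta> (\<lambda>i. Xs i \<omega>) \<longleftrightarrow> lindeberg n (m n) \<delta> (data \<omega>)" for \<omega>
    by (rule lindeberg_cong) (simp add: data_def)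
  have eq: "of_bool (lindeberg n (m n) \<delta> (\<lambda>i. Xs i \<omega>)) * (boot_cdf T n B t \<omega> - \<phi>) = (\<Sum>b=1..B. h b \<omega>) / real B" for \<omega>
  proof -
    have "(\<Sum>b=1..B. h b \<omega>) = of_bool (lindeberg n (m n) \<delta> (data \<omega>)) *
        ((\<Sum>b=1..B. of_bool (T n (m n) (wts n b \<omega>) (data \<omega>) \<le> t)) - real B * \<phi>)"
      unfolding h_def H_def sum_distrib_left[symmetric] by (simp add: sum_subtractf)
    thus ?thesis using B by (simp add: lind boot_cdf_def statistic_data_wts[OF T] field_simps)
  qed
  have pair: "expectation (\<lambda>\<omega>. h b \<omega> * h c \<omega>) \<le> of_bool (b = c) + \<eta>\<^sup>2" if bc: "1 \<le> b" "1 \<le> c" for b c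
  proof (cases "b = c")
    case True
    have "expectation (\<lambda>\<omega>. h b \<omega> * h c \<omega>) \<le> expectation (\<lambda>_. 1)"
      using hh by (intro integral_mono int_hh bc) (auto simp: abs_le_iff)
    thus ?thesis using True by (simp add: prob_space add_increasing2)
  next
    case False
    have bound: "(measure_pmf.expectation (weight_pmf n (m n)) (\<lambda>v. H v x))\<^sup>2 \<le> \<eta>\<^sup>2" for x
    proof (cases "lindeberg n (m n) \<delta> x")
      case True
      have fin: "integrable (measure_pmf (weight_pmf n (m n))) f" for f :: "(nat \<Rightarrow> nat) \<Rightarrow> real"
        using n by (intro integrable_measure_pmf_finite finite_set_weight_pmf) simp
      have "measure_pmf.expectation (weight_pmf n (m n)) (\<lambda>v. H v x) =
          measure_pmf.expectation (weight_pmf n (m n)) (\<lambda>v. of_bool (T n (m n) v x \<le> t)) - \<phi>"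
        using True fin by (simp add: H_def)
      hence "\<bar>measure_pmf.expectation (weight_pmf n (m n)) (\<lambda>v. H v x)\<bar> \<le> \<eta>"
        using close[OF True] by (simp add: expectation_weight_pmf_statistic[OF T])
      hence "\<bar>measure_pmf.expectation (weight_pmf n (m n)) (\<lambda>v. H v x)\<bar>\<^sup>2 \<le> \<eta>\<^sup>2"
        by (intro power_mono) auto
      thus ?thesis by simp
    qed (simp add: H_def)
    have "expectation (\<lambda>\<omega>. h b \<omega> * h c \<omega>) =
        expectation (\<lambda>\<omega>. (measure_pmf.expectation (weight_pmf n (m n)) (\<lambda>v. H v (data \<omega>)))\<^sup>2)"
      unfolding h_def by (rule expectation_two_resamples[OF n bc False H_meas H_bound])
    also have "\<dots> \<le> expectation (\<lambda>_. \<eta>\<^sup>2)" using bound by (intro integral_mono') auto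
    also have "\<dots> = \<eta>\<^sup>2" by (simp add: prob_space)
    finally show ?thesis using False by simp
  qed
  have "expectation (\<lambda>\<omega>. ((\<Sum>b=1..B. h b \<omega>) / real B)\<^sup>2) =
      expectation (\<lambda>\<omega>. (\<Sum>b=1..B. \<Sum>c=1..B. h b \<omega> * h c \<omega>) / (real B)\<^sup>2)"
    by (simp add: power_divide sum_product power2_eq_square)
  also have "\<dots> = (\<Sum>b=1..B. \<Sum>c=1..B. expectation (\<lambda>\<omega>. h b \<omega> * h c \<omega>)) / (real B)\<^sup>2"
  proof -
    have "expectation (\<lambda>\<omega>. \<Sum>b=1..B. \<Sum>c=1..B. h b \<omega> * h c \<omega>) =
        (\<Sum>b=1..B. expectation (\<lambda>\<omega>. \<Sum>c=1..B. h b \<omega> * h c \<omega>))"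
      by (intro Bochner_Integration.integral_sum Bochner_Integration.integrable_sum int_hh) auto
    also have "\<dots> = (\<Sum>b=1..B. \<Sum>c=1..B. expectation (\<lambda>\<omega>. h b \<omega> * h c \<omega>))"
      by (intro sum.cong refl Bochner_Integration.integral_sum int_hh) auto
    finally show ?thesis by simp
  qed
  also have "\<dots> \<le> (\<Sum>b=1..B. \<Sum>c=1..B. of_bool (b = c) + \<eta>\<^sup>2) / (real B)\<^sup>2"
    by (intro divide_right_mono sum_mono pair) auto
  also have "(\<Sum>b=1..B. \<Sum>c=1..B. of_bool (b = c) + \<eta>\<^sup>2) = real B + real B * (real B * \<eta>\<^sup>2)"
    by (simp add: sum.distrib of_bool_def distrib_left)
  also have "\<dots> / (real B)\<^sup>2 = 1 / real B + \<eta>\<^sup>2"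
    using B by (simp add: power2_eq_square field_simps)
  finally show ?thesis unfolding eq .
qed

text \<open>Where the data satisfy the Lindeberg condition this is Markov's inequality for the second moment; the
accuracy \<open>\<eta>\<close> of the conditional approximation is chosen small compared with \<open>\<epsilon>\<close>. The event where
they do not has vanishing probability.\<close>

lemma boot_cdf_converges:
  assumes T: "sample_statistic T" "bootstrap_clt T" and m: "filterlim m at_top sequentially"
    and lind: "\<And>\<delta>. 0 < \<delta> \<Longrightarrow> (\<lambda>n. prob {\<omega> \<in> space M. \<not> lindeberg n (m n) \<delta> (\<lambda>i. Xs i \<omega>)}) \<longlonglongrightarrow> 0"
    and \<epsilon>: "0 < \<epsilon>"
  shows "((\<lambda>(n, B). prob {\<omega> \<in> space M. \<epsilon> \<le> \<bar>boot_cdf T n B t \<omega> - \<Phi> t\<bar>}) \<longlongrightarrow> 0)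
     (sequentially \<times>\<^sub>F sequentially)"
proof (rule tendstoI)
  fix \<rho> :: real assume \<rho>: "0 < \<rho>"
  interpret N: real_distribution std_normal_distribution by (rule real_dist_normal_dist)
  define \<phi> where "\<phi> = \<Phi> t"
  have \<phi>: "0 \<le> \<phi>" "\<phi> \<le> 1" unfolding \<phi>_def by (rule N.cdf_nonneg, rule N.cdf_bounded_prob)
  define \<eta> where "\<eta> = \<epsilon> * sqrt (\<rho> / 3)"
  have \<eta>: "0 < \<eta>" "\<eta>\<^sup>2 = \<epsilon>\<^sup>2 * (\<rho> / 3)" using \<epsilon> \<rho> by (auto simp: \<eta>_def power_mult_distrib)
  obtain \<delta> N where \<delta>: "0 < \<delta>" and close: "\<And>n k x. n \<ge> N \<Longrightarrow> k \<ge> N \<Longrightarrow> lindeberg n k \<delta> x \<Longrightarrow>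
      \<bar>resample_prob n k {l. T n k (count_list l) x \<le> t} - \<phi>\<bar> \<le> \<eta>"
    using T(2) \<eta>(1) unfolding bootstrap_clt_def \<phi>_def by meson
  have "\<forall>\<^sub>F n in sequentially. prob {\<omega> \<in> space M. \<not> lindeberg n (m n) \<delta> (\<lambda>i. Xs i \<omega>)} < \<rho> / 3"
    using order_tendstoD(2)[OF lind[OF \<delta>], of "\<rho> / 3"] \<rho> by simp
  moreover have "\<forall>\<^sub>F n in sequentially. m n \<ge> N"
    using m unfolding filterlim_at_top by blast
  moreover have "\<forall>\<^sub>F n in sequentially. n \<ge> max 1 N" by (rule eventually_ge_at_top)
  ultimately have ev_n: "\<forall>\<^sub>F n in sequentially. prob {\<omega> \<in> space M. \<not> lindeberg n (m n) \<delta> (\<lambda>i. Xs i \<omega>)} < \<rho> / 3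
      \<and> m n \<ge> N \<and> n \<ge> N \<and> n \<ge> 1"
    by eventually_elim auto
  have ev_B: "\<forall>\<^sub>F B in sequentially. 0 < B \<and> 1 / real B < \<epsilon>\<^sup>2 * (\<rho> / 3)"
  proof (intro eventually_conj)
    show "\<forall>\<^sub>F B in sequentially. (0::nat) < B" by (rule eventually_gt_at_top)
    show "\<forall>\<^sub>F B in sequentially. 1 / real B < \<epsilon>\<^sup>2 * (\<rho> / 3)"
      using \<epsilon> \<rho> by (intro order_tendstoD(2)[OF lim_1_over_n]) auto
  qed
  have main: "prob {\<omega> \<in> space M. \<epsilon> \<le> \<bar>boot_cdf T n B t \<omega> - \<phi>\<bar>} < \<rho>"
    if n: "prob {\<omega> \<in> space M. \<not> lindeberg n (m n) \<delta> (\<lambda>i. Xs i \<omega>)} < \<rho> / 3 \<and> m n \<ge> N \<and> n \<ge> N \<and> n \<ge> 1"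
      and B: "0 < B \<and> 1 / real B < \<epsilon>\<^sup>2 * (\<rho> / 3)" for n B
  proof -
    define G where "G \<omega> \<longleftrightarrow> lindeberg n (m n) \<delta> (\<lambda>i. Xs i \<omega>)" for \<omega>
    have n1: "1 \<le> n" using n by simp
    have G_meas [measurable]: "Measurable.pred M G"
      unfolding G_def by (rule lindeberg_measurable) (simp add: Xs_meas)
    note [measurable] = boot_cdf_measurable[OF T(1) n1]
    define f where "f \<omega> = (of_bool (G \<omega>) * (boot_cdf T n B t \<omega> - \<phi>))\<^sup>2" for \<omega>
    have f_meas [measurable]: "f \<in> borel_measurable M" unfolding f_def[abs_def] of_bool_def by measurable
    have cdf01: "0 \<le> boot_cdf T n B t \<omega>" "boot_cdf T n B t \<omega> \<le> 1" for \<omega>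
    proof -
      show "0 \<le> boot_cdf T n B t \<omega>" unfolding boot_cdf_def by (intro divide_nonneg_nonneg sum_nonneg) auto
      have "boot_cdf T n B t \<omega> \<le> (\<Sum>b=1..B. 1) / real B"
        unfolding boot_cdf_def by (intro divide_right_mono sum_mono) auto
      thus "boot_cdf T n B t \<omega> \<le> 1" using B by simp
    qed
    have f_bound: "\<bar>f \<omega>\<bar> \<le> 1" for \<omega>
    proof -
      have "\<bar>of_bool (G \<omega>) * (boot_cdf T n B t \<omega> - \<phi>)\<bar> \<le> 1" using cdf01[of \<omega>] \<phi> by auto
      thus ?thesis unfolding f_def by (simp add: abs_square_le_1)
    qed
    have int_f: "integrable M f" by (rule integrable_const_bound[where B = 1]) (use f_bound in auto)
    have "prob {\<omega> \<in> space M. \<epsilon> \<le> \<bar>boot_cdf T n B t \<omega> - \<phi>\<bar>} \<le>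
        prob ({\<omega> \<in> space M. \<not> G \<omega>} \<union> {\<omega> \<in> space M. \<epsilon>\<^sup>2 \<le> f \<omega>})"
    proof (intro finite_measure_mono subsetI)
      fix \<omega> assume \<omega>: "\<omega> \<in> {\<omega> \<in> space M. \<epsilon> \<le> \<bar>boot_cdf T n B t \<omega> - \<phi>\<bar>}"
      hence "\<epsilon>\<^sup>2 \<le> \<bar>boot_cdf T n B t \<omega> - \<phi>\<bar>\<^sup>2" using \<epsilon> by (intro power_mono) auto
      thus "\<omega> \<in> {\<omega> \<in> space M. \<not> G \<omega>} \<union> {\<omega> \<in> space M. \<epsilon>\<^sup>2 \<le> f \<omega>}" using \<omega> by (auto simp: f_def)
    qed measurable
    also have "\<dots> \<le> prob {\<omega> \<in> space M. \<not> G \<omega>} + prob {\<omega> \<in> space M. \<epsilon>\<^sup>2 \<le> f \<omega>}"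
      by (rule measure_Un_le) measurable
    also have "prob {\<omega> \<in> space M. \<epsilon>\<^sup>2 \<le> f \<omega>} \<le> expectation f / \<epsilon>\<^sup>2"
      using \<epsilon> by (intro integral_Markov_inequality_measure[OF int_f]) (auto simp: f_def)
    also have "expectation f / \<epsilon>\<^sup>2 \<le> (1 / real B + \<eta>\<^sup>2) / \<epsilon>\<^sup>2"
      unfolding f_def[abs_def] G_def using n B close
      by (intro divide_right_mono boot_cdf_second_moment[OF T(1) _ _ \<phi>]) auto
    also have "\<dots> < (\<epsilon>\<^sup>2 * (\<rho> / 3) + \<epsilon>\<^sup>2 * (\<rho> / 3)) / \<epsilon>\<^sup>2"
      using B \<epsilon> unfolding \<eta>(2) by (intro divide_strict_right_mono add_strict_right_mono) auto
    also have "\<dots> = \<rho> / 3 + \<rho> / 3" using \<epsilon> by (simp add: add_divide_distrib)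
    finally show ?thesis using n unfolding G_def by linarith
  qed
  have "\<forall>\<^sub>F p in sequentially \<times>\<^sub>F sequentially.
      prob {\<omega> \<in> space M. \<epsilon> \<le> \<bar>boot_cdf T (fst p) (snd p) t \<omega> - \<phi>\<bar>} < \<rho>"
    by (rule eventually_mono[OF eventually_prodI[OF ev_n ev_B]]) (rule main; blast)
  thus "\<forall>\<^sub>F p in sequentially \<times>\<^sub>F sequentially. dist (case p of (n, B) \<Rightarrow>
      prob {\<omega> \<in> space M. \<epsilon> \<le> \<bar>boot_cdf T n B t \<omega> - \<Phi> t\<bar>}) 0 < \<rho>"
    by eventually_elim (simp add: case_prod_beta \<phi>_def)
qed

text \<open>By convergence of the empirical distribution function at each point, the quantile exceeds every point
below \<open>z\<close> and does not exceed any point above \<open>z\<close>, with probability tending to 1.\<close>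

lemma boot_quantile_converges:
  assumes T: "sample_statistic T" "bootstrap_clt T" and m: "filterlim m at_top sequentially"
    and lind: "\<And>\<delta>. 0 < \<delta> \<Longrightarrow> (\<lambda>n. prob {\<omega> \<in> space M. \<not> lindeberg n (m n) \<delta> (\<lambda>i. Xs i \<omega>)}) \<longlonglongrightarrow> 0"
    and \<alpha>: "0 < \<alpha>" "\<alpha> \<le> 1" and z: "measure std_normal_distribution {x. ereal x \<le> z} = \<alpha>"
  shows "tendsto_in_prob M (boot_quantile T m Xs w \<alpha>) z (sequentially \<times>\<^sub>F sequentially)"
proof -
  let ?q = "boot_quantile T m Xs w \<alpha>" and ?F = "sequentially \<times>\<^sub>F sequentially :: (nat \<times> nat) filter"
  have meas [measurable]: "?q p \<in> borel_measurable M" for p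
    using boot_quantile_measurable[OF T(1) \<alpha>, of "fst p" "snd p"] by simp
  have pos: "\<forall>\<^sub>F p in ?F. 0 < fst p \<and> 0 < snd p"
    unfolding eventually_prod_filter by (intro exI[of _ "\<lambda>n. 0 < n"]) (auto intro: eventually_gt_at_top)
  have decide: "((\<lambda>p. prob {\<omega> \<in> space M. (?q p \<omega> \<le> a) \<noteq> (\<alpha> \<le> \<Phi> a)}) \<longlongrightarrow> 0) ?F" if "\<Phi> a \<noteq> \<alpha>" for a
  proof -
    let ?d = "\<bar>\<alpha> - \<Phi> a\<bar>"
    have lim: "((\<lambda>p. prob {\<omega> \<in> space M. ?d \<le> \<bar>boot_cdf T (fst p) (snd p) a \<omega> - \<Phi> a\<bar>}) \<longlongrightarrow> 0) ?F"
      using boot_cdf_converges[OF T m lind, of ?d a] that by (simp add: split_beta')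
    have le: "\<forall>\<^sub>F p in ?F. prob {\<omega> \<in> space M. (?q p \<omega> \<le> a) \<noteq> (\<alpha> \<le> \<Phi> a)} \<le>
        prob {\<omega> \<in> space M. ?d \<le> \<bar>boot_cdf T (fst p) (snd p) a \<omega> - \<Phi> a\<bar>}"
      using pos
    proof eventually_elim
      fix p :: "nat \<times> nat" assume p: "0 < fst p \<and> 0 < snd p"
      have [measurable]: "boot_cdf T (fst p) (snd p) a \<in> borel_measurable M"
        using p by (intro boot_cdf_measurable T(1)) simp
      have iff: "?q p \<omega> \<le> a \<longleftrightarrow> \<alpha> \<le> boot_cdf T (fst p) (snd p) a \<omega>" for \<omega>
        using boot_quantile_le_iff[OF \<alpha>, of "snd p" T "fst p"] p by simp
      show "prob {\<omega> \<in> space M. (?q p \<omega> \<le> a) \<noteq> (\<alpha> \<le> \<Phi> a)} \<le>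
          prob {\<omega> \<in> space M. ?d \<le> \<bar>boot_cdf T (fst p) (snd p) a \<omega> - \<Phi> a\<bar>}"
      proof (intro finite_measure_mono subsetI)
        fix \<omega> assume \<omega>: "\<omega> \<in> {\<omega> \<in> space M. (?q p \<omega> \<le> a) \<noteq> (\<alpha> \<le> \<Phi> a)}"
        hence "(\<alpha> \<le> boot_cdf T (fst p) (snd p) a \<omega>) \<noteq> (\<alpha> \<le> \<Phi> a)" using iff by blast
        hence "?d \<le> \<bar>boot_cdf T (fst p) (snd p) a \<omega> - \<Phi> a\<bar>" by linarith
        thus "\<omega> \<in> {\<omega> \<in> space M. ?d \<le> \<bar>boot_cdf T (fst p) (snd p) a \<omega> - \<Phi> a\<bar>}" using \<omega> by blast
      qed measurable
    qed
    show ?thesis by (rule tendsto_sandwich[OF _ le tendsto_const lim]) simp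
  qed
  have below: "((\<lambda>p. prob {\<omega> \<in> space M. ?q p \<omega> \<le> a}) \<longlongrightarrow> 0) ?F" if "ereal a < z" for a
  proof -
    have "\<not> \<alpha> \<le> \<Phi> a" using cdf_at_normal_quantile(1)[OF z \<alpha>(1) that] by simp
    with decide[of a] show ?thesis by fastforce
  qed
  have above: "((\<lambda>p. prob {\<omega> \<in> space M. a < ?q p \<omega>}) \<longlongrightarrow> 0) ?F" if "z < ereal a" for a
    using decide[of a] cdf_at_normal_quantile(2)[OF z \<alpha>(1) that] by (simp add: not_le)
  show ?thesis
  proof (cases z)
    case (real r)
    have "((\<lambda>p. prob {\<omega> \<in> space M. \<epsilon> < \<bar>?q p \<omega> - r\<bar>}) \<longlongrightarrow> 0) ?F" if "0 < \<epsilon>" for \<epsilon>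
    proof -
      have lim: "((\<lambda>p. prob {\<omega> \<in> space M. ?q p \<omega> \<le> r - \<epsilon>} + prob {\<omega> \<in> space M. r + \<epsilon> < ?q p \<omega>}) \<longlongrightarrow> 0 + 0) ?F"
        using that real by (intro tendsto_add below above) auto
      have "prob {\<omega> \<in> space M. \<epsilon> < \<bar>?q p \<omega> - r\<bar>} \<le> prob ({\<omega> \<in> space M. ?q p \<omega> \<le> r - \<epsilon>} \<union> {\<omega> \<in> space M. r + \<epsilon> < ?q p \<omega>})" for p
        by (intro finite_measure_mono) (auto simp: abs_if split: if_splits)
      also have "prob ({\<omega> \<in> space M. ?q p \<omega> \<le> r - \<epsilon>} \<union> {\<omega> \<in> space M. r + \<epsilon> < ?q p \<omega>}) \<le>
          prob {\<omega> \<in> space M. ?q p \<omega> \<le> r - \<epsilon>} + prob {\<omega> \<in> space M. r + \<epsilon> < ?q p \<omega>}" for p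
        by (rule measure_Un_le) measurable
      finally have le: "prob {\<omega> \<in> space M. \<epsilon> < \<bar>?q p \<omega> - r\<bar>} \<le>
          prob {\<omega> \<in> space M. ?q p \<omega> \<le> r - \<epsilon>} + prob {\<omega> \<in> space M. r + \<epsilon> < ?q p \<omega>}" for p .
      show ?thesis
        by (rule tendsto_sandwich[OF _ always_eventually tendsto_const lim[simplified]]) (use le in auto)
    qed
    thus ?thesis unfolding real using meas by (subst tendsto_in_prob_real_iff) (auto intro: prob_space_axioms)
  next
    case PInf
    thus ?thesis using meas below by (simp add: tendsto_in_prob_PInf_iff[OF prob_space_axioms])
  next
    case MInf
    thus ?thesis using z \<alpha> by simp
  qed
qed

end

section \<open>The Lindeberg condition for random samples\<close>

lemma one_minus_cos_double: "(1 - cos u)\<^sup>2 = 2 * (1 - cos u) - (1 - cos (2 * u)) / 2" for u :: real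
  unfolding cos_double_cos by (simp add: power2_eq_square field_simps)

lemma one_minus_cos_le: "1 - cos u \<le> u\<^sup>2 / 2" for u :: real
proof -
  have "1 - cos u = 2 * (sin (u / 2))\<^sup>2" using cos_double_sin[of "u / 2"] by simp
  also have "(sin (u / 2))\<^sup>2 \<le> (u / 2)\<^sup>2"
    using abs_sin_x_le_abs_x[of "u / 2"] by (simp only: abs_le_square_iff)
  finally show ?thesis by (simp add: power_divide)
qed

lemma abs_one_minus_cos_le: "\<bar>1 - cos u\<bar> \<le> 2" for u :: real
  using cos_ge_minus_one[of u] cos_le_one[of u] by linarith

text \<open>This is \<open>- n * ln (r n) \<longlonglongrightarrow> c\<close> together with \<open>r * (- ln r) \<le> 1 - r \<le> - ln r\<close> and \<open>r n \<longlonglongrightarrow> 1\<close>.\<close>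

lemma power_tendsto_exp_imp:
  fixes r :: "nat \<Rightarrow> real"
  assumes r: "\<And>n. 0 \<le> r n" "\<And>n. r n \<le> 1" and lim: "(\<lambda>n. r n ^ n) \<longlonglongrightarrow> exp (- c)"
  shows "(\<lambda>n. real n * (1 - r n)) \<longlonglongrightarrow> c"
proof -
  define u where "u n = - (real n * ln (r n))" for n
  have "\<forall>\<^sub>F n in sequentially. r n ^ n > 0" using order_tendstoD(1)[OF lim, of 0] by simp
  hence pos: "\<forall>\<^sub>F n in sequentially. 0 < r n \<and> 0 < n"
    using eventually_gt_at_top[of 0]
  proof eventually_elim
    case (elim n)
    thus ?case using r(1)[of n] by (cases "r n = 0") (auto simp: power_0_left)
  qed
  have "(\<lambda>n. ln (r n ^ n)) \<longlonglongrightarrow> ln (exp (- c))" by (intro tendsto_ln lim) simp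
  hence "(\<lambda>n. - ln (r n ^ n)) \<longlonglongrightarrow> c" using tendsto_minus by fastforce
  moreover have "\<forall>\<^sub>F n in sequentially. - ln (r n ^ n) = u n"
    using pos by eventually_elim (simp add: u_def ln_realpow)
  ultimately have u: "u \<longlonglongrightarrow> c" by (rule Lim_transform_eventually)
  have "(\<lambda>n. exp (- (u n / real n))) \<longlonglongrightarrow> exp (- 0)"
    by (intro tendsto_exp tendsto_minus real_tendsto_divide_at_top[OF u] filterlim_real_sequentially)
  moreover have "\<forall>\<^sub>F n in sequentially. exp (- (u n / real n)) = r n"
    using pos by eventually_elim (simp add: u_def)
  ultimately have "r \<longlonglongrightarrow> 1" using Lim_transform_eventually by fastforce
  from tendsto_mult[OF this u] have low: "(\<lambda>n. r n * u n) \<longlonglongrightarrow> c" by simp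
  have lower: "\<forall>\<^sub>F n in sequentially. r n * u n \<le> real n * (1 - r n)"
    using pos
  proof eventually_elim
    case (elim n)
    have "ln (1 / r n) \<le> 1 / r n - 1" using elim by (intro ln_le_minus_one) auto
    hence "- ln (r n) \<le> (1 - r n) / r n" using elim by (simp add: ln_div field_simps)
    hence "- ln (r n) * r n \<le> 1 - r n" using elim by (simp add: pos_le_divide_eq)
    hence "real n * (- ln (r n) * r n) \<le> real n * (1 - r n)" by (intro mult_left_mono) auto
    thus ?case by (simp add: u_def mult_ac)
  qed
  have upper: "\<forall>\<^sub>F n in sequentially. real n * (1 - r n) \<le> u n"
    using pos
  proof eventually_elim
    case (elim n)
    have "1 - r n \<le> - ln (r n)" using ln_le_minus_one[of "r n"] elim by simp
    hence "real n * (1 - r n) \<le> real n * (- ln (r n))" by (intro mult_left_mono) auto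
    thus ?case by (simp add: u_def)
  qed
  show ?thesis by (rule tendsto_sandwich[OF lower upper low u])
qed

lemma std_normal_cos: "integral\<^sup>L std_normal_distribution (\<lambda>t. cos (t * u)) = exp (- (u\<^sup>2) / 2)"
proof -
  interpret N: real_distribution std_normal_distribution by (rule real_dist_normal_dist)
  have "integral\<^sup>L std_normal_distribution (\<lambda>t. cos (t * u)) =
      integral\<^sup>L std_normal_distribution (\<lambda>t. Re (iexp (u * t)))"
    unfolding cis_conv_exp[symmetric] by (simp add: mult.commute)
  also have "\<dots> = Re (char std_normal_distribution u)"
    unfolding char_def by (intro integral_Re N.integrable_iexp) auto
  finally show ?thesis by (simp add: char_std_normal_distribution)
qed

text \<open>With \<open>s = exp (- u\<^sup>2 / 2)\<close> the integral equals \<open>(3 - 4 * s + s ^ 4) / 2\<close>, and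
\<open>3 - 4 * s + s ^ 4 = (s\<^sup>2 + 2 * s + 3) * (1 - s)\<^sup>2\<close>.\<close>

lemma std_normal_one_minus_cos_sq:
  "integral\<^sup>L std_normal_distribution (\<lambda>t. (1 - cos (t * u))\<^sup>2) \<ge> 3 / 2 * (1 - exp (- (u\<^sup>2) / 2))\<^sup>2"
proof -
  interpret N: real_distribution std_normal_distribution by (rule real_dist_normal_dist)
  define s where "s = exp (- (u\<^sup>2) / 2)"
  have s4: "exp (- ((2 * u)\<^sup>2) / 2) = s ^ 4"
    by (simp add: s_def power_mult_distrib flip: exp_of_nat_mult)
  have int: "integrable std_normal_distribution (\<lambda>t. cos (t * v))" for v
    by (rule N.integrable_const_bound[where B = 1]) auto
  have "integral\<^sup>L std_normal_distribution (\<lambda>t. (1 - cos (t * u))\<^sup>2) =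
      integral\<^sup>L std_normal_distribution (\<lambda>t. 3 / 2 - 2 * cos (t * u) + cos (t * (2 * u)) / 2)"
  proof (intro Bochner_Integration.integral_cong refl)
    fix t show "(1 - cos (t * u))\<^sup>2 = 3 / 2 - 2 * cos (t * u) + cos (t * (2 * u)) / 2"
      using one_minus_cos_double[of "t * u"] by (simp add: mult_ac field_simps)
  qed
  also have "\<dots> = 3 / 2 - 2 * integral\<^sup>L std_normal_distribution (\<lambda>t. cos (t * u)) +
      integral\<^sup>L std_normal_distribution (\<lambda>t. cos (t * (2 * u))) / 2"
    using int N.prob_space by simp
  also have "\<dots> = 3 / 2 - 2 * s + s ^ 4 / 2"
    by (simp only: std_normal_cos s4 s_def)
  also have "\<dots> = 3 / 2 * (1 - s)\<^sup>2 + (s\<^sup>2 + 2 * s) * (1 - s)\<^sup>2 / 2"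
    by (simp add: power2_eq_square power4_eq_xxxx field_simps)
  also have "\<dots> \<ge> 3 / 2 * (1 - s)\<^sup>2"
    by (simp add: s_def)
  finally show ?thesis by (simp add: s_def)
qed

text \<open>For a single frequency \<open>t\<close> the hypothesis does not see the values of \<open>x / b n\<close> near the zeros of
\<open>1 - cos (t * x / b n)\<close>. Averaging over a normally distributed frequency removes them, because the average
of the integrand is bounded below for \<open>\<bar>x\<bar> \<ge> \<epsilon> * b n\<close>. The hypothesis is only pointwise in \<open>t\<close>; the
weight \<open>r = 1 / (1 + h)\<close> makes the functions to be averaged bounded without changing them much on
average, so that dominated convergence applies.\<close>

lemma tail_from_cosine_moments:
  fixes \<nu> :: "real measure" and b :: "nat \<Rightarrow> real"
  assumes \<nu>: "real_distribution \<nu>" and b: "\<And>n. 0 < b n"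
    and lim: "\<And>t. (\<lambda>n. real n * (LINT x|\<nu>. (1 - cos (t * (x / b n)))\<^sup>2)) \<longlonglongrightarrow> 0"
    and \<epsilon>: "0 < \<epsilon>"
  shows "(\<lambda>n. real n * measure \<nu> {x. \<epsilon> * b n \<le> \<bar>x\<bar>}) \<longlonglongrightarrow> 0"
proof -
  interpret N: real_distribution std_normal_distribution by (rule real_dist_normal_dist)
  interpret V: real_distribution \<nu> by fact
  interpret P: pair_prob_space std_normal_distribution \<nu> ..
  define f where "f n t x = (1 - cos (t * (x / b n)))\<^sup>2" for n and t x :: real
  have f: "0 \<le> f n t x" "f n t x \<le> 4" for n t x
  proof -
    show "0 \<le> f n t x" by (simp add: f_def)
    have "(1 - cos (t * (x / b n)))\<^sup>2 \<le> 2\<^sup>2"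
      by (intro power_mono) (auto simp: cos_ge_minus_one intro: order_trans[OF diff_left_mono[OF cos_ge_minus_one]])
    thus "f n t x \<le> 4" by (simp add: f_def)
  qed
  have f_meas [measurable]: "(\<lambda>(t, x). f n t x) \<in> borel_measurable (borel \<Otimes>\<^sub>M borel)" for n
    unfolding f_def by measurable
  define h where "h n t = real n * (LINT x|\<nu>. f n t x)" for n t
  have h_nonneg: "0 \<le> h n t" for n t
    unfolding h_def by (intro mult_nonneg_nonneg integral_nonneg_AE) (auto simp: f)
  have h_meas [measurable]: "h n \<in> borel_measurable borel" for n
    unfolding h_def[abs_def] by measurable
  define r where "r n t = 1 / (1 + h n t)" for n t
  have r: "0 \<le> r n t" "r n t \<le> 1" for n t
    using h_nonneg[of n t] by (auto simp: r_def field_simps)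
  have r_h: "1 - r n t = r n t * h n t" for n t
    using h_nonneg[of n t] by (auto simp: r_def field_simps)
  have r_meas [measurable]: "r n \<in> borel_measurable borel" for n
    unfolding r_def[abs_def] by measurable
  have int_r: "integrable std_normal_distribution (r n)" for n
    by (rule N.integrable_const_bound[where B = 1]) (use r in auto)
  define D where "D n = (LINT t|std_normal_distribution. 1 - r n t)" for n
  have D_nonneg: "0 \<le> D n" for n unfolding D_def by (rule integral_nonneg_AE) (simp add: r(2))
  have "D \<longlonglongrightarrow> (LINT t|std_normal_distribution. 0)"
    unfolding D_def[abs_def]
  proof (rule integral_dominated_convergence[where w = "\<lambda>_. 1"])
    show "AE t in std_normal_distribution. (\<lambda>n. 1 - r n t) \<longlonglongrightarrow> 0"
    proof (rule AE_I2)
      fix t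
      have "(\<lambda>n. h n t) \<longlonglongrightarrow> 0" using lim[of t] by (simp add: h_def f_def)
      hence "(\<lambda>n. 1 - 1 / (1 + h n t)) \<longlonglongrightarrow> 1 - 1 / (1 + 0)" by (intro tendsto_intros) auto
      thus "(\<lambda>n. 1 - r n t) \<longlonglongrightarrow> 0" by (simp add: r_def)
    qed
    show "AE t in std_normal_distribution. norm (1 - r n t) \<le> 1" for n
    proof (rule AE_I2)
      fix t show "norm (1 - r n t) \<le> 1" using r(1,2)[of n t] by simp
    qed
  qed auto
  hence D: "D \<longlonglongrightarrow> 0" by simp
  define \<kappa> where "\<kappa> = 3 / 2 * (1 - exp (- (\<epsilon>\<^sup>2) / 2))\<^sup>2"
  have \<kappa>: "0 < \<kappa>" using \<epsilon> by (simp add: \<kappa>_def)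
  \<comment> \<open>integrate \<open>D n = n * (LINT t. LINT x. r * f)\<close> in the other order and discard small \<open>\<bar>x\<bar>\<close>\<close>
  have key: "real n * measure \<nu> {x. \<epsilon> * b n \<le> \<bar>x\<bar>} * (\<kappa> - 4 * D n) \<le> D n" if pos: "0 \<le> \<kappa> - 4 * D n" for n
  proof -
    have int_rf: "integrable (std_normal_distribution \<Otimes>\<^sub>M \<nu>) (\<lambda>(t, x). r n t * f n t x)"
    proof (rule P.integrable_const_bound[where B = 4])
      show "AE p in std_normal_distribution \<Otimes>\<^sub>M \<nu>. norm (case p of (t, x) \<Rightarrow> r n t * f n t x) \<le> 4"
        using r f mult_mono[of "r n _" 1 "f n _ _" 4] by (intro AE_I2) (auto simp: abs_mult split: prod.splits)
    qed measurable
    have int_f: "integrable std_normal_distribution (\<lambda>t. f n t x)" for x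
      by (rule N.integrable_const_bound[where B = 4]) (use f in auto)
    have int_rfx: "integrable std_normal_distribution (\<lambda>t. r n t * f n t x)" for x
      by (rule N.integrable_const_bound[where B = 4])
         (use r f mult_mono[of "r n _" 1 "f n _ _" 4] in \<open>auto simp: abs_mult\<close>)
    have inner: "(\<kappa> - 4 * D n) * indicator {x. \<epsilon> * b n \<le> \<bar>x\<bar>} x \<le> (LINT t|std_normal_distribution. r n t * f n t x)" for x
    proof (cases "\<epsilon> * b n \<le> \<bar>x\<bar>")
      case True
      have "\<epsilon> \<le> \<bar>x / b n\<bar>" using True b[of n] by (simp add: abs_divide pos_le_divide_eq)
      hence "\<epsilon>\<^sup>2 \<le> \<bar>x / b n\<bar>\<^sup>2" using \<epsilon> by (intro power_mono) auto
      hence "\<epsilon>\<^sup>2 \<le> (x / b n)\<^sup>2" by (simp only: power2_abs)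
      hence "1 - exp (- (\<epsilon>\<^sup>2) / 2) \<le> 1 - exp (- ((x / b n)\<^sup>2) / 2)" by simp
      hence "(1 - exp (- (\<epsilon>\<^sup>2) / 2))\<^sup>2 \<le> (1 - exp (- ((x / b n)\<^sup>2) / 2))\<^sup>2"
        by (intro power_mono) auto
      hence "\<kappa> \<le> 3 / 2 * (1 - exp (- ((x / b n)\<^sup>2) / 2))\<^sup>2"
        unfolding \<kappa>_def by (intro mult_left_mono) auto
      also have "\<dots> \<le> (LINT t|std_normal_distribution. f n t x)"
        unfolding f_def by (rule std_normal_one_minus_cos_sq)
      finally have "\<kappa> \<le> (LINT t|std_normal_distribution. f n t x)" .
      moreover have "(LINT t|std_normal_distribution. f n t x) - (LINT t|std_normal_distribution. r n t * f n t x)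
          = (LINT t|std_normal_distribution. (1 - r n t) * f n t x)"
        using int_f int_rfx by (simp add: left_diff_distrib)
      moreover have "\<dots> \<le> (LINT t|std_normal_distribution. (1 - r n t) * 4)"
        using int_r int_f int_rfx r f
        by (intro integral_mono mult_left_mono) (auto simp: left_diff_distrib)
      moreover have "\<dots> = 4 * D n" unfolding D_def by (subst integral_mult_left_zero) (rule mult.commute)
      ultimately show ?thesis using True by simp
    next
      case False
      thus ?thesis using r f by (simp add: integral_nonneg_AE)
    qed
    have "D n = (LINT t|std_normal_distribution. LINT x|\<nu>. real n * (r n t * f n t x))"
      unfolding D_def r_h h_def by (intro Bochner_Integration.integral_cong refl) (simp add: mult_ac)
    also have "\<dots> = real n * (LINT t|std_normal_distribution. LINT x|\<nu>. r n t * f n t x)" by simp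
    also have "(LINT t|std_normal_distribution. LINT x|\<nu>. r n t * f n t x) =
        (LINT x|\<nu>. LINT t|std_normal_distribution. r n t * f n t x)"
      by (rule P.Fubini_integral[symmetric, OF int_rf])
    also have "real n * \<dots> \<ge> real n * (LINT x|\<nu>. (\<kappa> - 4 * D n) * indicator {x. \<epsilon> * b n \<le> \<bar>x\<bar>} x)"
    proof (intro mult_left_mono integral_mono inner)
      show "integrable \<nu> (\<lambda>x. LINT t|std_normal_distribution. r n t * f n t x)"
        using P.integrable_snd[OF int_rf] by simp
      show "integrable \<nu> (\<lambda>x. (\<kappa> - 4 * D n) * indicator {x. \<epsilon> * b n \<le> \<bar>x\<bar>} x)"
        by (intro integrable_mult_right V.integrable_const_bound[where B = 1]) (auto simp: indicator_def)
    qed auto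
    also have "(LINT x|\<nu>. (\<kappa> - 4 * D n) * indicator {x. \<epsilon> * b n \<le> \<bar>x\<bar>} x) =
        (\<kappa> - 4 * D n) * measure \<nu> {x. \<epsilon> * b n \<le> \<bar>x\<bar>}" by simp
    finally show ?thesis by (simp add: mult_ac)
  qed
  have ev: "\<forall>\<^sub>F n in sequentially. real n * measure \<nu> {x. \<epsilon> * b n \<le> \<bar>x\<bar>} \<le> D n / (\<kappa> / 2)"
  proof -
    have "\<forall>\<^sub>F n in sequentially. D n < \<kappa> / 8" using \<kappa> by (intro order_tendstoD(2)[OF D]) auto
    thus ?thesis
    proof eventually_elim
      case (elim n)
      have "real n * measure \<nu> {x. \<epsilon> * b n \<le> \<bar>x\<bar>} * (\<kappa> / 2) \<le>
          real n * measure \<nu> {x. \<epsilon> * b n \<le> \<bar>x\<bar>} * (\<kappa> - 4 * D n)"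
        using elim by (intro mult_left_mono) auto
      also have "\<dots> \<le> D n" using elim \<kappa> by (intro key) auto
      finally show ?case using \<kappa> by (subst pos_le_divide_eq) auto
    qed
  qed
  have "(\<lambda>n. D n / (\<kappa> / 2)) \<longlonglongrightarrow> 0 / (\<kappa> / 2)" using \<kappa> by (intro tendsto_divide D) auto
  hence lim0: "(\<lambda>n. D n / (\<kappa> / 2)) \<longlonglongrightarrow> 0" by simp
  show ?thesis by (rule tendsto_sandwich[OF _ ev tendsto_const lim0]) simp
qed

lemma sum_by_pairs: "(\<Sum>i=1..2 * h. f i) = (\<Sum>k=1..h. f (2 * k - 1) + f (2 * k :: nat) :: real)"
  by (induction h) (auto simp: sum.distrib)

text \<open>The differences within disjoint pairs of observations are independent of each other and free of the
unknown centre. They give a lower bound of the right order for the sum of squares.\<close>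

lemma sample_var_ge_pairs:
  assumes "0 < n" "2 * h \<le> n"
  shows "(\<Sum>k=1..h. (x (2 * k - 1) - x (2 * k))\<^sup>2) / 2 \<le> real n * sample_var n x"
proof -
  define c where "c = sample_mean n x"
  have "(\<Sum>k=1..h. (x (2 * k - 1) - x (2 * k))\<^sup>2 / 2) \<le> (\<Sum>k=1..h. (x (2 * k - 1) - c)\<^sup>2 + (x (2 * k) - c)\<^sup>2)"
  proof (intro sum_mono)
    fix k
    have "(x (2 * k - 1) - c)\<^sup>2 + (x (2 * k) - c)\<^sup>2 - (x (2 * k - 1) - x (2 * k))\<^sup>2 / 2 =
        ((x (2 * k - 1) - c) + (x (2 * k) - c))\<^sup>2 / 2"
      by (simp add: power2_eq_square field_simps)
    moreover have "\<dots> \<ge> 0" by simp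
    ultimately show "(x (2 * k - 1) - x (2 * k))\<^sup>2 / 2 \<le> (x (2 * k - 1) - c)\<^sup>2 + (x (2 * k) - c)\<^sup>2" by linarith
  qed
  also have "\<dots> = (\<Sum>i=1..2 * h. (x i - c)\<^sup>2)" by (rule sum_by_pairs[symmetric])
  also have "\<dots> \<le> (\<Sum>i=1..n. (x i - c)\<^sup>2)" using assms by (intro sum_mono2) auto
  also have "\<dots> = real n * sample_var n x" using assms by (simp add: sample_var_def c_def)
  finally show ?thesis by (simp add: sum_divide_distrib)
qed

lemma abs_minus_sample_mean_le:
  assumes "i \<in> {1..n}" "\<And>j. j \<in> {1..n} \<Longrightarrow> \<bar>x j - c\<bar> \<le> d"
  shows "\<bar>x i - sample_mean n x\<bar> \<le> 2 * d"
proof -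
  have n: "0 < n" using assms(1) by simp
  have "\<bar>\<Sum>j=1..n. x j - c\<bar> \<le> (\<Sum>j=1..n. d)"
    by (rule order_trans[OF sum_abs]) (intro sum_mono assms(2))
  hence "\<bar>\<Sum>j=1..n. x j - c\<bar> \<le> real n * d" by simp
  moreover have "sample_mean n x - c = (\<Sum>j=1..n. x j - c) / real n"
    using n by (simp add: sample_mean_def sum_subtractf diff_divide_distrib)
  ultimately have "\<bar>sample_mean n x - c\<bar> \<le> d"
    using n by (simp add: abs_divide pos_divide_le_eq mult.commute)
  thus ?thesis using assms(2)[OF assms(1)] by linarith
qed

text \<open>If all observations lie within a small distance, then no deviation from the mean passes the threshold
and the truncated sum is empty.\<close>

lemma lindeberg_of_small_range:
  assumes n: "0 < n" and S: "s < real n * sample_var n x" "0 < s"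
    and d: "\<And>j. j \<in> {1..n} \<Longrightarrow> \<bar>x j - c\<bar> \<le> d"
    and le: "4 * d\<^sup>2 * real n \<le> \<delta> * real k * s" and \<delta>: "0 < \<delta>" and k: "0 < k"
  shows "lindeberg n k \<delta> x"
proof -
  have "0 < real n * sample_var n x" using S by linarith
  hence v: "0 < sample_var n x" using n by (simp add: zero_less_mult_iff)
  have "\<not> \<delta> * real k * sample_var n x < (x i - sample_mean n x)\<^sup>2" if i: "i \<in> {1..n}" for i
  proof -
    have "\<bar>x i - sample_mean n x\<bar> \<le> 2 * d" by (rule abs_minus_sample_mean_le[OF i d])
    hence "\<bar>x i - sample_mean n x\<bar>\<^sup>2 \<le> (2 * d)\<^sup>2" by (intro power_mono) auto
    hence "(x i - sample_mean n x)\<^sup>2 * real n \<le> 4 * d\<^sup>2 * real n"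
      by (intro mult_right_mono) (auto simp: power_mult_distrib)
    also have "\<dots> \<le> \<delta> * real k * s" by (rule le)
    also have "\<dots> \<le> \<delta> * real k * (real n * sample_var n x)"
      using S \<delta> by (intro mult_left_mono) auto
    finally have "(x i - sample_mean n x)\<^sup>2 * real n \<le> \<delta> * real k * sample_var n x * real n"
      by (simp add: mult_ac)
    thus ?thesis using n by simp
  qed
  hence "(\<Sum>i=1..n. (x i - sample_mean n x)\<^sup>2 *
        of_bool (\<delta> * real k * sample_var n x < (x i - sample_mean n x)\<^sup>2)) = 0"
    by (intro sum.neutral) auto
  thus ?thesis unfolding lindeberg_def using v \<delta> by simp
qed

context iid_data
begin

definition cf :: "real \<Rightarrow> complex" where
  "cf = char (distr M borel X)"

lemma norm_cf_le: "norm (cf t) \<le> 1"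
proof -
  interpret R: real_distribution "distr M borel X" by (rule real_distribution_distr) simp
  show ?thesis unfolding cf_def by (rule R.cmod_char_le_1)
qed

definition norming :: "(nat \<Rightarrow> real) \<Rightarrow> (nat \<Rightarrow> real) \<Rightarrow> bool" where
  "norming a b \<longleftrightarrow> (\<forall>n. b n > 0) \<and>
     weak_conv_m (\<lambda>n. distr M borel (\<lambda>\<omega>. ((\<Sum>i=1..n. Xs i \<omega>) - a n) / b n)) std_normal_distribution"

lemma norm_cf_power_tendsto:
  assumes "norming a b"
  shows "(\<lambda>n. norm (cf (t / b n)) ^ n) \<longlonglongrightarrow> exp (- (t\<^sup>2) / 2)"
proof -
  let ?P = "\<lambda>n. distr M borel (\<lambda>\<omega>. ((\<Sum>i=1..n. Xs i \<omega>) - a n) / b n)"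
  have meas [measurable]: "(\<lambda>\<omega>. \<Sum>i=1..n. Xs i \<omega>) \<in> borel_measurable M" for n
    by (intro borel_measurable_sum) auto
  have "(\<lambda>n. char (?P n) t) \<longlonglongrightarrow> char std_normal_distribution t"
    using assms unfolding norming_def
    by (intro levy_continuity1 real_dist_normal_dist real_distribution_distr) auto
  hence lim: "(\<lambda>n. norm (char (?P n) t)) \<longlonglongrightarrow> norm (char std_normal_distribution t)" by (rule tendsto_norm)
  have "norm (char (?P n) t) = norm (cf (t / b n)) ^ n" for n
  proof -
    have "char (?P n) t = (CLINT \<omega>|M. iexp (t * (((\<Sum>i=1..n. Xs i \<omega>) - a n) / b n)))"
      unfolding char_def by (subst integral_distr) auto
    also have "\<dots> = (CLINT \<omega>|M. iexp (- (t * a n / b n)) * iexp (t / b n * (\<Sum>i=1..n. Xs i \<omega>)))"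
      by (intro Bochner_Integration.integral_cong refl)
         (simp add: exp_add[symmetric] diff_divide_distrib right_diff_distrib)
    also have "\<dots> = iexp (- (t * a n / b n)) * char (distr M borel (\<lambda>\<omega>. \<Sum>i=1..n. Xs i \<omega>)) (t / b n)"
      unfolding char_def by (subst integral_distr) auto
    also have "char (distr M borel (\<lambda>\<omega>. \<Sum>i=1..n. Xs i \<omega>)) (t / b n) = (\<Prod>i=1..n. char (distr M borel (Xs i)) (t / b n))"
      by (intro char_distr_sum indep_vars_subset[OF Xs_indep]) auto
    also have "\<dots> = cf (t / b n) ^ n" by (simp add: Xs_distr cf_def)
    finally show ?thesis by (simp add: norm_mult norm_power)
  qed
  thus ?thesis using lim by (simp add: char_std_normal_distribution)
qed

lemma Xs_pair_indep:
  assumes "1 \<le> i" "1 \<le> j" "i \<noteq> j"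
  shows "indep_var borel (Xs i) borel (Xs j)"
proof -
  have "indep_var (PiM {i} (\<lambda>_. borel)) (\<lambda>\<omega>. restrict (\<lambda>k. Xs k \<omega>) {i})
     (PiM {j} (\<lambda>_. borel)) (\<lambda>\<omega>. restrict (\<lambda>k. Xs k \<omega>) {j})"
    using assms by (intro indep_var_restrict[OF Xs_indep]) auto
  hence "indep_var borel ((\<lambda>f. f i) \<circ> (\<lambda>\<omega>. restrict (\<lambda>k. Xs k \<omega>) {i}))
     borel ((\<lambda>f. f j) \<circ> (\<lambda>\<omega>. restrict (\<lambda>k. Xs k \<omega>) {j}))"
    by (rule indep_var_compose) auto
  thus ?thesis by (simp add: comp_def)
qed

text \<open>The law of a symmetrized observation. By uniqueness of characteristic functions it is the law of the
difference of any two distinct observations.\<close>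

definition sym_law :: "real measure" where
  "sym_law = distr M borel (\<lambda>\<omega>. Xs 1 \<omega> - Xs 2 \<omega>)"

lemma char_difference:
  assumes "1 \<le> i" "1 \<le> j" "i \<noteq> j"
  shows "char (distr M borel (\<lambda>\<omega>. Xs i \<omega> - Xs j \<omega>)) t = of_real ((norm (cf t))\<^sup>2)"
proof -
  have [measurable]: "Xs i \<in> borel_measurable M" "Xs j \<in> borel_measurable M" using assms by auto
  have "indep_var borel ((\<lambda>x. x) \<circ> Xs i) borel (uminus \<circ> Xs j)"
    by (rule indep_var_compose[OF Xs_pair_indep[OF assms]]) auto
  hence "char (distr M borel (\<lambda>\<omega>. Xs i \<omega> + (- Xs j \<omega>))) t =
      char (distr M borel (Xs i)) t * char (distr M borel (\<lambda>\<omega>. - Xs j \<omega>)) t"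
    by (intro char_distr_add) (simp add: comp_def)
  also have "char (distr M borel (Xs i)) t = cf t" using assms by (simp add: Xs_distr cf_def)
  also have "char (distr M borel (\<lambda>\<omega>. - Xs j \<omega>)) t = cnj (cf t)"
  proof -
    have "char (distr M borel (\<lambda>\<omega>. - Xs j \<omega>)) t = (CLINT \<omega>|M. cnj (iexp (t * Xs j \<omega>)))"
      unfolding char_def by (subst integral_distr) (auto simp: exp_cnj)
    also have "\<dots> = cnj (char (distr M borel (Xs j)) t)"
      unfolding char_def by (subst integral_distr) auto
    finally show ?thesis using assms by (simp add: Xs_distr cf_def)
  qed
  finally show ?thesis by (simp add: complex_norm_square[symmetric] del: of_real_power)
qed

lemma distr_difference:
  assumes "1 \<le> i" "1 \<le> j" "i \<noteq> j"
  shows "distr M borel (\<lambda>\<omega>. Xs i \<omega> - Xs j \<omega>) = sym_law"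
proof -
  have meas: "(\<lambda>\<omega>. Xs i \<omega> - Xs j \<omega>) \<in> borel_measurable M" if "1 \<le> i" "1 \<le> j" for i j
    using that by measurable
  show ?thesis unfolding sym_law_def
    by (rule Levy_uniqueness) (use assms in \<open>auto intro!: real_distribution_distr meas simp: fun_eq_iff char_difference\<close>)
qed

lemma sym_law_real_distribution: "real_distribution sym_law"
  unfolding sym_law_def by (intro real_distribution_distr borel_measurable_diff) auto

lemma sym_law_cos: "(LINT x|sym_law. 1 - cos (t * x)) = 1 - (norm (cf t))\<^sup>2"
proof -
  interpret S: real_distribution sym_law by (rule sym_law_real_distribution)
  have int: "integrable sym_law (\<lambda>x. cos (t * x))" by (rule S.integrable_const_bound[where B = 1]) auto
  have "(LINT x|sym_law. cos (t * x)) = (LINT x|sym_law. Re (iexp (t * x)))"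
    unfolding cis_conv_exp[symmetric] by simp
  also have "\<dots> = Re (char sym_law t)" unfolding char_def by (intro integral_Re S.integrable_iexp) auto
  also have "\<dots> = (norm (cf t))\<^sup>2" unfolding sym_law_def by (simp add: char_difference)
  finally show ?thesis using int S.prob_space by simp
qed

text \<open>Normal convergence of the normalized sums implies that \<open>norm (cf (t / b n)) ^ n\<close> tends to
\<open>exp (- t\<^sup>2 / 2)\<close>; the centring constants disappear in the modulus.\<close>

lemma sym_law_first_moment:
  assumes "norming a b"
  shows "(\<lambda>n. real n * (LINT x|sym_law. 1 - cos (t * (x / b n)))) \<longlonglongrightarrow> t\<^sup>2"
proof -
  have "(\<lambda>n. real n * (1 - (norm (cf (t / b n)))\<^sup>2)) \<longlonglongrightarrow> t\<^sup>2"
  proof (rule power_tendsto_exp_imp)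
    show "(norm (cf (t / b n)))\<^sup>2 \<le> 1" for n using norm_cf_le by (simp add: power_le_one)
    have "(\<lambda>n. (norm (cf (t / b n)) ^ n)\<^sup>2) \<longlonglongrightarrow> (exp (- (t\<^sup>2) / 2))\<^sup>2"
      by (intro tendsto_power norm_cf_power_tendsto[OF assms])
    thus "(\<lambda>n. ((norm (cf (t / b n)))\<^sup>2) ^ n) \<longlonglongrightarrow> exp (- (t\<^sup>2))"
      by (simp add: power_mult[symmetric] mult.commute exp_double[symmetric])
  qed auto
  thus ?thesis using sym_law_cos[of "t / b _"] by simp
qed

text \<open>By the doubling formula \<open>(1 - cos u)\<^sup>2 = 2 * (1 - cos u) - (1 - cos (2 * u)) / 2\<close> the limit is
\<open>2 * t\<^sup>2 - (2 * t)\<^sup>2 / 2 = 0\<close>. The vanishing is special to the quadratic exponent of the normal law.\<close>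

lemma sym_law_second_moment:
  assumes "norming a b"
  shows "(\<lambda>n. real n * (LINT x|sym_law. (1 - cos (t * (x / b n)))\<^sup>2)) \<longlonglongrightarrow> 0"
proof -
  interpret S: real_distribution sym_law by (rule sym_law_real_distribution)
  have int: "integrable sym_law (\<lambda>x. 1 - cos (s * (x / b n)))" for s n
    by (rule S.integrable_const_bound[where B = 2]) (simp_all add: abs_one_minus_cos_le)
  have "(\<lambda>n. 2 * (real n * (LINT x|sym_law. 1 - cos (t * (x / b n)))) -
      (real n * (LINT x|sym_law. 1 - cos (2 * t * (x / b n)))) / 2) \<longlonglongrightarrow> 2 * t\<^sup>2 - (2 * t)\<^sup>2 / 2"
    by (intro tendsto_intros sym_law_first_moment[OF assms]) auto
  moreover have "real n * (LINT x|sym_law. (1 - cos (t * (x / b n)))\<^sup>2) =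
     2 * (real n * (LINT x|sym_law. 1 - cos (t * (x / b n)))) -
      (real n * (LINT x|sym_law. 1 - cos (2 * t * (x / b n)))) / 2" for n
  proof -
    have "(LINT x|sym_law. (1 - cos (t * (x / b n)))\<^sup>2) =
        (LINT x|sym_law. 2 * (1 - cos (t * (x / b n))) - (1 - cos (2 * t * (x / b n))) / 2)"
      by (intro Bochner_Integration.integral_cong refl) (simp add: one_minus_cos_double mult.assoc)
    also have "\<dots> = 2 * (LINT x|sym_law. 1 - cos (t * (x / b n))) - (LINT x|sym_law. 1 - cos (2 * t * (x / b n))) / 2"
    proof -
      have "(LINT x|sym_law. 2 * f x - g x / 2) = 2 * integral\<^sup>L sym_law f - integral\<^sup>L sym_law g / 2"
        if "integrable sym_law f" "integrable sym_law g" for f g :: "real \<Rightarrow> real"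
        using that by simp
      thus ?thesis using int by blast
    qed
    finally show ?thesis by (simp add: right_diff_distrib)
  qed
  ultimately show ?thesis by (simp add: power_mult_distrib)
qed

text \<open>All observations are compared with the first one, so that the tail of the difference of two
observations decides.\<close>

lemma range_tendsto_0:
  assumes "norming a b" "0 < \<epsilon>"
  shows "(\<lambda>n. prob {\<omega> \<in> space M. \<exists>i\<in>{2..n}. \<epsilon> * b n \<le> \<bar>Xs i \<omega> - Xs 1 \<omega>\<bar>}) \<longlonglongrightarrow> 0"
proof -
  have b: "0 < b n" for n using assms by (simp add: norming_def)
  have lim: "(\<lambda>n. real n * measure sym_law {x. \<epsilon> * b n \<le> \<bar>x\<bar>}) \<longlonglongrightarrow> 0"
    by (rule tail_from_cosine_moments[OF sym_law_real_distribution b sym_law_second_moment[OF assms(1)] assms(2)])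
  have "prob {\<omega> \<in> space M. \<exists>i\<in>{2..n}. \<epsilon> * b n \<le> \<bar>Xs i \<omega> - Xs 1 \<omega>\<bar>} \<le> real n * measure sym_law {x. \<epsilon> * b n \<le> \<bar>x\<bar>}" for n
  proof -
    have ev: "{\<omega> \<in> space M. \<epsilon> * b n \<le> \<bar>Xs i \<omega> - Xs 1 \<omega>\<bar>} \<in> events" if "i \<in> {2..n}" for i
    proof -
      have [measurable]: "Xs i \<in> borel_measurable M" using that by simp
      show ?thesis by measurable
    qed
    have "prob {\<omega> \<in> space M. \<exists>i\<in>{2..n}. \<epsilon> * b n \<le> \<bar>Xs i \<omega> - Xs 1 \<omega>\<bar>} =
        prob (\<Union>i\<in>{2..n}. {\<omega> \<in> space M. \<epsilon> * b n \<le> \<bar>Xs i \<omega> - Xs 1 \<omega>\<bar>})"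
      by (intro arg_cong[where f = prob]) auto
    also have "\<dots> \<le> (\<Sum>i\<in>{2..n}. prob {\<omega> \<in> space M. \<epsilon> * b n \<le> \<bar>Xs i \<omega> - Xs 1 \<omega>\<bar>})"
      using ev by (intro finite_measure_subadditive_finite) auto
    also have "\<dots> = (\<Sum>i\<in>{2..n}. measure sym_law {x. \<epsilon> * b n \<le> \<bar>x\<bar>})"
    proof (intro sum.cong refl)
      fix i assume i: "i \<in> {2..n}"
      have [measurable]: "Xs i \<in> borel_measurable M" using i by simp
      have "measure sym_law {x. \<epsilon> * b n \<le> \<bar>x\<bar>} = measure (distr M borel (\<lambda>\<omega>. Xs i \<omega> - Xs 1 \<omega>)) {x. \<epsilon> * b n \<le> \<bar>x\<bar>}"
        using i by (subst distr_difference) auto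
      also have "\<dots> = prob {\<omega> \<in> space M. \<epsilon> * b n \<le> \<bar>Xs i \<omega> - Xs 1 \<omega>\<bar>}"
        by (subst measure_distr) (auto simp: vimage_def Int_def conj_commute)
      finally show "prob {\<omega> \<in> space M. \<epsilon> * b n \<le> \<bar>Xs i \<omega> - Xs 1 \<omega>\<bar>} = measure sym_law {x. \<epsilon> * b n \<le> \<bar>x\<bar>}" ..
    qed
    also have "\<dots> \<le> real n * measure sym_law {x. \<epsilon> * b n \<le> \<bar>x\<bar>}"
      by (simp add: mult_right_mono)
    finally show ?thesis .
  qed
  thus ?thesis by (intro tendsto_sandwich[OF _ always_eventually tendsto_const lim]) auto
qed

text \<open>The variables \<open>Z = 1 - cos (Y / b n) \<le> Y\<^sup>2 / (2 * (b n)\<^sup>2)\<close> formed from the \<open>n div 2\<close> disjoint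
differences \<open>Y\<close> are independent. Their sum has mean tending to \<open>1 / 2\<close> and variance tending to 0 by the
limits for the first and second cosine moments, so it exceeds \<open>1 / 4\<close> with probability tending to 1.\<close>

lemma sample_var_lower_bound:
  assumes "norming a b"
  shows "(\<lambda>n. prob {\<omega> \<in> space M. real n * sample_var n (\<lambda>i. Xs i \<omega>) \<le> (b n)\<^sup>2 / 4}) \<longlonglongrightarrow> 0"
proof -
  interpret S: real_distribution sym_law by (rule sym_law_real_distribution)
  have b: "0 < b n" for n using assms by (simp add: norming_def)
  define h where "h n = n div 2" for n :: nat
  define Z where "Z n k \<omega> = 1 - cos ((Xs (2 * k - 1) \<omega> - Xs (2 * k) \<omega>) / b n)" for n k \<omega>
  define e where "e n = (LINT x|sym_law. 1 - cos (1 * (x / b n)))" for n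
  define q where "q n = (LINT x|sym_law. (1 - cos (1 * (x / b n)))\<^sup>2)" for n
  have Y_meas: "(\<lambda>\<omega>. Xs (2 * k - 1) \<omega> - Xs (2 * k) \<omega>) \<in> borel_measurable M" if "1 \<le> k" for k
    using that by (intro borel_measurable_diff Xs_meas) auto
  have Z_meas [measurable]: "Z n k \<in> borel_measurable M" if "1 \<le> k" for n k
    unfolding Z_def[abs_def]
    by (rule measurable_compose[OF Y_meas[OF that], of "\<lambda>y. 1 - cos (y / b n)"]) measurable
  have Z_bound: "0 \<le> Z n k \<omega>" "Z n k \<omega> \<le> 2" for n k \<omega>
    using cos_ge_minus_one[of "(Xs (2 * k - 1) \<omega> - Xs (2 * k) \<omega>) / b n"]
      cos_le_one[of "(Xs (2 * k - 1) \<omega> - Xs (2 * k) \<omega>) / b n"] unfolding Z_def by linarith+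
  have Z_E: "expectation (\<lambda>\<omega>. g (Z n k \<omega>)) = (LINT x|sym_law. g (1 - cos (1 * (x / b n))))"
    if k: "1 \<le> k" and [measurable]: "g \<in> borel_measurable borel" for g :: "real \<Rightarrow> real" and n k
  proof -
    have "distr M borel (\<lambda>\<omega>. Xs (2 * k - 1) \<omega> - Xs (2 * k) \<omega>) = sym_law"
      using k by (intro distr_difference) auto
    hence "(LINT x|sym_law. g (1 - cos (1 * (x / b n)))) =
        (LINT x|distr M borel (\<lambda>\<omega>. Xs (2 * k - 1) \<omega> - Xs (2 * k) \<omega>). g (1 - cos (1 * (x / b n))))" by simp
    also have "\<dots> = expectation (\<lambda>\<omega>. g (Z n k \<omega>))"
      by (subst integral_distr[OF Y_meas[OF k]]) (simp_all add: Z_def)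
    finally show ?thesis ..
  qed
  have Z_indep: "indep_var borel (Z n j) borel (Z n k)" if "1 \<le> j" "1 \<le> k" "j \<noteq> k" for n j k
  proof -
    let ?R = "\<lambda>A \<omega>. restrict (\<lambda>i. Xs i \<omega>) A"
    have "{2 * j - 1, 2 * j} \<inter> {2 * k - 1, 2 * k} = {}" using that by auto
    hence "indep_var (PiM {2 * j - 1, 2 * j} (\<lambda>_. borel)) (?R {2 * j - 1, 2 * j})
        (PiM {2 * k - 1, 2 * k} (\<lambda>_. borel)) (?R {2 * k - 1, 2 * k})"
      using that by (intro indep_var_restrict[OF Xs_indep]) auto
    moreover have "(\<lambda>x. 1 - cos ((x (2 * i - 1) - x (2 * i)) / b n)) \<in>
        borel_measurable (PiM {2 * i - 1, 2 * i} (\<lambda>_. borel))" for i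
      by measurable
    ultimately have "indep_var borel ((\<lambda>x. 1 - cos ((x (2 * j - 1) - x (2 * j)) / b n)) \<circ> ?R {2 * j - 1, 2 * j})
        borel ((\<lambda>x. 1 - cos ((x (2 * k - 1) - x (2 * k)) / b n)) \<circ> ?R {2 * k - 1, 2 * k})"
      by (intro indep_var_compose)
    thus ?thesis by (simp add: comp_def Z_def[abs_def])
  qed
  have int_bd: "integrable M f" if "f \<in> borel_measurable M" "\<And>\<omega>. \<bar>f \<omega>\<bar> \<le> c" for f :: "'a \<Rightarrow> real" and c
    using that by (intro integrable_const_bound[where B = c]) auto
  have int_Z: "integrable M (Z n k)" if "1 \<le> k" for n k
    using Z_bound that by (intro int_bd[of _ 2] Z_meas) (auto simp: abs_le_iff intro: order_trans[of _ 0])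
  have e_bound: "0 \<le> e n" "e n \<le> 2" for n
  proof -
    show "0 \<le> e n" unfolding e_def by (intro integral_nonneg_AE) auto
    have "e n \<le> (LINT x|sym_law. 2)" unfolding e_def
      using abs_one_minus_cos_le by (intro integral_mono S.integrable_const_bound[where B = 2]) (auto simp: abs_le_iff)
    thus "e n \<le> 2" using S.prob_space by simp
  qed
  define W where "W n k \<omega> = Z n k \<omega> - e n" for n k \<omega>
  have W_bound: "\<bar>W n k \<omega>\<bar> \<le> 2" for n k \<omega>
    using Z_bound[of n k \<omega>] e_bound[of n] by (auto simp: W_def abs_le_iff)
  have W_meas [measurable]: "W n k \<in> borel_measurable M" if "1 \<le> k" for n k
    unfolding W_def[abs_def] using that by (intro borel_measurable_diff Z_meas) auto
  have int_W: "integrable M (W n k)" if "1 \<le> k" for n k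
    using that by (intro int_bd[of _ 2] W_meas W_bound)
  have E_W: "expectation (W n k) = 0" if "1 \<le> k" for n k
    using int_Z[OF that] Z_E[OF that, of "\<lambda>x. x" n] prob_space
    by (simp add: W_def[abs_def] e_def)
  have int_WW: "integrable M (\<lambda>\<omega>. W n j \<omega> * W n k \<omega>)" if "1 \<le> j" "1 \<le> k" for n j k
    using that W_bound mult_mono[OF W_bound W_bound]
    by (intro int_bd[of _ 4] borel_measurable_times W_meas) (auto simp: abs_mult)
  have E_WW: "expectation (\<lambda>\<omega>. W n j \<omega> * W n k \<omega>) \<le> (if j = k then q n else 0)" if jk: "1 \<le> j" "1 \<le> k" for n j k
  proof (cases "j = k")
    case True
    have int_Z2: "integrable M (\<lambda>\<omega>. (Z n k \<omega>)\<^sup>2)"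
      using Z_bound jk power_mono[OF Z_bound(2) Z_bound(1), of _ _ _ 2]
      by (intro int_bd[of _ 4] borel_measurable_power Z_meas) auto
    have EZ: "expectation (Z n k) = e n" using Z_E[OF jk(2), of "\<lambda>x. x" n] by (simp add: e_def)
    have "expectation (\<lambda>\<omega>. W n k \<omega> * W n k \<omega>) = variance (Z n k)"
      unfolding W_def EZ power2_eq_square ..
    also have "\<dots> = expectation (\<lambda>\<omega>. (Z n k \<omega>)\<^sup>2) - (expectation (Z n k))\<^sup>2"
      using int_Z[OF jk(2)] int_Z2 by (rule variance_eq)
    also have "\<dots> \<le> expectation (\<lambda>\<omega>. (Z n k \<omega>)\<^sup>2)" by simp
    also have "\<dots> = q n" using Z_E[OF jk(2), of "\<lambda>x. x\<^sup>2" n] by (simp add: q_def)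
    finally show ?thesis using True by simp
  next
    case False
    have "indep_var borel ((\<lambda>x. x - e n) \<circ> Z n j) borel ((\<lambda>x. x - e n) \<circ> Z n k)"
      by (rule indep_var_compose[OF Z_indep[OF jk False]]) auto
    hence "indep_var borel (W n j) borel (W n k)" by (simp add: comp_def W_def[abs_def])
    hence "expectation (\<lambda>\<omega>. W n j \<omega> * W n k \<omega>) = expectation (W n j) * expectation (W n k)"
      by (rule indep_var_lebesgue_integral) (use jk int_W in auto)
    thus ?thesis using False E_W jk by simp
  qed
  have second: "expectation (\<lambda>\<omega>. (\<Sum>k=1..h n. W n k \<omega>)\<^sup>2) \<le> real n * q n" for n
  proof -
    have q: "0 \<le> q n" unfolding q_def by (intro integral_nonneg_AE) auto
    have "expectation (\<lambda>\<omega>. (\<Sum>k=1..h n. W n k \<omega>)\<^sup>2) = expectation (\<lambda>\<omega>. \<Sum>j=1..h n. \<Sum>k=1..h n. W n j \<omega> * W n k \<omega>)"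
      by (simp add: power2_eq_square sum_product)
    also have "\<dots> = (\<Sum>j=1..h n. expectation (\<lambda>\<omega>. \<Sum>k=1..h n. W n j \<omega> * W n k \<omega>))"
      by (intro Bochner_Integration.integral_sum Bochner_Integration.integrable_sum int_WW) auto
    also have "\<dots> = (\<Sum>j=1..h n. \<Sum>k=1..h n. expectation (\<lambda>\<omega>. W n j \<omega> * W n k \<omega>))"
      by (intro sum.cong refl Bochner_Integration.integral_sum int_WW) auto
    also have "\<dots> \<le> (\<Sum>j=1..h n. \<Sum>k=1..h n. if j = k then q n else 0)"
      by (intro sum_mono E_WW) auto
    also have "\<dots> = real (h n) * q n" by simp
    also have "\<dots> \<le> real n * q n" using q by (intro mult_right_mono) (auto simp: h_def)
    finally show ?thesis .
  qed
  have nq: "(\<lambda>n. real n * q n) \<longlonglongrightarrow> 0" unfolding q_def by (rule sym_law_second_moment[OF assms])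
  have ne: "(\<lambda>n. real n * e n) \<longlonglongrightarrow> 1\<^sup>2" unfolding e_def by (rule sym_law_first_moment[OF assms])
  have "\<forall>\<^sub>F n in sequentially. 7 / 8 < real n * e n" using order_tendstoD(1)[OF ne, of "7 / 8"] by simp
  moreover have "\<forall>\<^sub>F n in sequentially. 16 < n" by (rule eventually_gt_at_top)
  \<comment> \<open>the mean of the sum is about \<open>1 / 2\<close>; \<open>3 / 8\<close> leaves a gap of \<open>1 / 8\<close> above \<open>1 / 4\<close>\<close>
  ultimately have he: "\<forall>\<^sub>F n in sequentially. 3 / 8 < real (h n) * e n"
  proof eventually_elim
    case (elim n)
    have "real n * (7 / 16) \<le> real (h n)" using elim unfolding h_def by linarith
    hence "real n * (7 / 16) * e n \<le> real (h n) * e n" using e_bound by (intro mult_right_mono) auto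
    thus ?case using elim by simp
  qed
  have le: "\<forall>\<^sub>F n in sequentially. prob {\<omega> \<in> space M. real n * sample_var n (\<lambda>i. Xs i \<omega>) \<le> (b n)\<^sup>2 / 4}
      \<le> (real n * q n) / (1 / 64)"
    using he eventually_gt_at_top[of 0]
  proof eventually_elim
    case (elim n)
    let ?f = "\<lambda>\<omega>. (\<Sum>k=1..h n. W n k \<omega>)\<^sup>2"
    have f_meas [measurable]: "?f \<in> borel_measurable M"
      by (intro borel_measurable_power borel_measurable_sum W_meas) auto
    have int_f: "integrable M ?f"
    proof -
      have "integrable M (\<lambda>\<omega>. \<Sum>j=1..h n. \<Sum>k=1..h n. W n j \<omega> * W n k \<omega>)"
        by (intro Bochner_Integration.integrable_sum int_WW) auto
      thus ?thesis by (simp add: power2_eq_square sum_product)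
    qed
    have "prob {\<omega> \<in> space M. real n * sample_var n (\<lambda>i. Xs i \<omega>) \<le> (b n)\<^sup>2 / 4} \<le> prob {\<omega> \<in> space M. 1 / 64 \<le> ?f \<omega>}"
    proof (rule finite_measure_mono, safe)
      fix \<omega> assume small: "real n * sample_var n (\<lambda>i. Xs i \<omega>) \<le> (b n)\<^sup>2 / 4"
      have "(b n)\<^sup>2 * (\<Sum>k=1..h n. Z n k \<omega>) \<le> (\<Sum>k=1..h n. (Xs (2 * k - 1) \<omega> - Xs (2 * k) \<omega>)\<^sup>2 / 2)"
        unfolding sum_distrib_left
      proof (rule sum_mono)
        fix k
        have "Z n k \<omega> \<le> ((Xs (2 * k - 1) \<omega> - Xs (2 * k) \<omega>) / b n)\<^sup>2 / 2"
          unfolding Z_def by (rule one_minus_cos_le)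
        thus "(b n)\<^sup>2 * Z n k \<omega> \<le> (Xs (2 * k - 1) \<omega> - Xs (2 * k) \<omega>)\<^sup>2 / 2"
          using b[of n] by (simp add: power_divide field_simps)
      qed
      also have "\<dots> \<le> real n * sample_var n (\<lambda>i. Xs i \<omega>)"
        using sample_var_ge_pairs[of n "h n" "\<lambda>i. Xs i \<omega>"] elim by (simp add: sum_divide_distrib h_def)
      also note small
      finally have "(b n)\<^sup>2 * (\<Sum>k=1..h n. Z n k \<omega>) \<le> (b n)\<^sup>2 * (1 / 4)" by simp
      hence "(\<Sum>k=1..h n. Z n k \<omega>) \<le> 1 / 4" using b[of n] by (subst (asm) mult_le_cancel_left_pos) auto
      hence "(\<Sum>k=1..h n. W n k \<omega>) \<le> - (1 / 8)"
        using elim by (simp add: W_def sum_subtractf)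
      hence "(1 / 8)\<^sup>2 \<le> \<bar>\<Sum>k=1..h n. W n k \<omega>\<bar>\<^sup>2" by (intro power_mono) auto
      thus "1 / 64 \<le> ?f \<omega>" by (simp add: power_divide)
    qed measurable
    also have "\<dots> \<le> expectation ?f / (1 / 64)"
      by (intro integral_Markov_inequality_measure[OF int_f]) auto
    also have "\<dots> \<le> (real n * q n) / (1 / 64)" by (intro divide_right_mono second) auto
    finally show ?case .
  qed
  have "(\<lambda>n. (real n * q n) / (1 / 64)) \<longlonglongrightarrow> 0 / (1 / 64)" by (intro tendsto_divide nq) auto
  hence lim: "(\<lambda>n. (real n * q n) / (1 / 64)) \<longlonglongrightarrow> 0" by simp
  show ?thesis by (rule tendsto_sandwich[OF _ le tendsto_const lim]) simp
qed

end

text \<open>Replaces the random centre and scale in the Lindeberg condition by a fixed centre \<open>\<mu>\<close> and a lower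
bound for the sample variance. The hypothesis on the mean square makes the squared distance of the
sample mean from \<open>\<mu>\<close> at most \<open>R / 8\<close>; a deviation from the sample mean whose square exceeds \<open>R\<close> is
then comparable with the deviation from \<open>\<mu>\<close>.\<close>

lemma lindeberg_of_truncated:
  assumes n: "0 < n" and v: "\<sigma> / 4 < sample_var n x" and pos: "0 < \<sigma>" "0 < \<delta>"
    and R: "R = \<delta> * real k * \<sigma> / 4"
    and mean: "(\<Sum>i=1..n. (x i - \<mu>)\<^sup>2) / real n \<le> R / 8"
    and tail: "(\<Sum>i=1..n. 4 * ((x i - \<mu>)\<^sup>2 * of_bool (R / 4 < (x i - \<mu>)\<^sup>2))) / real n \<le> \<delta> * \<sigma> / 4"
  shows "lindeberg n k \<delta> x"
proof -
  define d where "d = sample_mean n x - \<mu>"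
  have v0: "0 < sample_var n x" using v pos by linarith
  have d2: "d\<^sup>2 \<le> R / 8"
  proof -
    have "(\<Sum>i=1..n. (x i - sample_mean n x)) = 0" using n by (simp add: sum_subtractf sample_mean_def)
    hence "0 = (\<Sum>i=1..n. 2 * d * (x i - sample_mean n x))" by (simp flip: sum_distrib_left)
    hence "real n * d\<^sup>2 \<le> (\<Sum>i=1..n. (x i - sample_mean n x)\<^sup>2 + 2 * d * (x i - sample_mean n x) + d\<^sup>2)"
      by (simp add: sum.distrib sum_nonneg)
    also have "\<dots> = (\<Sum>i=1..n. (x i - \<mu>)\<^sup>2)"
      by (intro sum.cong refl) (simp add: d_def power2_eq_square algebra_simps)
    finally have "d\<^sup>2 \<le> (\<Sum>i=1..n. (x i - \<mu>)\<^sup>2) / real n" using n by (simp add: pos_le_divide_eq mult.commute)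
    thus ?thesis using mean by linarith
  qed
  have R0: "0 \<le> R" unfolding R using pos by simp
  have term_le: "(x i - sample_mean n x)\<^sup>2 * of_bool (\<delta> * real k * sample_var n x < (x i - sample_mean n x)\<^sup>2) \<le>
      4 * ((x i - \<mu>)\<^sup>2 * of_bool (R / 4 < (x i - \<mu>)\<^sup>2))" for i
  proof (cases "\<delta> * real k * sample_var n x < (x i - sample_mean n x)\<^sup>2")
    case True
    have "R \<le> \<delta> * real k * sample_var n x"
      unfolding R using v pos mult_left_mono[of "\<sigma> / 4" "sample_var n x" "\<delta> * real k"] by simp
    moreover have "(x i - sample_mean n x)\<^sup>2 \<le> 2 * (x i - \<mu>)\<^sup>2 + 2 * d\<^sup>2"
    proof -
      have "2 * (x i - \<mu>)\<^sup>2 + 2 * d\<^sup>2 - (x i - sample_mean n x)\<^sup>2 = ((x i - \<mu>) + d)\<^sup>2"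
        by (simp add: d_def power2_eq_square algebra_simps)
      moreover have "0 \<le> ((x i - \<mu>) + d)\<^sup>2" by simp
      ultimately show ?thesis by linarith
    qed
    ultimately have "R / 4 < (x i - \<mu>)\<^sup>2" "(x i - sample_mean n x)\<^sup>2 \<le> 4 * (x i - \<mu>)\<^sup>2"
      using True d2 R0 by linarith+
    thus ?thesis using True by simp
  next
    case False
    thus ?thesis by simp
  qed
  have "(\<Sum>i=1..n. (x i - sample_mean n x)\<^sup>2 * of_bool (\<delta> * real k * sample_var n x < (x i - sample_mean n x)\<^sup>2)) / real n
      \<le> (\<Sum>i=1..n. 4 * ((x i - \<mu>)\<^sup>2 * of_bool (R / 4 < (x i - \<mu>)\<^sup>2))) / real n"
    by (intro divide_right_mono sum_mono term_le) auto
  also have "\<dots> \<le> \<delta> * (\<sigma> / 4)" using tail by simp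
  also have "\<dots> \<le> \<delta> * sample_var n x" using v pos by (intro mult_left_mono) auto
  finally show ?thesis using v0 unfolding lindeberg_def by blast
qed

context iid_data
begin

lemma sample_var_Xs_measurable [measurable]: "(\<lambda>\<omega>. sample_var n (\<lambda>i. Xs i \<omega>)) \<in> borel_measurable M"
  by (rule sample_var_measurable) simp

text \<open>On the scale \<open>b n\<close> the range of the sample is negligible while the root of the sum of squares is
not; for \<open>m \<ge> \<epsilon> * n\<close> the threshold in the Lindeberg condition is at least a
fixed fraction of the sum of squares.\<close>

lemma lindeberg_normal_attraction:
  assumes "norming a b" "0 < \<epsilon>" "\<forall>\<^sub>F n in sequentially. \<epsilon> \<le> real (m n) / real n" "0 < \<delta>"
  shows "(\<lambda>n. prob {\<omega> \<in> space M. \<not> lindeberg n (m n) \<delta> (\<lambda>i. Xs i \<omega>)}) \<longlonglongrightarrow> 0"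
proof -
  have b: "0 < b n" for n using assms by (simp add: norming_def)
  \<comment> \<open>chosen so that \<open>4 * (\<eta> * b n)\<^sup>2 * n = \<delta> * (\<epsilon> * n) * ((b n)\<^sup>2 / 4)\<close>\<close>
  define \<eta> where "\<eta> = sqrt (\<delta> * \<epsilon>) / 4"
  have \<eta>: "0 < \<eta>" "\<eta>\<^sup>2 = \<delta> * \<epsilon> / 16" using assms by (auto simp: \<eta>_def power_divide)
  let ?A = "\<lambda>n. {\<omega> \<in> space M. \<exists>i\<in>{2..n}. \<eta> * b n \<le> \<bar>Xs i \<omega> - Xs 1 \<omega>\<bar>}"
  let ?B = "\<lambda>n. {\<omega> \<in> space M. real n * sample_var n (\<lambda>i. Xs i \<omega>) \<le> (b n)\<^sup>2 / 4}"
  have lim: "(\<lambda>n. prob (?A n) + prob (?B n)) \<longlonglongrightarrow> 0 + 0"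
    by (intro tendsto_add range_tendsto_0 sample_var_lower_bound) (use assms \<eta> in auto)
  hence lim: "(\<lambda>n. prob (?A n) + prob (?B n)) \<longlonglongrightarrow> 0" by simp
  have le: "\<forall>\<^sub>F n in sequentially. prob {\<omega> \<in> space M. \<not> lindeberg n (m n) \<delta> (\<lambda>i. Xs i \<omega>)} \<le> prob (?A n) + prob (?B n)"
    using assms(3) eventually_gt_at_top[of 0]
  proof eventually_elim
    case (elim n)
    have mn: "\<epsilon> * real n \<le> real (m n)" using elim by (simp add: pos_le_divide_eq)
    moreover have "0 < \<epsilon> * real n" using elim assms by simp
    ultimately have m0: "0 < m n" by linarith
    have A_ev: "?A n \<in> events"
    proof -
      have [measurable]: "Xs i \<in> borel_measurable M" if "i \<in> {2..n}" for i using that by simp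
      show ?thesis by measurable
    qed
    have "{\<omega> \<in> space M. \<not> lindeberg n (m n) \<delta> (\<lambda>i. Xs i \<omega>)} \<subseteq> ?A n \<union> ?B n"
    proof (rule subsetI, rule ccontr)
      fix \<omega> assume \<omega>: "\<omega> \<in> {\<omega> \<in> space M. \<not> lindeberg n (m n) \<delta> (\<lambda>i. Xs i \<omega>)}" "\<omega> \<notin> ?A n \<union> ?B n"
      have "lindeberg n (m n) \<delta> (\<lambda>i. Xs i \<omega>)"
      proof (rule lindeberg_of_small_range)
        show "(b n)\<^sup>2 / 4 < real n * sample_var n (\<lambda>i. Xs i \<omega>)" using \<omega> by auto
        show "0 < (b n)\<^sup>2 / 4" using b[of n] by simp
        show "\<bar>Xs j \<omega> - Xs 1 \<omega>\<bar> \<le> \<eta> * b n" if "j \<in> {1..n}" for j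
        proof (cases "j = 1")
          case True
          thus ?thesis using \<eta> b[of n] by simp
        next
          case False
          hence "j \<in> {2..n}" using that by auto
          thus ?thesis using \<omega> by force
        qed
        have "4 * (\<eta> * b n)\<^sup>2 * real n = \<delta> * (\<epsilon> * real n) * ((b n)\<^sup>2 / 4)"
          by (simp add: power_mult_distrib \<eta>(2))
        also have "\<dots> \<le> \<delta> * real (m n) * ((b n)\<^sup>2 / 4)"
          using mn assms by (intro mult_right_mono mult_left_mono) auto
        finally show "4 * (\<eta> * b n)\<^sup>2 * real n \<le> \<delta> * real (m n) * ((b n)\<^sup>2 / 4)" .
      qed (use elim m0 assms in auto)
      thus False using \<omega> by simp
    qed
    hence "prob {\<omega> \<in> space M. \<not> lindeberg n (m n) \<delta> (\<lambda>i. Xs i \<omega>)} \<le> prob (?A n \<union> ?B n)"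
      using A_ev by (intro finite_measure_mono) auto
    also have "\<dots> \<le> prob (?A n) + prob (?B n)" using A_ev by (intro measure_Un_le) auto
    finally show ?case .
  qed
  show ?thesis by (rule tendsto_sandwich[OF _ le tendsto_const lim]) simp
qed

lemma expectation_Xs:
  fixes g :: "real \<Rightarrow> real"
  assumes "1 \<le> i" and [measurable]: "g \<in> borel_measurable borel"
  shows "expectation (\<lambda>\<omega>. g (Xs i \<omega>)) = expectation (\<lambda>\<omega>. g (X \<omega>))"
    and "integrable M (\<lambda>\<omega>. g (X \<omega>)) \<Longrightarrow> integrable M (\<lambda>\<omega>. g (Xs i \<omega>))"
proof -
  note [measurable] = Xs_meas[OF assms(1)]
  have "expectation (\<lambda>\<omega>. g (Xs i \<omega>)) = (LINT x|distr M borel (Xs i). g x)"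
    by (subst integral_distr) auto
  also have "\<dots> = expectation (\<lambda>\<omega>. g (X \<omega>))"
    unfolding Xs_distr[OF assms(1)] by (subst integral_distr) auto
  finally show "expectation (\<lambda>\<omega>. g (Xs i \<omega>)) = expectation (\<lambda>\<omega>. g (X \<omega>))" .
  assume "integrable M (\<lambda>\<omega>. g (X \<omega>))"
  hence "integrable (distr M borel X) g" by (subst integrable_distr_eq) auto
  hence "integrable (distr M borel (Xs i)) g" unfolding Xs_distr[OF assms(1)] .
  thus "integrable M (\<lambda>\<omega>. g (Xs i \<omega>))" by (subst (asm) integrable_distr_eq) auto
qed

text \<open>The norming constant for \<open>n = 0\<close> is set to 1 because norming constants are positive; the empty sum
makes the quotient 0 in any case.\<close>

lemma norming_finite_variance:
  assumes sq: "integrable M (\<lambda>\<omega>. (X \<omega>)\<^sup>2)" and var: "0 < variance X"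
  shows "norming (\<lambda>n. real n * expectation X) (\<lambda>n. if n = 0 then 1 else sqrt (real n * variance X))"
proof -
  define \<sigma> where "\<sigma> = sqrt (variance X)"
  have \<sigma>: "0 < \<sigma>" "\<sigma>\<^sup>2 = variance X" using var by (auto simp: \<sigma>_def)
  have "weak_conv_m (\<lambda>n. distr M borel (\<lambda>\<omega>. (\<Sum>i<n. Xs (Suc i) \<omega> - expectation X) / sqrt (real n * \<sigma>\<^sup>2)))
      std_normal_distribution"
  proof (rule central_limit_theorem)
    show "indep_vars (\<lambda>i. borel) (\<lambda>i. Xs (Suc i)) UNIV"
    proof -
      have "indep_vars (\<lambda>i. PiM {Suc i} (\<lambda>_. borel)) (\<lambda>i \<omega>. restrict (\<lambda>k. Xs k \<omega>) {Suc i}) UNIV"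
        by (intro indep_vars_restrict[OF Xs_indep]) (auto simp: disjoint_family_on_def)
      hence "indep_vars (\<lambda>i. borel) (\<lambda>i \<omega>. (restrict (\<lambda>k. Xs k \<omega>) {Suc i}) (Suc i)) UNIV"
        by (rule indep_vars_compose2[where Y = "\<lambda>i f. f (Suc i)"]) auto
      thus ?thesis by simp
    qed
    show "expectation (Xs (Suc n)) = expectation X" for n using expectation_Xs(1)[of "Suc n" "\<lambda>x. x"] by simp
    show "integrable M (\<lambda>\<omega>. (Xs (Suc n) \<omega>)\<^sup>2)" for n
      using sq by (intro expectation_Xs(2)[of "Suc n" "\<lambda>x. x\<^sup>2"]) auto
    show "expectation (\<lambda>\<omega>. (Xs (Suc n) \<omega> - expectation (Xs (Suc n)))\<^sup>2) = \<sigma>\<^sup>2" for n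
      using expectation_Xs(1)[of "Suc n" "\<lambda>x. x"] expectation_Xs(1)[of "Suc n" "\<lambda>x. (x - expectation X)\<^sup>2"] \<sigma> by simp
    show "distr M borel (Xs (Suc n)) = distr M borel X" for n by (rule Xs_distr) simp
  qed (rule \<sigma>(1))
  moreover have "(\<Sum>i<n. Xs (Suc i) \<omega> - expectation X) / sqrt (real n * \<sigma>\<^sup>2) =
      ((\<Sum>i=1..n. Xs i \<omega>) - real n * expectation X) / (if n = 0 then 1 else sqrt (real n * variance X))" for n \<omega>
  proof -
    have "(\<Sum>i<n. Xs (Suc i) \<omega>) = (\<Sum>i=1..n. Xs i \<omega>)"
      by (rule sum.reindex_bij_witness[of _ "\<lambda>i. i - 1" Suc]) auto
    thus ?thesis using \<sigma> by (simp add: sum_subtractf)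
  qed
  ultimately show ?thesis unfolding norming_def using var by simp
qed

text \<open>The expected truncated second moment vanishes as the truncation level, which is proportional to
\<open>m\<close>, tends to infinity; by Markov's inequality the same holds for its empirical counterpart in
probability. The lower bound for the sample variance is the one for norming constants in the central
limit theorem.\<close>

lemma lindeberg_finite_variance:
  assumes sq: "integrable M (\<lambda>\<omega>. (X \<omega>)\<^sup>2)" and var: "0 < variance X"
    and m: "filterlim m at_top sequentially" and \<delta>: "0 < \<delta>"
  shows "(\<lambda>n. prob {\<omega> \<in> space M. \<not> lindeberg n (m n) \<delta> (\<lambda>i. Xs i \<omega>)}) \<longlonglongrightarrow> 0"
proof -
  define \<mu> where "\<mu> = expectation X"
  define \<sigma> where "\<sigma> = variance X"
  have \<sigma>: "0 < \<sigma>" using var by (simp add: \<sigma>_def)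
  have int_X: "integrable M X" by (rule square_integrable_imp_integrable[OF X_measurable sq])
  have int_D: "integrable M (\<lambda>\<omega>. (X \<omega> - \<mu>)\<^sup>2)"
    using int_X sq by (simp add: power2_diff)
  define R where "R n = \<delta> * real (m n) * \<sigma> / 4" for n
  define G where "G n = expectation (\<lambda>\<omega>. (X \<omega> - \<mu>)\<^sup>2 * of_bool (R n / 4 < (X \<omega> - \<mu>)\<^sup>2))" for n
  have R_lim: "filterlim R at_top sequentially"
  proof -
    have "filterlim (\<lambda>n. real (m n)) at_top sequentially"
      by (rule filterlim_compose[OF filterlim_real_sequentially m])
    hence "filterlim (\<lambda>n. (\<delta> * \<sigma> / 4) * real (m n)) at_top sequentially"
      using \<delta> \<sigma> by (intro filterlim_tendsto_pos_mult_at_top[OF tendsto_const]) auto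
    thus ?thesis unfolding R_def by (simp add: mult_ac)
  qed
  have "G \<longlonglongrightarrow> expectation (\<lambda>\<omega>. 0)"
    unfolding G_def[abs_def]
  proof (rule integral_dominated_convergence[where w = "\<lambda>\<omega>. (X \<omega> - \<mu>)\<^sup>2"])
    show "AE \<omega> in M. (\<lambda>n. (X \<omega> - \<mu>)\<^sup>2 * of_bool (R n / 4 < (X \<omega> - \<mu>)\<^sup>2)) \<longlonglongrightarrow> 0"
    proof (rule AE_I2)
      fix \<omega>
      have "\<forall>\<^sub>F n in sequentially. 4 * (X \<omega> - \<mu>)\<^sup>2 \<le> R n" using R_lim unfolding filterlim_at_top by blast
      hence "\<forall>\<^sub>F n in sequentially. (X \<omega> - \<mu>)\<^sup>2 * of_bool (R n / 4 < (X \<omega> - \<mu>)\<^sup>2) = 0"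
        by eventually_elim auto
      thus "(\<lambda>n. (X \<omega> - \<mu>)\<^sup>2 * of_bool (R n / 4 < (X \<omega> - \<mu>)\<^sup>2)) \<longlonglongrightarrow> 0"
        by (rule tendsto_eventually)
    qed
    show "(\<lambda>\<omega>. (X \<omega> - \<mu>)\<^sup>2 * of_bool (R n / 4 < (X \<omega> - \<mu>)\<^sup>2)) \<in> borel_measurable M" for n
      unfolding of_bool_def by measurable
  qed (use int_D in auto)
  hence G_lim: "G \<longlonglongrightarrow> 0" by simp
  let ?b = "\<lambda>n. if n = 0 then 1 else sqrt (real n * variance X)"
  let ?A = "\<lambda>n. {\<omega> \<in> space M. real n * sample_var n (\<lambda>i. Xs i \<omega>) \<le> (?b n)\<^sup>2 / 4}"
  have A_lim: "(\<lambda>n. prob (?A n)) \<longlonglongrightarrow> 0"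
    by (rule sample_var_lower_bound[OF norming_finite_variance[OF sq var]])
  have "(\<lambda>n. prob (?A n) + \<sigma> / (R n / 8) + 4 * G n / (\<delta> * \<sigma> / 4)) \<longlonglongrightarrow> 0 + 0 + 4 * 0 / (\<delta> * \<sigma> / 4)"
  proof (intro tendsto_add A_lim tendsto_divide tendsto_mult tendsto_const G_lim)
    have "filterlim (\<lambda>n. (1 / 8) * R n) at_top sequentially"
      by (rule filterlim_tendsto_pos_mult_at_top[OF tendsto_const _ R_lim]) simp
    thus "(\<lambda>n. \<sigma> / (R n / 8)) \<longlonglongrightarrow> 0"
      by (intro real_tendsto_divide_at_top[OF tendsto_const]) simp
  qed (use \<delta> \<sigma> in auto)
  hence lim: "(\<lambda>n. prob (?A n) + \<sigma> / (R n / 8) + 4 * G n / (\<delta> * \<sigma> / 4)) \<longlonglongrightarrow> 0" by simp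
  have "\<forall>\<^sub>F n in sequentially. 0 < R n" using R_lim unfolding filterlim_at_top_dense by blast
  hence le: "\<forall>\<^sub>F n in sequentially. prob {\<omega> \<in> space M. \<not> lindeberg n (m n) \<delta> (\<lambda>i. Xs i \<omega>)} \<le>
      prob (?A n) + \<sigma> / (R n / 8) + 4 * G n / (\<delta> * \<sigma> / 4)"
    using eventually_gt_at_top[of 0]
  proof eventually_elim
    case (elim n)
    define f where "f \<omega> = (\<Sum>i=1..n. (Xs i \<omega> - \<mu>)\<^sup>2) / real n" for \<omega>
    define g where "g \<omega> = (\<Sum>i=1..n. 4 * ((Xs i \<omega> - \<mu>)\<^sup>2 * of_bool (R n / 4 < (Xs i \<omega> - \<mu>)\<^sup>2))) / real n" for \<omega>
    have int_Di: "integrable M (\<lambda>\<omega>. (Xs i \<omega> - \<mu>)\<^sup>2)" "expectation (\<lambda>\<omega>. (Xs i \<omega> - \<mu>)\<^sup>2) = \<sigma>" if "i \<in> {1..n}" for i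
      using that int_D expectation_Xs[of i "\<lambda>x. (x - \<mu>)\<^sup>2"] by (auto simp: \<sigma>_def \<mu>_def)
    have int_tr: "integrable M (\<lambda>\<omega>. (X \<omega> - \<mu>)\<^sup>2 * of_bool (R n / 4 < (X \<omega> - \<mu>)\<^sup>2))"
    proof (rule Bochner_Integration.integrable_bound[OF int_D])
      show "(\<lambda>\<omega>. (X \<omega> - \<mu>)\<^sup>2 * of_bool (R n / 4 < (X \<omega> - \<mu>)\<^sup>2)) \<in> borel_measurable M"
        unfolding of_bool_def by measurable
    qed auto
    have tr_meas: "(\<lambda>x. (x - \<mu>)\<^sup>2 * of_bool (R n / 4 < (x - \<mu>)\<^sup>2)) \<in> borel_measurable borel"
      unfolding of_bool_def by measurable
    have int_tri: "integrable M (\<lambda>\<omega>. (Xs i \<omega> - \<mu>)\<^sup>2 * of_bool (R n / 4 < (Xs i \<omega> - \<mu>)\<^sup>2))"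
      "expectation (\<lambda>\<omega>. (Xs i \<omega> - \<mu>)\<^sup>2 * of_bool (R n / 4 < (Xs i \<omega> - \<mu>)\<^sup>2)) = G n" if "i \<in> {1..n}" for i
      using that expectation_Xs(2)[OF _ tr_meas int_tr, of i] expectation_Xs(1)[OF _ tr_meas, of i] by (auto simp: G_def)
    have int_f: "integrable M f"
      unfolding f_def[abs_def] by (intro integrable_divide Bochner_Integration.integrable_sum int_Di)
    have int_g: "integrable M g"
      unfolding g_def[abs_def] by (intro integrable_divide Bochner_Integration.integrable_sum integrable_mult_right int_tri)
    note [measurable] = borel_measurable_integrable[OF int_f] borel_measurable_integrable[OF int_g]
    have E_f: "expectation f = \<sigma>"
    proof -
      have "expectation f = (\<Sum>i=1..n. expectation (\<lambda>\<omega>. (Xs i \<omega> - \<mu>)\<^sup>2)) / real n"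
        unfolding f_def[abs_def] by (subst integral_divide_zero, subst Bochner_Integration.integral_sum) (auto intro: int_Di)
      thus ?thesis using elim int_Di by simp
    qed
    have E_g: "expectation g = 4 * G n"
    proof -
      have "expectation g = (\<Sum>i=1..n. expectation (\<lambda>\<omega>. 4 * ((Xs i \<omega> - \<mu>)\<^sup>2 * of_bool (R n / 4 < (Xs i \<omega> - \<mu>)\<^sup>2)))) / real n"
        unfolding g_def[abs_def]
        by (subst integral_divide_zero, subst Bochner_Integration.integral_sum; (intro integrable_mult_right int_tri)?) simp_all
      also have "\<dots> = (\<Sum>i=1..n. 4 * G n) / real n"
        by (intro arg_cong2[where f = "(/)"] sum.cong refl) (simp only: integral_mult_right_zero int_tri(2))
      finally show ?thesis using elim by simp
    qed
    let ?F = "{\<omega> \<in> space M. R n / 8 \<le> f \<omega>}" and ?G = "{\<omega> \<in> space M. \<delta> * \<sigma> / 4 \<le> g \<omega>}"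
    have "{\<omega> \<in> space M. \<not> lindeberg n (m n) \<delta> (\<lambda>i. Xs i \<omega>)} \<subseteq> (?A n \<union> ?F) \<union> ?G"
    proof (rule subsetI, rule ccontr)
      fix \<omega> assume \<omega>: "\<omega> \<in> {\<omega> \<in> space M. \<not> lindeberg n (m n) \<delta> (\<lambda>i. Xs i \<omega>)}" "\<omega> \<notin> (?A n \<union> ?F) \<union> ?G"
      have "real n * (\<sigma> / 4) < real n * sample_var n (\<lambda>i. Xs i \<omega>)"
        using \<omega> elim var by (auto simp: \<sigma>_def)
      hence "\<sigma> / 4 < sample_var n (\<lambda>i. Xs i \<omega>)" using elim by simp
      hence "lindeberg n (m n) \<delta> (\<lambda>i. Xs i \<omega>)"
        by (rule lindeberg_of_truncated[where R = "R n" and \<mu> = \<mu>, rotated])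
           (use \<omega> elim \<delta> \<sigma> in \<open>auto simp: f_def g_def R_def\<close>)
      thus False using \<omega> by simp
    qed
    hence "prob {\<omega> \<in> space M. \<not> lindeberg n (m n) \<delta> (\<lambda>i. Xs i \<omega>)} \<le> prob ((?A n \<union> ?F) \<union> ?G)"
      by (intro finite_measure_mono) auto
    also have "\<dots> \<le> prob (?A n \<union> ?F) + prob ?G" by (intro measure_Un_le) auto
    also have "prob (?A n \<union> ?F) \<le> prob (?A n) + prob ?F" by (intro measure_Un_le) auto
    also have "prob ?F \<le> expectation f / (R n / 8)"
      using elim by (intro integral_Markov_inequality_measure[OF int_f]) (auto simp: f_def intro!: divide_nonneg_nonneg sum_nonneg)
    also have "expectation f = \<sigma>" by (rule E_f)
    also have "prob ?G \<le> expectation g / (\<delta> * \<sigma> / 4)"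
      using \<delta> \<sigma> by (intro integral_Markov_inequality_measure[OF int_g]) (auto simp: g_def intro!: divide_nonneg_nonneg sum_nonneg)
    also have "expectation g = 4 * G n" by (rule E_g)
    finally show ?case by simp
  qed
  show ?thesis by (rule tendsto_sandwich[OF _ le tendsto_const lim]) simp
qed

lemma DAN_iff: "DAN M Xs \<longleftrightarrow> (\<exists>a b. norming a b)"
  unfolding DAN_def norming_def ..

end

lemma ratio_ge_1_of_log_ratio:
  assumes "LIM n sequentially. real (m n) / (2 * real n * ln (real n)) :> at_top"
  shows "\<forall>\<^sub>F n in sequentially. 1 \<le> real (m n) / real n"
proof -
  have "\<forall>\<^sub>F n in sequentially. 1 \<le> real (m n) / (2 * real n * ln (real n))"
    using assms unfolding filterlim_at_top by blast
  thus ?thesis using eventually_ge_at_top[of 3]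
  proof eventually_elim
    case (elim n)
    have "exp 1 \<le> real n" using exp_le elim by linarith
    hence ln: "1 \<le> ln (real n)" using elim by (simp add: ln_ge_iff)
    hence "2 * real n * ln (real n) \<le> real (m n)" using elim by (simp add: pos_le_divide_eq)
    moreover have "2 * real n * (1 / 2) \<le> 2 * real n * ln (real n)" using ln by (intro mult_left_mono) auto
    ultimately have "real n \<le> real (m n)" by simp
    thus ?case using elim by (simp add: pos_le_divide_eq)
  qed
qed

section \<open>Convergence of the bootstrap quantiles\<close>

theorem theorem4p1:
  fixes M :: "'a measure"
    and X :: "'a \<Rightarrow> real"
    and Xs :: "nat \<Rightarrow> 'a \<Rightarrow> real"
    and m :: "nat \<Rightarrow> nat"
    and w :: "nat \<Rightarrow> nat \<Rightarrow> nat \<Rightarrow> 'a \<Rightarrow> nat"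
    and \<alpha> :: real
    and z :: ereal
  assumes "prob_space M"
    and "iid_sample M X Xs"
    and "efron_weights M Xs m w"
    and "filterlim m at_top sequentially"
    and "0 < \<alpha>" and "\<alpha> \<le> 1"
    and "measure std_normal_distribution {x. ereal x \<le> z} = \<alpha>"
  shows
    "(integrable M (\<lambda>\<omega>. (X \<omega>)\<^sup>2) \<longrightarrow> 0 < prob_space.variance M X \<longrightarrow>
        ((\<lambda>n. real (m n)) \<in> o(\<lambda>n. (real n)\<^sup>2) \<longrightarrow>
           tendsto_in_prob M (boot_quantile T1 m Xs w \<alpha>) z (sequentially \<times>\<^sub>F sequentially)) \<and>
        ((\<lambda>n. real (m n)) \<in> o(\<lambda>n. (real n)\<^sup>2) \<longrightarrow> (\<lambda>n. real n) \<in> o(\<lambda>n. real (m n)) \<longrightarrow>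
           tendsto_in_prob M (boot_quantile T2 m Xs w \<alpha>) z (sequentially \<times>\<^sub>F sequentially))) \<and>
     (DAN M Xs \<longrightarrow>
        (LIM n sequentially. real (m n) / (2 * real n * ln (real n)) :> at_top) \<or>
        (integrable M (\<lambda>\<omega>. (X \<omega>)\<^sup>2) \<and> (LIM n sequentially. real (m n) / real n :> at_top)) \<longrightarrow>
        tendsto_in_prob M (boot_quantile T2 m Xs w \<alpha>) z (sequentially \<times>\<^sub>F sequentially)) \<and>
     (\<forall>\<epsilon>>0. DAN M Xs \<longrightarrow> (\<forall>\<^sub>F n in sequentially. real (m n) / real n \<ge> \<epsilon>) \<longrightarrow>
        tendsto_in_prob M (boot_quantile T3 m Xs w \<alpha>) z (sequentially \<times>\<^sub>F sequentially))"
proof -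
  interpret prob_space M by fact
  interpret E: efron_bootstrap M X Xs m w by unfold_locales fact+
  note converges = E.boot_quantile_converges[OF _ _ assms(4) _ assms(5-7)]
  have finite_var: "tendsto_in_prob M (boot_quantile T m Xs w \<alpha>) z (sequentially \<times>\<^sub>F sequentially)"
    if "integrable M (\<lambda>\<omega>. (X \<omega>)\<^sup>2)" "0 < variance X" "sample_statistic T" "bootstrap_clt T" for T
    by (rule converges[OF that(3,4)]) (rule E.lindeberg_finite_variance[OF that(1,2) assms(4)])
  have attracted: "tendsto_in_prob M (boot_quantile T m Xs w \<alpha>) z (sequentially \<times>\<^sub>F sequentially)"
    if DAN: "DAN M Xs" and \<epsilon>: "0 < \<epsilon>" "\<forall>\<^sub>F n in sequentially. \<epsilon> \<le> real (m n) / real n"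
      and T: "sample_statistic T" "bootstrap_clt T" for T \<epsilon>
  proof -
    obtain a b where "E.norming a b" using DAN unfolding E.DAN_iff by blast
    thus ?thesis by (intro converges[OF T]) (rule E.lindeberg_normal_attraction[OF _ \<epsilon>])
  qed
  have ge_1: "\<forall>\<^sub>F n in sequentially. 1 \<le> real (m n) / real n"
    if "(LIM n sequentially. real (m n) / (2 * real n * ln (real n)) :> at_top) \<or>
        (integrable M (\<lambda>\<omega>. (X \<omega>)\<^sup>2) \<and> (LIM n sequentially. real (m n) / real n :> at_top))"
    using that ratio_ge_1_of_log_ratio unfolding filterlim_at_top by blast
  show ?thesis
    using finite_var[OF _ _ sample_statistic_T1 bootstrap_clt_T1] finite_var[OF _ _ sample_statistic_T2 bootstrap_clt_T2]
      attracted[OF _ zero_less_one ge_1 sample_statistic_T2 bootstrap_clt_T2]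
      attracted[OF _ _ _ sample_statistic_T3 bootstrap_clt_T3]
    by blast
qed

end
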